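(* The lattice of monoid subvarieties of $\mathsf{var}_{\mathbb{M}}\{A^1\times B^1\}$ consists of exactly the following $13$ (pairwise distinct) varieties: \[ \mathsf{var}_{\mathbb{M}}\{T\},\ \mathsf{var}_{\mathbb{M}}\{S\},\ \mathsf{var}_{\mathbb{M}}\{N^1\},\ \mathsf{var}_{\mathbb{M}}\{M^1\},\ \mathsf{var}_{\mathbb{M}}\{L^1\},\ \mathsf{var}_{\mathbb{M}}\{R^1\},\ \mathsf{var}_{\mathbb{M}}\{B_0^1\}, \] \[ \mathsf{var}_{\mathbb{M}}\{A_0^1\},\ \mathsf{var}_{\mathbb{M}}\{Q^1\},\ \mathsf{var}_{\mathbb{M}}\{A^1\}\wedge\mathsf{var}_{\mathbb{M}}\{B^1\},\ \mathsf{var}_{\mathbb{M}}\{A^1\},\ \mathsf{var}_{\mathbb{M}}\{B^1\},\ \mathsf{var}_{\mathbb{M}}\{A^1\times B^1\}, \] and its covering relation is given as follows (where $X\lessdot Y$ abbreviates that the variety written $\mathsf{var}_{\mathbb{M}}\{Y\}$ covers $\mathsf{var}_{\mathbb{M}}\{X\}$, and $A^1\wedge B^1$ stands for $\mathsf{var}_{\mathbb{M}}\{A^1\}\wedge\mathsf{var}_{\mathbb{M}}\{B^1\}$): $T\lessdot S\lessdot N^1\lessdot M^1$; $M^1\lessdot L^1$, $M^1\lessdot R^1$; $L^1\lessdot B_0^1$, $R^1\lessdot B_0^1$; $B_0^1\lessdot A_0^1$, $B_0^1\lessdot Q^1$; $A_0^1\lessdot A^1\wedge B^1$, $Q^1\lessdot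 A^1\wedge B^1$; $A^1\wedge B^1\lessdot A^1$, $A^1\wedge B^1\lessdot B^1$; $A^1\lessdot A^1\times B^1$, $B^1\lessdot A^1\times B^1$; and there are no other covering pairs.
   Context: For a monoid (or class of monoids) $\mathfrak{C}$, $\mathsf{var}_{\mathbb{M}}\{\mathfrak{C}\}$ is the monoid variety it generates; $\wedge$ is the meet (intersection) of varieties. For a semigroup $X$ without identity element, $X^1$ is the monoid obtained by adjoining an identity element. $A=\{0,a,b,c,d,e\}$ is the semigroup with zero $0$ whose nonzero products are exactly $ae=a$, $be=b$, $cb=a$, $cd=c$, $db=b$, $dd=d$, $ea=a$, $eb=a$, $ec=c$, $ed=c$, $ee=e$ (all other products equal $0$). $B$ is the semigroup dual (anti-isomorphic) to $A$. The following are semigroups with zero given by presentations: $A_0=\langle a,b\mid a^2=a,\ b^2=b,\ ba=0\rangle$; $B_0=\langle a,b,c\mid a^2=a,\ b^2=b,\ ab=ba=0,\ ac=cb=c\rangle$; $L=\langle a,b\mid a^2=ba=0,\ ab=a,\ b^2=b\rangle$; $R=\langle a,b\mid a^2=ab=0,\ ba=a,\ b^2=b\rangle$; $M=\langle a,b,c\mid cb=a,\text{ and all other products equal to }0\rangle$; $N=\langle a\mid a^2=0\rangle$. $T$ is the trivial monoid and $S$ is the two-element semilattice monoid $\{0,1\}$. $\mathsf{var}_{\mathbb{M}}\{Q^1\}$ denotes the subvariety of $\mathsf{var}_{\mathbb{M}}\{A^1\times B^1\}$ consisting of all its monoids that satisfy the identity $x^2y^2\approx xy^2x$. *)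

theory Defs
  imports "HOL-Algebra.Product_Groups"
begin

section \<open>Monoid varieties\<close>

text \<open>
  HOL has no proper classes, so a class of monoids is a set of monoids whose carriers lie in a
  fixed universe type \<open>'u\<close>. Closure under homomorphic images, submonoids and direct products
  has to be imposed in one go: a product of members of the class lives over \<open>'u \<Rightarrow> 'u\<close> and in
  general has no copy over \<open>'u\<close>, although many quotients of its submonoids do have one.

  Let \<open>'u\<close> be infinite. Products indexed by subsets of \<open>'u\<close> suffice: a monoid over \<open>'u\<close> is an
  image of the monoid of words in its elements, there are at most as many pairs of such words as
  elements of \<open>'u\<close>, and one factor is needed for each pair of words that some member
  of the class separates. A variety in the usual sense is determined by its countable members, so
  the sets below ordered by inclusion are exactly the lattice of all monoid varieties.
\<close>

definition HSP :: "'u monoid set \<Rightarrow> 'u monoid set" where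
  "HSP K = {N. monoid N \<and>
     (\<exists>(I :: 'u set) F P h.
        (\<forall>i\<in>I. F i \<in> K) \<and>
        submonoid P (product_group I F) \<and>
        h \<in> hom ((product_group I F)\<lparr>carrier := P\<rparr>) N \<and>
        h \<one>\<^bsub>product_group I F\<^esub> = \<one>\<^bsub>N\<^esub> \<and>
        h ` P = carrier N)}"

definition monoid_variety :: "'u monoid set \<Rightarrow> bool" where
  "monoid_variety V \<longleftrightarrow> (\<forall>N\<in>V. monoid N) \<and> HSP V \<subseteq> V"

text \<open>
  The generating monoids may have carriers in another type than the universe; they enter through
  their isomorphic copies, which exist whenever the generators are finite and \<open>'u\<close> is infinite.
\<close>

definition var_generated :: "'a monoid set \<Rightarrow> 'u monoid set" where
  "var_generated K =
     \<Inter>{V. monoid_variety V \<and> (\<forall>G\<in>K. \<forall>N. monoid N \<and> G \<cong> N \<longrightarrow> N \<in> V)}"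

definition subvarieties :: "'u monoid set \<Rightarrow> 'u monoid set set" where
  "subvarieties W = {V. monoid_variety V \<and> V \<subseteq> W}"

definition covered_by :: "'u monoid set \<Rightarrow> 'u monoid set \<Rightarrow> bool" where
  "covered_by V W \<longleftrightarrow>
     V \<subset> W \<and> \<not> (\<exists>U. monoid_variety U \<and> V \<subset> U \<and> U \<subset> W)"


section \<open>Adjoining an identity element\<close>

text \<open>The new identity element is \<open>None\<close>.\<close>

fun mult_adjoin :: "('a \<Rightarrow> 'a \<Rightarrow> 'a) \<Rightarrow> 'a option \<Rightarrow> 'a option \<Rightarrow> 'a option" where
  "mult_adjoin f None y = y"
| "mult_adjoin f (Some x) None = Some x"
| "mult_adjoin f (Some x) (Some y) = Some (f x y)"

definition adjoin_one :: "'a set \<Rightarrow> ('a \<Rightarrow> 'a \<Rightarrow> 'a) \<Rightarrow> 'a option monoid" where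
  "adjoin_one X f = \<lparr>carrier = insert None (Some ` X), mult = mult_adjoin f, one = None\<rparr>"


section \<open>Semigroups with zero given by presentations\<close>

text \<open>
  In the free semigroup with zero over \<open>X\<close>, a nonempty word \<open>w\<close> is \<open>Some w\<close> and the zero is \<open>None\<close>.
\<close>

definition free_sg0 :: "'x set \<Rightarrow> 'x list option set" where
  "free_sg0 X = insert None (Some ` (lists X - {[]}))"

fun mult0 :: "'x list option \<Rightarrow> 'x list option \<Rightarrow> 'x list option" where
  "mult0 (Some u) (Some v) = Some (u @ v)"
| "mult0 _ _ = None"

inductive_set pres_cong ::
    "'x set \<Rightarrow> ('x list option \<times> 'x list option) set \<Rightarrow> ('x list option \<times> 'x list option) set"
  for X :: "'x set" and E :: "('x list option \<times> 'x list option) set" where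
  relator: "(u, v) \<in> E \<Longrightarrow> (u, v) \<in> pres_cong X E"
| refl: "u \<in> free_sg0 X \<Longrightarrow> (u, u) \<in> pres_cong X E"
| sym: "(u, v) \<in> pres_cong X E \<Longrightarrow> (v, u) \<in> pres_cong X E"
| trans: "(u, v) \<in> pres_cong X E \<Longrightarrow> (v, w) \<in> pres_cong X E \<Longrightarrow> (u, w) \<in> pres_cong X E"
| cong: "(u, v) \<in> pres_cong X E \<Longrightarrow> (u', v') \<in> pres_cong X E
    \<Longrightarrow> (mult0 u u', mult0 v v') \<in> pres_cong X E"

definition pres_mult ::
    "'x set \<Rightarrow> ('x list option \<times> 'x list option) set
      \<Rightarrow> 'x list option set \<Rightarrow> 'x list option set \<Rightarrow> 'x list option set" where
  "pres_mult X E p q = (\<Union>u\<in>p. \<Union>v\<in>q. pres_cong X E `` {mult0 u v})"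

definition presented_one ::
    "'x set \<Rightarrow> ('x list option \<times> 'x list option) set \<Rightarrow> 'x list option set option monoid" where
  "presented_one X E = adjoin_one (free_sg0 X // pres_cong X E) (pres_mult X E)"


section \<open>The monoids\<close>

datatype letter = La | Lb | Lc

type_synonym pres_monoid = "letter list option set option monoid"

definition A0_1 :: pres_monoid where
  "A0_1 = presented_one {La, Lb}
     {(Some [La, La], Some [La]), (Some [Lb, Lb], Some [Lb]), (Some [Lb, La], None)}"

definition B0_1 :: pres_monoid where
  "B0_1 = presented_one {La, Lb, Lc}
     {(Some [La, La], Some [La]), (Some [Lb, Lb], Some [Lb]),
      (Some [La, Lb], None), (Some [Lb, La], None),
      (Some [La, Lc], Some [Lc]), (Some [Lc, Lb], Some [Lc])}"

definition L_1 :: pres_monoid where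
  "L_1 = presented_one {La, Lb}
     {(Some [La, La], None), (Some [Lb, La], None),
      (Some [La, Lb], Some [La]), (Some [Lb, Lb], Some [Lb])}"

definition R_1 :: pres_monoid where
  "R_1 = presented_one {La, Lb}
     {(Some [La, La], None), (Some [La, Lb], None),
      (Some [Lb, La], Some [La]), (Some [Lb, Lb], Some [Lb])}"

definition M_1 :: pres_monoid where
  "M_1 = presented_one {La, Lb, Lc}
     (insert (Some [Lc, Lb], Some [La])
       {(Some [x, y], None) | x y. (x, y) \<noteq> (Lc, Lb)})"

definition N_1 :: pres_monoid where
  "N_1 = presented_one {La} {(Some [La, La], None)}"

definition T_mon :: "nat monoid" where
  "T_mon = \<lparr>carrier = {1}, mult = (*), one = 1\<rparr>"

definition S_mon :: "nat monoid" where
  "S_mon = \<lparr>carrier = {0, 1}, mult = (*), one = 1\<rparr>"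

datatype elt = Z | Ea | Eb | Ec | Ed | Ee

fun mult_A :: "elt \<Rightarrow> elt \<Rightarrow> elt" where
  "mult_A Ea Ee = Ea"
| "mult_A Eb Ee = Eb"
| "mult_A Ec Eb = Ea"
| "mult_A Ec Ed = Ec"
| "mult_A Ed Eb = Eb"
| "mult_A Ed Ed = Ed"
| "mult_A Ee Ea = Ea"
| "mult_A Ee Eb = Ea"
| "mult_A Ee Ec = Ec"
| "mult_A Ee Ed = Ec"
| "mult_A Ee Ee = Ee"
| "mult_A _ _ = Z"

definition A_1 :: "elt option monoid" where
  "A_1 = adjoin_one UNIV mult_A"

definition B_1 :: "elt option monoid" where
  "B_1 = adjoin_one UNIV (\<lambda>x y. mult_A y x)"


section \<open>The thirteen varieties\<close>

definition var_Q :: "'u monoid set" where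
  "var_Q = {N \<in> var_generated {A_1 \<times>\<times> B_1}.
     \<forall>x\<in>carrier N. \<forall>y\<in>carrier N.
       x [^]\<^bsub>N\<^esub> (2::nat) \<otimes>\<^bsub>N\<^esub> y [^]\<^bsub>N\<^esub> (2::nat) =
       x \<otimes>\<^bsub>N\<^esub> y [^]\<^bsub>N\<^esub> (2::nat) \<otimes>\<^bsub>N\<^esub> x}"

datatype label =
  vT | vS | vN | vM | vL | vR | vB0 | vA0 | vQ | vA_meet_B | vA | vB | vA_times_B

fun variety_of :: "label \<Rightarrow> 'u monoid set" where
  "variety_of vT = var_generated {T_mon}"
| "variety_of vS = var_generated {S_mon}"
| "variety_of vN = var_generated {N_1}"
| "variety_of vM = var_generated {M_1}"
| "variety_of vL = var_generated {L_1}"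
| "variety_of vR = var_generated {R_1}"
| "variety_of vB0 = var_generated {B0_1}"
| "variety_of vA0 = var_generated {A0_1}"
| "variety_of vQ = var_Q"
| "variety_of vA_meet_B = var_generated {A_1} \<inter> var_generated {B_1}"
| "variety_of vA = var_generated {A_1}"
| "variety_of vB = var_generated {B_1}"
| "variety_of vA_times_B = var_generated {A_1 \<times>\<times> B_1}"

end

(* Monoid varieties correspond to fully invariant congruences on words (Birkhoff, with products
   indexed by pairs of words). The identities of the nine join irreducible members of the lattice
   are described by scattered subwords of length at most three, and those of the remaining members
   are intersections of these.

   Let E be a fully invariant congruence containing the identities of A^1 x B^1. If E identifies two
   words that a join irreducible monoid X separates, then erasing letters and substituting squares
   leaves one specific identity "ax X" in E. Conversely these identities allow certain letters to
   be inserted into a word. Insertion only adds scattered subwords of length at most three, so each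
   word is E-equivalent to a "rich" one, which admits no further essential insertion, and rich words
   with the same remaining invariants are equal in A^1 x B^1. Hence E is determined by the set of
   the "ax X" that it contains, and only 13 sets can occur. *)

theory Submission
  imports Defs "HOL-Library.Multiset"
begin

section \<open>Scattered subwords of length two and three\<close>

text \<open>The nine join irreducibles form a poset whose order ideals correspond to the 13 labels;
  a congruence is recorded by an ideal. Squares enter for this reason: modulo the identities of A^1
  x B^1, a word in which every letter repeats is determined by its content and its pairs
  \<open>prec\<close>; triples count only if an end letter occurs once. So a retraction to two or
  three letters, some of them doubled, meets only a few classes, which finite inspection separates.
  Rich words are not normal forms: no canonical representative is computed, and rich words are
  compared only modulo A^1 x B^1. The obstacle to an insertion is a letter occurring once that
  stands in the way; features lower in the poset, on which the two words already agree, exclude it.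
  Below M^1 the order of such letters is lost, which insertions do not express, and commutativity
  takes over. The variety of Q^1 and the meet come without a generating monoid. The classification
  itself, applied to the identities of one member, determines both.\<close>

primrec prec :: "'a \<Rightarrow> 'a \<Rightarrow> 'a list \<Rightarrow> bool" where
  "prec x y [] \<longleftrightarrow> False"
| "prec x y (z # u) \<longleftrightarrow> z = x \<and> y \<in> set u \<or> prec x y u"

primrec prec3 :: "'a \<Rightarrow> 'a \<Rightarrow> 'a \<Rightarrow> 'a list \<Rightarrow> bool" where
  "prec3 x y z [] \<longleftrightarrow> False"
| "prec3 x y z (w # u) \<longleftrightarrow> w = x \<and> prec y z u \<or> prec3 x y z u"

lemma prec_append [simp]:
  "prec x y (u @ v) \<longleftrightarrow> prec x y u \<or> prec x y v \<or> x \<in> set u \<and> y \<in> set v"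
  by (induction u) auto

lemma prec3_append [simp]:
  "prec3 x y z (u @ v) \<longleftrightarrow> prec3 x y z u \<or> prec3 x y z v
     \<or> x \<in> set u \<and> prec y z v \<or> prec x y u \<and> z \<in> set v"
  by (induction u) auto

lemma prec_in_set: "prec x y u \<Longrightarrow> x \<in> set u \<and> y \<in> set u"
  by (induction u) auto

lemma prec3_imp_prec: "prec3 x y z u \<Longrightarrow> prec x y u \<and> prec y z u \<and> prec x z u"
  by (induction u) (auto dest: prec_in_set)

lemma prec_split: "prec x y u \<longleftrightarrow> (\<exists>p q. u = p @ x # q \<and> y \<in> set q)"
proof
  show "prec x y u \<Longrightarrow> \<exists>p q. u = p @ x # q \<and> y \<in> set q"
  proof (induction u)
    case (Cons z u)
    then show ?case
      by (metis append_Cons append_Nil prec.simps(2))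
  qed simp
qed auto

lemma prec_rev [simp]: "prec x y (rev u) \<longleftrightarrow> prec y x u"
  by (induction u) auto

lemma prec3_rev [simp]: "prec3 x y z (rev u) \<longleftrightarrow> prec3 z y x u"
  by (induction u) auto

lemma prec_concat_map:
  "prec x y (concat (map f u)) \<longleftrightarrow>
     (\<exists>a\<in>set u. prec x y (f a)) \<or> (\<exists>a b. prec a b u \<and> x \<in> set (f a) \<and> y \<in> set (f b))"
  by (induction u) auto

lemma prec3_concat_map:
  "prec3 x y z (concat (map f u)) \<longleftrightarrow>
     (\<exists>a\<in>set u. prec3 x y z (f a))
     \<or> (\<exists>a b. prec a b u \<and> (prec x y (f a) \<and> z \<in> set (f b) \<or> x \<in> set (f a) \<and> prec y z (f b)))
     \<or> (\<exists>a b c. prec3 a b c u \<and> x \<in> set (f a) \<and> y \<in> set (f b) \<and> z \<in> set (f c))"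
proof (induction u)
  case (Cons a u)
  then show ?case
    by (simp add: prec_concat_map ex_disj_distrib conj_disj_distribL conj_disj_distribR) blast
qed simp

lemma prec_map: "prec r s (map f u) \<longleftrightarrow> (\<exists>x y. f x = r \<and> f y = s \<and> prec x y u)"
  by (induction u) auto

lemma prec3_map:
  "prec3 r s t (map f u) \<longleftrightarrow> (\<exists>x y z. f x = r \<and> f y = s \<and> f z = t \<and> prec3 x y z u)"
  by (induction u) (auto simp: prec_map)

lemma prec_total: "x \<in> set u \<Longrightarrow> y \<in> set u \<Longrightarrow> x \<noteq> y \<Longrightarrow> prec x y u \<or> prec y x u"
  by (induction u) auto

text \<open>No \<open>z\<close> precedes a \<open>y\<close> and the two differ, so every
  \<open>z\<close> lies behind every \<open>y\<close>, in particular behind one that follows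
  \<open>x\<close>.\<close>

lemma prec3_if_prec_left:
  "prec x y u \<Longrightarrow> z \<in> set u \<Longrightarrow> \<not> prec z y u \<Longrightarrow> z \<noteq> y \<Longrightarrow> prec3 x y z u"
  by (induction u) (auto dest: prec_total prec_in_set)

lemma prec3_if_prec_right:
  "prec y z u \<Longrightarrow> x \<in> set u \<Longrightarrow> \<not> prec y x u \<Longrightarrow> x \<noteq> y \<Longrightarrow> prec3 x y z u"
  using prec3_if_prec_left[of z y "rev u" x] by simp

text \<open>Linear is the usual term for a letter with a single occurrence; repeated letters are
  called nonlinear in the comments.\<close>

definition lin :: "'a \<Rightarrow> 'a list \<Rightarrow> bool" where
  "lin x u \<longleftrightarrow> x \<in> set u \<and> \<not> prec x x u"

lemma lin_rev [simp]: "lin x (rev u) \<longleftrightarrow> lin x u"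
  by (simp add: lin_def)

text \<open>
  The feature of a join irreducible label is what its monoid recognises on top of the monoids
  strictly below it; two words form an identity of a variety iff they agree on the features of
  the join irreducible labels below it.
\<close>

fun feat :: "label \<Rightarrow> 'a list \<Rightarrow> 'a list set" where
  "feat vS u = {[x] | x. x \<in> set u}"
| "feat vN u = {[x] | x. prec x x u}"
| "feat vM u = {[x, y] | x y. lin x u \<and> lin y u \<and> prec x y u}"
| "feat vL u = {[x, y] | x y. lin y u \<and> prec x y u}"
| "feat vR u = {[x, y] | x y. lin x u \<and> prec x y u}"
| "feat vA0 u = {[x, y] | x y. prec x y u}"
| "feat vQ u = {[s, x, t] | s x t. lin s u \<and> lin t u \<and> prec3 s x t u}"
| "feat vA u = {[d, e, t] | d e t. lin t u \<and> \<not> prec t d u \<and> prec3 d e t u}"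
| "feat vB u = {[t, e, d] | t e d. lin t u \<and> \<not> prec d t u \<and> prec3 t e d u}"
| "feat _ u = {}"

text \<open>Birkhoff's representation of a finite distributive lattice: each element is encoded by
  the order ideal of the join irreducibles below it. The labels \<open>vT\<close>,
  \<open>vB0\<close>, \<open>vA_meet_B\<close> and \<open>vA_times_B\<close> are not join
  irreducible and so occur in no ideal.\<close>

fun down :: "label \<Rightarrow> label set" where
  "down vT = {}"
| "down vS = {vS}"
| "down vN = {vS, vN}"
| "down vM = {vS, vN, vM}"
| "down vL = {vS, vN, vM, vL}"
| "down vR = {vS, vN, vM, vR}"
| "down vB0 = {vS, vN, vM, vL, vR}"
| "down vA0 = {vS, vN, vM, vL, vR, vA0}"
| "down vQ = {vS, vN, vM, vL, vR, vQ}"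
| "down vA_meet_B = {vS, vN, vM, vL, vR, vA0, vQ}"
| "down vA = {vS, vN, vM, vL, vR, vA0, vQ, vA}"
| "down vB = {vS, vN, vM, vL, vR, vA0, vQ, vB}"
| "down vA_times_B = {vS, vN, vM, vL, vR, vA0, vQ, vA, vB}"

definition agree :: "label set \<Rightarrow> ('a list \<times> 'a list) set" where
  "agree D = {(u, v). \<forall>j\<in>D. feat j u = feat j v}"

abbreviation irreducibles :: "label set" where
  "irreducibles \<equiv> down vA_times_B"

abbreviation agree_all :: "('a list \<times> 'a list) set" where
  "agree_all \<equiv> agree irreducibles"

lemma Collect_list_eq:
  "{[x] | x. P x} = {[x] | x. Q x} \<longleftrightarrow> (\<forall>x. P x = Q x)" (is "?A = ?B \<longleftrightarrow> _")
proof
  assume eq: "?A = ?B"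
  have "P x \<longleftrightarrow> [x] \<in> ?A" for x
    by simp
  also have "[x] \<in> ?A \<longleftrightarrow> Q x" for x
    unfolding eq by simp
  finally show "\<forall>x. P x = Q x"
    by blast
qed simp

lemma Collect_list2_eq:
  "{[x, y] | x y. P x y} = {[x, y] | x y. Q x y} \<longleftrightarrow> (\<forall>x y. P x y = Q x y)"
  (is "?A = ?B \<longleftrightarrow> _")
proof
  assume eq: "?A = ?B"
  have "P x y \<longleftrightarrow> [x, y] \<in> ?A" for x y
    by simp
  also have "[x, y] \<in> ?A \<longleftrightarrow> Q x y" for x y
    unfolding eq by simp
  finally show "\<forall>x y. P x y = Q x y"
    by blast
qed simp

lemma Collect_list3_eq:
  "{[x, y, z] | x y z. P x y z} = {[x, y, z] | x y z. Q x y z} \<longleftrightarrow> (\<forall>x y z. P x y z = Q x y z)"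
  (is "?A = ?B \<longleftrightarrow> _")
proof
  assume eq: "?A = ?B"
  have "P x y z \<longleftrightarrow> [x, y, z] \<in> ?A" for x y z
    by simp
  also have "[x, y, z] \<in> ?A \<longleftrightarrow> Q x y z" for x y z
    unfolding eq by simp
  finally show "\<forall>x y z. P x y z = Q x y z"
    by blast
qed simp

lemma feat_S: "feat vS u = feat vS v \<longleftrightarrow> set u = set v"
  unfolding feat.simps Collect_list_eq by blast

lemma feat_N: "feat vN u = feat vN v \<longleftrightarrow> (\<forall>x. prec x x u = prec x x v)"
  by (simp only: feat.simps Collect_list_eq Collect_list2_eq Collect_list3_eq)

lemma feat_M: "feat vM u = feat vM v \<longleftrightarrow>
    (\<forall>x y. (lin x u \<and> lin y u \<and> prec x y u) = (lin x v \<and> lin y v \<and> prec x y v))"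
  by (simp only: feat.simps Collect_list_eq Collect_list2_eq Collect_list3_eq)

lemma feat_L: "feat vL u = feat vL v \<longleftrightarrow>
    (\<forall>x y. (lin y u \<and> prec x y u) = (lin y v \<and> prec x y v))"
  by (simp only: feat.simps Collect_list_eq Collect_list2_eq Collect_list3_eq)

lemma feat_R: "feat vR u = feat vR v \<longleftrightarrow>
    (\<forall>x y. (lin x u \<and> prec x y u) = (lin x v \<and> prec x y v))"
  by (simp only: feat.simps Collect_list_eq Collect_list2_eq Collect_list3_eq)

lemma feat_A0: "feat vA0 u = feat vA0 v \<longleftrightarrow> (\<forall>x y. prec x y u = prec x y v)"
  by (simp only: feat.simps Collect_list_eq Collect_list2_eq Collect_list3_eq)

lemma feat_Q: "feat vQ u = feat vQ v \<longleftrightarrow>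
    (\<forall>s x t. (lin s u \<and> lin t u \<and> prec3 s x t u) = (lin s v \<and> lin t v \<and> prec3 s x t v))"
  by (simp only: feat.simps Collect_list_eq Collect_list2_eq Collect_list3_eq)

lemma feat_A: "feat vA u = feat vA v \<longleftrightarrow>
    (\<forall>d e t. (lin t u \<and> \<not> prec t d u \<and> prec3 d e t u) = (lin t v \<and> \<not> prec t d v \<and> prec3 d e t v))"
  by (simp only: feat.simps Collect_list_eq Collect_list2_eq Collect_list3_eq)

lemma feat_B: "feat vB u = feat vB v \<longleftrightarrow>
    (\<forall>t e d. (lin t u \<and> \<not> prec d t u \<and> prec3 t e d u) = (lin t v \<and> \<not> prec d t v \<and> prec3 t e d v))"
  by (simp only: feat.simps Collect_list_eq Collect_list2_eq Collect_list3_eq)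

lemmas feat_eq = feat_S feat_N feat_M feat_L feat_R feat_A0 feat_Q feat_A feat_B

declare feat.simps [simp del]

text \<open>The feature \<open>vQ\<close> follows from the others: for linear \<open>s\<close> and
  \<open>t\<close>, either \<open>t\<close> precedes \<open>s\<close>, which excludes the triple in
  both words, or the triple is an instance of the condition for \<open>vA\<close>. The lower
  features depend on content and pairs alone.\<close>

lemma agree_allI:
  assumes "set u = set v" "\<And>x y. prec x y u = prec x y v"
    "\<And>d e t. lin t u \<Longrightarrow> lin t v \<Longrightarrow> \<not> prec t d u \<Longrightarrow> \<not> prec t d v \<Longrightarrow> prec3 d e t u = prec3 d e t v"
    "\<And>d e t. lin t u \<Longrightarrow> lin t v \<Longrightarrow> \<not> prec d t u \<Longrightarrow> \<not> prec d t v \<Longrightarrow> prec3 t e d u = prec3 t e d v"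
  shows "(u, v) \<in> agree_all"
proof -
  have l: "lin x u = lin x v" for x
    by (simp add: lin_def assms(1,2))
  have "prec3 s x t u = prec3 s x t v" if "lin s u" "lin t u" for s x t
  proof (cases "prec t s u")
    case True
    then have "\<not> prec s t u"
    proof -
      have "\<not> prec s t u" if "lin s u" "lin t u" "prec t s u"
        using that by (induction u) (auto simp: lin_def dest: prec_in_set)
      with that True show ?thesis by blast
    qed
    then show ?thesis
      using prec3_imp_prec[of s x t] assms(2) by blast
  next
    case False
    then show ?thesis
      using assms(2,3) that l by blast
  qed
  then show ?thesis
    using assms l by (auto simp: agree_def feat_eq)
qed

section \<open>Congruences on words\<close>

text \<open>Without linear letters the conditions on triples are vacuous.\<close>

lemma agree_all_nonlinI:
  assumes "set u = set v" "\<And>x y. prec x y u = prec x y v" "\<And>x. x \<in> set u \<Longrightarrow> prec x x u"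
  shows "(u, v) \<in> agree_all"
  using assms by (intro agree_allI) (auto simp: lin_def)

lemma agree_allD:
  assumes "(u, v) \<in> agree_all"
  shows "set u = set v" "prec x y u = prec x y v"
    "lin t u \<Longrightarrow> \<not> prec t d u \<Longrightarrow> prec3 d e t u = prec3 d e t v"
    "lin t u \<Longrightarrow> \<not> prec d t u \<Longrightarrow> prec3 t e d u = prec3 t e d v"
proof -
  have f: "feat vS u = feat vS v" "feat vA0 u = feat vA0 v" "feat vA u = feat vA v" "feat vB u = feat vB v"
    using assms by (auto simp: agree_def)
  show s: "set u = set v" and p: "prec x y u = prec x y v" for x y
    using f by (simp_all add: feat_eq)
  then have "lin t u = lin t v"
    by (simp add: lin_def)
  then show "lin t u \<Longrightarrow> \<not> prec t d u \<Longrightarrow> prec3 d e t u = prec3 d e t v"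
    "lin t u \<Longrightarrow> \<not> prec d t u \<Longrightarrow> prec3 t e d u = prec3 t e d v"
    using f(3,4) p unfolding feat_A feat_B by metis+
qed

lemma agree_all_rev: "(rev u, rev v) \<in> agree_all \<longleftrightarrow> (u, v) \<in> agree_all"
proof -
  have "(rev u, rev v) \<in> agree_all" if "(u, v) \<in> agree_all" for u v :: "'a list"
    using agree_allD[OF that] by (intro agree_allI) simp_all
  from this[of u v] this[of "rev u" "rev v"] show ?thesis
    by auto
qed

text \<open>The only triples at stake are \<open>x x t\<close> and \<open>t x x\<close> with
  \<open>t\<close> linear and all \<open>x\<close> on one side of \<open>t\<close>; they are present
  already because \<open>x\<close> occurs twice.\<close>

lemma agree_dup:
  assumes "prec x x (p @ x # q)"
  shows "(p @ x # q, p @ x # x # q) \<in> agree_all"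
proof (rule agree_allI)
  let ?u = "p @ x # q" and ?v = "p @ x # x # q"
  show "set ?u = set ?v" by auto
  show "prec y z ?u = prec y z ?v" for y z
    using assms by auto
  show "prec3 d e t ?u = prec3 d e t ?v" if "lin t ?u" "\<not> prec t d ?u" for d e t
  proof -
    have "t \<noteq> x" using assms that(1) by (auto simp: lin_def)
    moreover have "prec3 x x t ?u" if "d = x" "e = x" "t \<in> set q"
      using prec3_if_prec_left[OF assms, of t] that \<open>\<not> prec t d ?u\<close> \<open>t \<noteq> x\<close> by auto
    ultimately show ?thesis by auto
  qed
  show "prec3 t e d ?u = prec3 t e d ?v" if "lin t ?u" "\<not> prec d t ?u" for d e t
  proof -
    have "t \<noteq> x" using assms that(1) by (auto simp: lin_def)
    moreover have "prec3 t x x ?u" if "d = x" "e = x" "t \<in> set p"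
      using prec3_if_prec_right[OF assms, of t] that \<open>\<not> prec d t ?u\<close> \<open>t \<noteq> x\<close> by auto
    ultimately show ?thesis by auto
  qed
qed

text \<open>The identity of a label holds in one of the thirteen varieties iff the label is not in
  its ideal (\<open>ax_in_agree_down\<close>), so its failure marks the label. The identity for
  \<open>vA0\<close> is the one that defines \<open>var_Q\<close>, and the one for \<open>vB\<close>
  is that for \<open>vA\<close> read backwards.\<close>

fun ax :: "label \<Rightarrow> nat list \<times> nat list" where
  "ax vS = ([0], [])"
| "ax vN = ([0], [0, 0])"
| "ax vM = ([0, 1], [1, 0])"
| "ax vL = ([0, 1, 1], [1, 0, 1])"
| "ax vR = ([1, 1, 0], [1, 0, 1])"
| "ax vA0 = ([0, 0, 1, 1], [0, 1, 1, 0])"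
| "ax vQ = ([0, 1, 2, 0], [0, 1, 0, 2, 0])"
| "ax vA = ([0, 0, 1, 1, 2, 0], [0, 1, 1, 0, 2, 0])"
| "ax vB = ([0, 2, 1, 1, 0, 0], [0, 2, 0, 1, 1, 0])"
| "ax _ = ([], [])"

text \<open>Fully invariant congruences on the free monoid over countably many letters, above the
  identities of A^1 x B^1: the equational theories of its subvarieties.\<close>

locale word_congruence =
  fixes E :: "(nat list \<times> nat list) set"
  assumes sym: "(u, v) \<in> E \<Longrightarrow> (v, u) \<in> E"
    and trans [trans]: "(u, v) \<in> E \<Longrightarrow> (v, w) \<in> E \<Longrightarrow> (u, w) \<in> E"
    and cong: "(u, v) \<in> E \<Longrightarrow> (p @ u @ q, p @ v @ q) \<in> E"
    and subst: "(u, v) \<in> E \<Longrightarrow> (concat (map f u), concat (map f v)) \<in> E"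
    and agree_all_le: "agree_all \<subseteq> E"
begin

lemma refl [simp]: "(u, u) \<in> E"
  using agree_all_le by (auto simp: agree_def)

lemma agreeE: "(u, v) \<in> agree_all \<Longrightarrow> (u, v) \<in> E"
  using agree_all_le by blast

lemma trans2: "(u, v) \<in> E \<Longrightarrow> (u, u') \<in> E \<Longrightarrow> (v, v') \<in> E \<Longrightarrow> (u', v') \<in> E"
  by (rule trans[OF trans[OF sym]])

lemma cong_Cons: "(u, v) \<in> E \<Longrightarrow> (x # u, x # v) \<in> E"
  using cong[of u v "[x]" "[]"] by simp

text \<open>A^1 x B^1 is anti-isomorphic to itself, so \<open>agree_all\<close> is closed under
  reversal. Interpreting the locale at the mirror image of \<open>E\<close> turns results about
  \<open>vL\<close> and \<open>vA\<close> into results about \<open>vR\<close> and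
  \<open>vB\<close>.\<close>

lemma word_congruence_rev: "word_congruence {(u, v). (rev u, rev v) \<in> E}"
proof
  fix u v assume "(u, v) \<in> {(u, v). (rev u, rev v) \<in> E}"
  then have uv: "(rev u, rev v) \<in> E" by simp
  show "(v, u) \<in> {(u, v). (rev u, rev v) \<in> E}"
    using sym[OF uv] by simp
  show "(p @ u @ q, p @ v @ q) \<in> {(u, v). (rev u, rev v) \<in> E}" for p q
    using cong[OF uv] by simp
  show "(concat (map f u), concat (map f v)) \<in> {(u, v). (rev u, rev v) \<in> E}" for f
    using subst[OF uv, of "rev \<circ> f"] by (simp add: rev_concat rev_map)
  show "(u, w) \<in> {(u, v). (rev u, rev v) \<in> E}" if "(v, w) \<in> {(u, v). (rev u, rev v) \<in> E}" for w
    using trans[OF uv] that by simp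
qed (use agreeE agree_all_rev in auto)

section \<open>Implications between the test identities\<close>

lemma S_imp_N: "ax vS \<in> E \<Longrightarrow> ax vN \<in> E"
  using subst[of "[0]" "[]" "\<lambda>_. [0, 0]"] by (auto intro: trans sym)

text \<open>Idempotency gives xy = xyxy and yx = yxyx, and the two squares have the same pairs and
  no linear letter.\<close>

lemma N_imp_M: assumes "ax vN \<in> E" shows "ax vM \<in> E"
proof -
  have *: "([0, 1], [0, 1, 0, 1]) \<in> E" "([1, 0], [1, 0, 1, 0]) \<in> E"
    using assms subst[of "[0]" "[0, 0]" "\<lambda>_. [0, 1]"] subst[of "[0]" "[0, 0]" "\<lambda>_. [1, 0]"] by auto
  have "([0, 1, 0, 1], [1, 0, 1, 0]) \<in> E"
    by (rule agreeE, rule agree_all_nonlinI) auto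
  then show ?thesis
    using trans[OF *(1) trans[OF _ sym[OF *(2)]]] by simp
qed

lemma M_imp_L: "ax vM \<in> E \<Longrightarrow> ax vL \<in> E"
  using cong[of "[0, 1]" "[1, 0]" "[]" "[1]"] by simp

lemma M_imp_R: "ax vM \<in> E \<Longrightarrow> ax vR \<in> E"
  using cong[of "[1, 0]" "[0, 1]" "[1]" "[]"] by (simp add: sym)

text \<open>Squaring the linear letter in xyy = yxy gives xxyy = yxxy, and yxxy has the same pairs
  as xyyx.\<close>

lemma L_imp_A0: assumes "ax vL \<in> E" shows "ax vA0 \<in> E"
proof -
  have "([0, 0, 1, 1], [1, 0, 0, 1]) \<in> E"
    using assms subst[of "[0, 1, 1]" "[1, 0, 1]" "\<lambda>x. if x = 0 then [0, 0] else [1]"] by simp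
  also have "([1, 0, 0, 1], [0, 1, 1, 0]) \<in> E"
    by (rule agreeE, rule agree_all_nonlinI) auto
  finally show ?thesis by simp
qed

lemma R_imp_A0: assumes "ax vR \<in> E" shows "ax vA0 \<in> E"
  using assms subst[of "[1, 1, 0]" "[1, 0, 1]" "\<lambda>x. if x = 0 then [1, 1] else [0]"] by simp

text \<open>Double the last x of xyzx, then move one copy to the left across z.\<close>

lemma L_imp_Q: assumes "ax vL \<in> E" shows "ax vQ \<in> E"
proof -
  have "([0, 1, 2] @ 0 # [], [0, 1, 2] @ 0 # 0 # []) \<in> E"
    by (rule agreeE, rule agree_dup) simp
  then have "([0, 1, 2, 0], [0, 1, 2, 0, 0]) \<in> E"
    by simp
  also have "([0, 1] @ [2, 0, 0] @ [], [0, 1] @ [0, 2, 0] @ []) \<in> E"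
    using assms subst[of "[0, 1, 1]" "[1, 0, 1]" "\<lambda>x. if x = 0 then [2] else [0]"]
    by (intro cong) simp
  then have "([0, 1, 2, 0, 0], [0, 1, 0, 2, 0]) \<in> E"
    by simp
  finally show ?thesis by simp
qed

lemma R_imp_Q: assumes "ax vR \<in> E" shows "ax vQ \<in> E"
proof -
  have "([] @ 0 # [1, 2, 0], [] @ 0 # 0 # [1, 2, 0]) \<in> E"
    by (rule agreeE, rule agree_dup) simp
  then have "([0, 1, 2, 0], [0, 0, 1, 2, 0]) \<in> E"
    by simp
  also have "([] @ [0, 0, 1] @ [2, 0], [] @ [0, 1, 0] @ [2, 0]) \<in> E"
    using assms subst[of "[1, 1, 0]" "[1, 0, 1]" "\<lambda>x. if x = 0 then [1] else [0]"]
    by (intro cong) simp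
  then have "([0, 0, 1, 2, 0], [0, 1, 0, 2, 0]) \<in> E"
    by simp
  finally show ?thesis by simp
qed

lemma A0_imp_A: "ax vA0 \<in> E \<Longrightarrow> ax vA \<in> E"
  using cong[of "[0, 0, 1, 1]" "[0, 1, 1, 0]" "[]" "[2, 0]"] by simp

lemma A0_imp_B: assumes "ax vA0 \<in> E" shows "ax vB \<in> E"
proof -
  have "([1, 1, 0, 0], [1, 0, 0, 1]) \<in> E"
    using assms subst[of "[0, 0, 1, 1]" "[0, 1, 1, 0]" "\<lambda>x. if x = 0 then [1] else [0]"] by simp
  also have "([1, 0, 0, 1], [0, 1, 1, 0]) \<in> E"
    by (rule agreeE, rule agree_all_nonlinI) auto
  finally have "([0, 2] @ [1, 1, 0, 0] @ [], [0, 2] @ [0, 1, 1, 0] @ []) \<in> E"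
    by (rule cong)
  then show ?thesis by simp
qed

text \<open>Squaring y in \<open>ax vQ\<close> gives xyyzx = xyyxzx; a further initial x is absorbed
  because doubling a nonlinear letter is free.\<close>

lemma Q_imp_A: assumes "ax vQ \<in> E" shows "ax vA \<in> E"
proof -
  have *: "([0, 1, 1, 2, 0], [0, 1, 1, 0, 2, 0]) \<in> E"
    using assms subst[of "[0, 1, 2, 0]" "[0, 1, 0, 2, 0]" "\<lambda>x. if x = 1 then [1, 1] else [x]"] by simp
  then have "([0, 0, 1, 1, 2, 0], [0, 0, 1, 1, 0, 2, 0]) \<in> E"
    by (rule cong_Cons)
  also have "([] @ 0 # [1, 1, 0, 2, 0], [] @ 0 # 0 # [1, 1, 0, 2, 0]) \<in> E"
    by (rule agreeE, rule agree_dup) simp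
  then have "([0, 0, 1, 1, 0, 2, 0], [0, 1, 1, 0, 2, 0]) \<in> E"
    by (simp add: sym)
  finally show ?thesis by simp
qed

end

context word_congruence begin

interpretation rev: word_congruence "{(u, v). (rev u, rev v) \<in> E}"
  by (rule word_congruence_rev)

lemma Q_imp_B: assumes "ax vQ \<in> E" shows "ax vB \<in> E"
proof -
  have "([0, 2, 1, 0], [0, 2, 0, 1, 0]) \<in> E"
    using assms subst[of "[0, 1, 2, 0]" "[0, 1, 0, 2, 0]" "\<lambda>x. if x = 1 then [2] else if x = 2 then [1] else [0]"]
    by simp
  then have "ax vA \<in> {(u, v). (rev u, rev v) \<in> E}"
    using assms by (intro rev.Q_imp_A) simp
  then show ?thesis by simp
qed

end

section \<open>Retractions to at most three letters that lead from a separated pair to a test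
  identity\<close>

lemma lin_antisym: "lin x u \<Longrightarrow> lin y u \<Longrightarrow> prec x y u \<Longrightarrow> \<not> prec y x u"
  by (induction u) (auto simp: lin_def dest: prec_in_set)

text \<open>No \<open>s\<close> stands behind a \<open>d\<close>, so \<open>s\<close> stands before
  the \<open>d\<close> that starts the triple and can replace it.\<close>

lemma prec3_replace_first:
  "prec3 d e t u \<Longrightarrow> s \<in> set u \<Longrightarrow> \<not> prec d s u \<Longrightarrow> s \<noteq> d \<Longrightarrow> prec3 s e t u"
  by (induction u) (auto dest: prec_in_set prec3_imp_prec)

text \<open>
  Erases the letters outside \<open>xs\<close>; the remaining ones are replaced by their index in \<open>xs\<close>, which is
  doubled when it lies in \<open>D\<close>.
\<close>

definition keep :: "'a list \<Rightarrow> nat set \<Rightarrow> 'a \<Rightarrow> nat list" where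
  "keep xs D a = (if a \<in> set xs
     then let i = (THE i. i < length xs \<and> xs ! i = a) in if i \<in> D then [i, i] else [i] else [])"

abbreviation retract :: "'a list \<Rightarrow> nat set \<Rightarrow> 'a list \<Rightarrow> nat list" where
  "retract xs D u \<equiv> concat (map (keep xs D) u)"

lemma keep_nth:
  assumes "distinct xs" "i < length xs"
  shows "keep xs D (xs ! i) = (if i \<in> D then [i, i] else [i])"
proof -
  have "(THE j. j < length xs \<and> xs ! j = xs ! i) = i"
    using assms nth_eq_iff_index_eq by blast
  then show ?thesis
    using assms by (simp add: keep_def)
qed

lemma in_keep: "distinct xs \<Longrightarrow> i \<in> set (keep xs D a) \<longleftrightarrow> i < length xs \<and> xs ! i = a"
  and prec_keep: "distinct xs \<Longrightarrow> prec i j (keep xs D a) \<longleftrightarrow> i = j \<and> i \<in> D \<and> i < length xs \<and> xs ! i = a"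
proof -
  assume xs: "distinct xs"
  have "(i \<in> set (keep xs D a) \<longleftrightarrow> i < length xs \<and> xs ! i = a) \<and>
      (prec i j (keep xs D a) \<longleftrightarrow> i = j \<and> i \<in> D \<and> i < length xs \<and> xs ! i = a)"
  proof (cases "a \<in> set xs")
    case True
    then obtain k where k: "k < length xs" "a = xs ! k"
      by (metis in_set_conv_nth)
    then have "i < length xs \<and> xs ! i = a \<longleftrightarrow> i = k"
      using nth_eq_iff_index_eq[OF xs] by auto
    then show ?thesis
      using keep_nth[OF xs k(1), of D] k(2) by auto
  next
    case False
    then show ?thesis
      by (auto simp: keep_def)
  qed
  then show "i \<in> set (keep xs D a) \<longleftrightarrow> i < length xs \<and> xs ! i = a"
    "prec i j (keep xs D a) \<longleftrightarrow> i = j \<and> i \<in> D \<and> i < length xs \<and> xs ! i = a"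
    by blast+
qed

lemma prec3_keep: "\<not> prec3 i j k (keep xs D a)"
  by (auto simp: keep_def Let_def)

lemma in_retract: "distinct xs \<Longrightarrow> i \<in> set (retract xs D u) \<longleftrightarrow> i < length xs \<and> xs ! i \<in> set u"
  by (auto simp: in_keep)

lemma prec_retract:
  "distinct xs \<Longrightarrow> prec i j (retract xs D u) \<longleftrightarrow> i < length xs \<and> j < length xs \<and>
     (prec (xs ! i) (xs ! j) u \<or> i = j \<and> i \<in> D \<and> xs ! i \<in> set u)"
  unfolding prec_concat_map by (auto simp: in_keep prec_keep)

lemma prec3_retract:
  "distinct xs \<Longrightarrow> prec3 i j k (retract xs D u) \<longleftrightarrow> i < length xs \<and> j < length xs \<and> k < length xs \<and>
     (prec3 (xs ! i) (xs ! j) (xs ! k) u \<or> i = j \<and> i \<in> D \<and> prec (xs ! i) (xs ! k) u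
      \<or> j = k \<and> j \<in> D \<and> prec (xs ! i) (xs ! j) u)"
  unfolding prec3_concat_map by (auto simp: in_keep prec_keep prec3_keep)

lemmas retract = in_retract prec_retract prec3_retract

text \<open>With bounded quantifiers, \<open>numeral_cases\<close> expands all conditions into
  finitely many, so a retract known only through its pairs and triples can be matched with a
  concrete word.\<close>

lemma agree_all_numeralI:
  fixes u v :: "nat list"
  assumes "set u \<subseteq> {..<n}" "set v \<subseteq> {..<n}" "\<forall>i<n. i \<in> set u" "\<forall>i<n. i \<in> set v"
    and P: "\<forall>i<n. \<forall>j<n. prec i j u = prec i j v"
    and A: "\<forall>t<n. \<not> prec t t u \<longrightarrow> (\<forall>d<n. \<not> prec t d u \<longrightarrow> (\<forall>e<n. prec3 d e t u = prec3 d e t v))"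
    and B: "\<forall>t<n. \<not> prec t t u \<longrightarrow> (\<forall>d<n. \<not> prec d t u \<longrightarrow> (\<forall>e<n. prec3 t e d u = prec3 t e d v))"
  shows "(u, v) \<in> agree_all"
proof (rule agree_allI)
  show s: "set u = set v"
    using assms(1-4) by blast
  show "prec i j u = prec i j v" for i j
    using P assms(1,2) prec_in_set[of i j u] prec_in_set[of i j v] by blast
  have *: "d < n \<and> e < n \<and> t < n" if "prec3 d e t u \<or> prec3 d e t v" for d e t
  proof -
    have "d \<in> set u \<union> set v" "e \<in> set u \<union> set v" "t \<in> set u \<union> set v"
      using that by (auto dest!: prec3_imp_prec prec_in_set)
    then show ?thesis
      using assms(1,2) by auto
  qed
  show "prec3 d e t u = prec3 d e t v" if "lin t u" "\<not> prec t d u" for d e t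
    using that A *[of d e t] unfolding lin_def by blast
  show "prec3 t e d u = prec3 t e d v" if "lin t u" "\<not> prec d t u" for d e t
    using that B *[of t e d] unfolding lin_def by blast
qed

lemmas numeral_cases = numeral_2_eq_2 numeral_3_eq_3 All_less_Suc subset_eq less_Suc_eq

context word_congruence
begin

lemma transfer_agree:
  "(u', u) \<in> agree_all \<Longrightarrow> (v', v) \<in> agree_all \<Longrightarrow> (u, v) \<in> E \<Longrightarrow> (u', v') \<in> E"
  using agreeE sym trans by meson

text \<open>Erasing the letters other than \<open>x\<close> equates a positive power w of x with the
  empty word. Powers with exponent at least two agree, so xw = ww = 1, while also xw = x.\<close>

lemma axS_if_content:
  assumes E: "(u, v) \<in> E" and x: "x \<in> set u" "x \<notin> set v"
  shows "ax vS \<in> E"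
proof -
  let ?w = "retract [x] {} u"
  have w: "set ?w = {0}"
    using x(1) by (auto simp: retract simp del: set_concat)
  have "retract [x] {} v = []"
    using x(2) by (auto simp: keep_def)
  then have wE: "(?w, []) \<in> E"
    using subst[OF E, of "keep [x] {}"] by (simp only:)
  have "(0 # ?w, ?w @ ?w) \<in> E"
    by (rule agreeE, rule agree_all_nonlinI) (auto simp: w retract simp del: set_concat)
  also have "(?w @ ?w, ?w) \<in> E"
    using cong[OF wE, of ?w "[]"] by simp
  also note wE
  finally have "(0 # ?w, []) \<in> E" .
  moreover have "(0 # ?w, [0]) \<in> E"
    using cong_Cons[OF wE] .
  ultimately show ?thesis
    unfolding ax.simps using trans[OF sym] by blast
qed

lemma content_agree:
  assumes "(u, v) \<in> E" "ax vS \<notin> E"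
  shows "set u = set v"
  using assms axS_if_content[OF assms(1)] axS_if_content[OF sym[OF assms(1)]] by blast

lemma axN_if_nonlin:
  assumes E: "(u, v) \<in> E" and x: "prec x x u" "x \<in> set v" "\<not> prec x x v"
  shows "ax vN \<in> E"
proof -
  let ?f = "keep [x] {}"
  have xu: "x \<in> set u"
    using x prec_in_set by metis
  have "([0], concat (map ?f v)) \<in> agree_all"
    using x by (intro agree_all_numeralI[where n = "Suc 0"])
      (auto simp: retract numeral_cases dest: prec3_imp_prec simp del: set_concat)
  moreover have "([0, 0], concat (map ?f u)) \<in> agree_all"
    using x xu by (intro agree_all_numeralI[where n = "Suc 0"])
      (auto simp: retract numeral_cases simp del: set_concat)
  moreover note sym[OF subst[OF E, of ?f]]
  ultimately show ?thesis
    unfolding ax.simps by (rule transfer_agree)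
qed

lemma nonlin_agree:
  assumes "(u, v) \<in> E" "ax vN \<notin> E"
  shows "set u = set v" "prec x x u = prec x x v" "lin x u = lin x v"
proof -
  show s: "set u = set v"
    using content_agree assms S_imp_N by blast
  show p: "prec x x u = prec x x v"
    using assms axN_if_nonlin[OF assms(1)] axN_if_nonlin[OF sym[OF assms(1)]] s prec_in_set[of x x]
    by blast
  show "lin x u = lin x v"
    using s p by (simp add: lin_def)
qed

lemma axM_if_linear_order:
  assumes E: "(u, v) \<in> E" and u: "lin x u" "lin y u" "prec x y u"
    and v: "lin x v" "lin y v" "prec y x v"
  shows "ax vM \<in> E"
proof -
  let ?f = "keep [x, y] {}"
  have xy: "x \<noteq> y" "\<not> prec x x u" "\<not> prec y y u" "\<not> prec x x v" "\<not> prec y y v"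
      "x \<in> set u" "y \<in> set u" "x \<in> set v" "y \<in> set v"
    using u v by (auto simp: lin_def)
  have *: "\<not> prec y x u" "\<not> prec x y v"
    using lin_antisym u v by metis+
  have "([0, 1], concat (map ?f u)) \<in> agree_all"
    using u xy * by (intro agree_all_numeralI[where n = 2])
      (auto simp: retract numeral_cases dest: prec3_imp_prec simp del: set_concat)
  moreover have "([1, 0], concat (map ?f v)) \<in> agree_all"
    using v xy * by (intro agree_all_numeralI[where n = 2])
      (auto simp: retract numeral_cases dest: prec3_imp_prec simp del: set_concat)
  moreover note subst[OF E, of ?f]
  ultimately show ?thesis
    unfolding ax.simps by (rule transfer_agree)
qed

lemma linear_order_agree:
  assumes E: "(u, v) \<in> E" and ax: "ax vM \<notin> E" and l: "lin x u" "lin y u"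
  shows "prec x y u = prec x y v"
proof -
  have N: "ax vN \<notin> E"
    using ax N_imp_M by blast
  have lv: "lin x v" "lin y v"
    using nonlin_agree(3)[OF E N] l by auto
  show ?thesis
  proof (cases "x = y")
    case True
    then show ?thesis using l lv by (simp add: lin_def)
  next
    case False
    then have "prec x y u \<or> prec y x u" "prec x y v \<or> prec y x v"
      using prec_total l lv unfolding lin_def by metis+
    then show ?thesis
      using axM_if_linear_order[OF E l _ lv] axM_if_linear_order[OF E l(2,1) _ lv(2,1)] ax
        lin_antisym l lv by metis
  qed
qed

lemma axL_if_before_linear:
  assumes E: "(u, v) \<in> E" and u: "lin x u" "prec y y u" "prec y x u"
    and v: "lin x v" "prec y y v" "\<not> prec y x v"
  shows "ax vL \<in> E"
proof -
  let ?f = "keep [x, y] {}"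
  have xy: "x \<noteq> y" "\<not> prec x x u" "\<not> prec x x v" "x \<in> set u" "x \<in> set v" "y \<in> set u" "y \<in> set v"
    using u v prec_in_set unfolding lin_def by metis+
  have *: "prec x y v"
    using v xy prec_total by metis
  \<comment> \<open>The appended 1, which stands for \<open>y\<close>, puts a \<open>y\<close>
    behind \<open>x\<close> in both words; the retracts then have the shapes yxy and xyy.\<close>
  let ?U = "concat (map ?f u) @ [1]" and ?V = "concat (map ?f v) @ [1]"
  have "([1, 0, 1], ?U) \<in> agree_all"
    using u xy by (intro agree_all_numeralI[where n = 2])
      (auto simp: retract numeral_cases dest: prec3_imp_prec simp del: set_concat)
  moreover have "([0, 1, 1], ?V) \<in> agree_all"
    using v xy * by (intro agree_all_numeralI[where n = 2])
      (auto simp: retract numeral_cases dest: prec3_imp_prec simp del: set_concat)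
  moreover have "(?U, ?V) \<in> E"
    using cong[OF subst[OF E, of ?f], of "[]" "[1]"] by simp
  ultimately have "([1, 0, 1], [0, 1, 1]) \<in> E"
    by (rule transfer_agree)
  then show ?thesis
    unfolding ax.simps by (rule sym)
qed

text \<open>If \<open>y\<close> is linear too, the pair is governed by \<open>vM\<close>; only a
  nonlinear \<open>y\<close> calls on the identity for \<open>vL\<close>.\<close>

lemma before_linear_agree:
  assumes E: "(u, v) \<in> E" and ax: "ax vL \<notin> E" and l: "lin x u"
  shows "prec y x u = prec y x v"
proof -
  have M: "ax vM \<notin> E"
    using ax M_imp_L by blast
  then have N: "ax vN \<notin> E"
    using N_imp_M by blast
  have lv: "lin x v"
    using nonlin_agree(3)[OF E N] l by auto
  show ?thesis
  proof (cases "prec y y u")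
    case True
    then have "prec y y v"
      using nonlin_agree(2)[OF E N] by auto
    with True show ?thesis
      using axL_if_before_linear[OF E l _ _ lv] axL_if_before_linear[OF sym[OF E] lv _ _ l] ax
      by blast
  next
    case False
    then show ?thesis
      using linear_order_agree[OF E M _ l, of y] nonlin_agree(1)[OF E N] prec_in_set[of y x]
      by (auto simp: lin_def)
  qed
qed

end

context word_congruence
begin

interpretation rev: word_congruence "{(u, v). (rev u, rev v) \<in> E}"
  by (rule word_congruence_rev)

lemma after_linear_agree:
  assumes E: "(u, v) \<in> E" and ax: "ax vR \<notin> E" and l: "lin x u"
  shows "prec x y u = prec x y v"
  using rev.before_linear_agree[of "rev u" "rev v" x y] assms by simp

end

context word_congruence
begin

lemma axQ_if_between_linear:
  assumes E: "(u, v) \<in> E" and u: "lin s u" "lin t u" "prec3 s x t u"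
    and v: "lin s v" "lin t v" "prec s t v" "x \<in> set v" "\<not> prec3 s x t v"
  shows "ax vQ \<in> E"
proof -
  let ?f = "keep [x, s, t] {}"
  have p: "prec s x u" "prec x t u" "prec s t u"
    using u(3) prec3_imp_prec[of s x t u] by auto
  have d: "s \<noteq> x" "x \<noteq> s" "x \<noteq> t" "s \<noteq> t"
    using p u by (auto simp: lin_def)
  have n: "\<not> prec s s u" "\<not> prec t t u" "\<not> prec s s v" "\<not> prec t t v" "\<not> prec t s u" "\<not> prec t s v"
    using u v p lin_antisym unfolding lin_def by metis+
  have m: "x \<in> set u" "s \<in> set u" "t \<in> set u" "s \<in> set v" "t \<in> set v"
    using p u v prec_in_set unfolding lin_def by metis+
  \<comment> \<open>With \<open>x\<close> (index 0) added at both ends, the words differ only in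
    whether an \<open>x\<close> stands between \<open>s\<close> and \<open>t\<close>.\<close>
  let ?U = "[0] @ concat (map ?f u) @ [0]" and ?V = "[0] @ concat (map ?f v) @ [0]"
  have "([0, 1, 0, 2, 0], ?U) \<in> agree_all"
    using p d n m u(3) by (intro agree_all_numeralI[where n = 3])
      (auto simp: retract numeral_cases dest: prec3_imp_prec simp del: set_concat)
  moreover have "([0, 1, 2, 0], ?V) \<in> agree_all"
    using v d n m by (intro agree_all_numeralI[where n = 3])
      (auto simp: retract numeral_cases dest: prec3_imp_prec simp del: set_concat)
  moreover have "(?U, ?V) \<in> E"
    using cong[OF subst[OF E, of ?f], of "[0]" "[0]"] by simp
  ultimately have "([0, 1, 0, 2, 0], [0, 1, 2, 0]) \<in> E"
    by (rule transfer_agree)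
  then show ?thesis
    unfolding ax.simps by (rule sym)
qed

lemma between_linear_agree:
  assumes E: "(u, v) \<in> E" and ax: "ax vQ \<notin> E" and l: "lin s u" "lin t u"
  shows "prec3 s x t u = prec3 s x t v"
proof -
  have LR: "ax vL \<notin> E" "ax vR \<notin> E"
    using ax L_imp_Q R_imp_Q by blast+
  have M: "ax vM \<notin> E" and N: "ax vN \<notin> E"
    using LR N_imp_M M_imp_L by blast+
  have lv: "lin s v" "lin t v"
    using nonlin_agree(3)[OF E N] l by auto
  have st: "prec s t u = prec s t v" and X: "set u = set v"
    using nonlin_agree(1)[OF E N] linear_order_agree[OF E M] l by auto
  show ?thesis
    using axQ_if_between_linear[OF E l _ lv] axQ_if_between_linear[OF sym[OF E] lv _ l] ax st X
      prec3_imp_prec[of s x t] prec_in_set[of s x]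
    by metis
qed

lemma axA0_if_prec:
  assumes E: "(u, v) \<in> E" and S: "x \<in> set u" "y \<in> set u" "x \<noteq> y"
    and xy: "\<not> prec x y u" "prec x y v"
  shows "ax vA0 \<in> E"
proof -
  let ?f = "keep [y, x] {0, 1}"
  have *: "prec y x u" "x \<in> set v" "y \<in> set v"
    using S xy prec_total prec_in_set by metis+
  \<comment> \<open>Index 0 is \<open>y\<close>. Both letters are doubled, hence nonlinear, so only
    pairs count; the leading 0 makes \<open>y\<close> precede \<open>x\<close> in \<open>?V\<close>
    as well.\<close>
  let ?U = "[0] @ concat (map ?f u)" and ?V = "[0] @ concat (map ?f v)"
  have "([0, 0, 1, 1], ?U) \<in> agree_all"
    using S xy * by (intro agree_all_numeralI[where n = 2])
      (auto simp: retract numeral_cases simp del: set_concat)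
  moreover have "([0, 1, 1, 0], ?V) \<in> agree_all"
    using S xy * by (intro agree_all_numeralI[where n = 2])
      (auto simp: retract numeral_cases simp del: set_concat)
  moreover have "(?U, ?V) \<in> E"
    using cong[OF subst[OF E, of ?f], of "[0]" "[]"] by simp
  ultimately show ?thesis
    unfolding ax.simps by (rule transfer_agree)
qed

lemma prec_agree:
  assumes E: "(u, v) \<in> E" and ax: "ax vA0 \<notin> E"
  shows "prec x y u = prec x y v"
proof -
  have N: "ax vN \<notin> E"
    using ax L_imp_A0 M_imp_L N_imp_M by blast
  show ?thesis
    using axA0_if_prec[OF E, of x y] axA0_if_prec[OF sym[OF E], of x y] ax
      nonlin_agree(1)[OF E N] nonlin_agree(2)[OF E N, of x] prec_in_set[of x y]
    by metis
qed

lemma axA_if_prec3: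
  assumes E: "(u, v) \<in> E" and P: "\<And>x y. prec x y u = prec x y v"
    and S: "lin t u" "t \<in> set v" "prec d d u" "\<not> prec t d u" "prec t e u"
    and u: "\<not> prec3 d e t u" and v: "prec3 d e t v"
  shows "ax vA \<in> E"
proof -
  let ?f = "keep [e, d, t] {0, 1}"
  have p: "prec d e v" "prec e t v" "prec d t v"
    using v prec3_imp_prec[of d e t v] by auto
  have dist: "e \<noteq> d" "d \<noteq> t" "e \<noteq> t" "\<not> prec t t v" "t \<in> set u"
    using S P p by (auto simp: lin_def)
  have m: "d \<in> set u" "e \<in> set u" "d \<in> set v" "e \<in> set v"
    using p P prec_in_set by metis+
  \<comment> \<open>The indices 0, 1, 2 stand for \<open>e\<close>, \<open>d\<close>,
    \<open>t\<close>. The leading \<open>e\<close> precedes everything and another \<open>e\<close>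
    follows \<open>t\<close>, so the words differ only in whether an \<open>e\<close> stands between
    \<open>d\<close> and \<open>t\<close>.\<close>
  let ?U = "[0] @ concat (map ?f u)" and ?V = "[0] @ concat (map ?f v)"
  have "([0, 0, 1, 1, 2, 0], ?U) \<in> agree_all"
    using p dist m S u by (intro agree_all_numeralI[where n = 3])
      (auto simp: retract numeral_cases P dest: prec3_imp_prec simp del: set_concat)
  moreover have "([0, 1, 1, 0, 2, 0], ?V) \<in> agree_all"
    using p dist m S v by (intro agree_all_numeralI[where n = 3])
      (auto simp: retract numeral_cases P dest: prec3_imp_prec simp del: set_concat)
  moreover have "(?U, ?V) \<in> E"
    using cong[OF subst[OF E, of ?f], of "[0]" "[]"] by simp
  ultimately show ?thesis
    unfolding ax.simps by (rule transfer_agree)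
qed

text \<open>A linear \<open>d\<close> makes this a triple of \<open>vQ\<close>. If no
  \<open>e\<close> follows the linear \<open>t\<close>, the triple amounts to the pair
  \<open>d e\<close> with \<open>e\<close> different from \<open>t\<close>. Only the remaining case
  calls on \<open>ax vA\<close>.\<close>

lemma prec3_left_agree:
  assumes E: "(u, v) \<in> E" and ax: "ax vA \<notin> E" and l: "lin t u" and td: "\<not> prec t d u"
  shows "prec3 d e t u = prec3 d e t v"
proof -
  have A0: "ax vA0 \<notin> E" and Q: "ax vQ \<notin> E"
    using ax A0_imp_A Q_imp_A by blast+
  then have N: "ax vN \<notin> E"
    using L_imp_A0 M_imp_L N_imp_M by blast
  note P = prec_agree[OF E A0]
  have lv: "lin t v" and X: "set u = set v"
    using nonlin_agree[OF E N] l by auto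
  show ?thesis
  proof (cases "prec d d u \<and> prec t e u")
    case True
    then show ?thesis
      using axA_if_prec3[OF E P l _ _ td] axA_if_prec3[OF sym[OF E] P[symmetric] lv] ax P td l lv
      by (metis lin_def)
  next
    case False
    moreover have "prec3 d e t u = prec3 d e t v" if "\<not> prec d d u"
      using between_linear_agree[OF E Q _ l, of d e] that X prec3_imp_prec[of d e t] prec_in_set[of d e]
      unfolding lin_def by metis
    moreover have "prec3 d e t w \<longleftrightarrow> prec d e w \<and> e \<noteq> t" if "\<not> prec t e w" "lin t w" for w
      using that prec3_if_prec_left[of d e w t] prec3_imp_prec[of d e t w] unfolding lin_def by metis
    ultimately show ?thesis
      using P l lv by metis
  qed
qed

end

context word_congruence
begin

interpretation rev: word_congruence "{(u, v). (rev u, rev v) \<in> E}"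
  by (rule word_congruence_rev)

lemma prec3_right_agree:
  assumes E: "(u, v) \<in> E" and ax: "ax vB \<notin> E" and l: "lin t u" and td: "\<not> prec d t u"
  shows "prec3 t e d u = prec3 t e d v"
  using rev.prec3_left_agree[of "rev u" "rev v" t d e] assms by simp

text \<open>This is the inclusion of \<open>E\<close> in \<open>agree D\<close>, where
  \<open>D\<close> is the set of labels whose identity fails. If \<open>ax j\<close> fails, so do
  the identities of the labels below \<open>j\<close>, whose invariants occur in the description of
  the feature \<open>j\<close>.\<close>

lemma feat_agree:
  assumes E: "(u, v) \<in> E" and j: "j \<in> irreducibles" "ax j \<notin> E"
  shows "feat j u = feat j v"
proof -
  have S: "feat vS u = feat vS v" if "ax vS \<notin> E"
    using content_agree[OF E that] by (simp add: feat_eq)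
  have N: "feat vN u = feat vN v" if "ax vN \<notin> E"
    using nonlin_agree(2)[OF E that] by (simp add: feat_eq)
  have M: "feat vM u = feat vM v" if ax: "ax vM \<notin> E"
  proof -
    have "ax vN \<notin> E"
      using ax N_imp_M by blast
    then show ?thesis
      unfolding feat_M by (auto simp: nonlin_agree(3)[OF E] linear_order_agree[OF E ax]
          simp del: ax.simps cong: conj_cong)
  qed
  have L: "feat vL u = feat vL v" if ax: "ax vL \<notin> E"
  proof -
    have "ax vN \<notin> E"
      using ax N_imp_M M_imp_L by blast
    then show ?thesis
      unfolding feat_L by (auto simp: nonlin_agree(3)[OF E] before_linear_agree[OF E ax]
          simp del: ax.simps cong: conj_cong)
  qed
  have R: "feat vR u = feat vR v" if ax: "ax vR \<notin> E"
  proof -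
    have "ax vN \<notin> E"
      using ax N_imp_M M_imp_R by blast
    then show ?thesis
      unfolding feat_R by (auto simp: nonlin_agree(3)[OF E] after_linear_agree[OF E ax]
          simp del: ax.simps cong: conj_cong)
  qed
  have A0: "feat vA0 u = feat vA0 v" if "ax vA0 \<notin> E"
    using prec_agree[OF E that] by (simp add: feat_eq)
  have Q: "feat vQ u = feat vQ v" if ax: "ax vQ \<notin> E"
  proof -
    have "ax vN \<notin> E"
      using ax N_imp_M M_imp_L L_imp_Q by blast
    then show ?thesis
      unfolding feat_Q by (auto simp: nonlin_agree(3)[OF E] between_linear_agree[OF E ax]
          simp del: ax.simps cong: conj_cong)
  qed
  have A: "feat vA u = feat vA v" if ax: "ax vA \<notin> E"
  proof -
    have "ax vN \<notin> E" "ax vA0 \<notin> E"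
      using ax N_imp_M M_imp_L L_imp_A0 A0_imp_A by blast+
    then show ?thesis
      unfolding feat_A by (auto simp: nonlin_agree(3)[OF E] prec_agree[OF E] prec3_left_agree[OF E ax]
          simp del: ax.simps cong: conj_cong)
  qed
  have B: "feat vB u = feat vB v" if ax: "ax vB \<notin> E"
  proof -
    have "ax vN \<notin> E" "ax vA0 \<notin> E"
      using ax N_imp_M M_imp_L L_imp_A0 A0_imp_B by blast+
    then show ?thesis
      unfolding feat_B by (auto simp: nonlin_agree(3)[OF E] prec_agree[OF E] prec3_right_agree[OF E ax]
          simp del: ax.simps cong: conj_cong)
  qed
  have "j = vS \<or> j = vN \<or> j = vM \<or> j = vL \<or> j = vR \<or> j = vA0 \<or> j = vQ \<or> j = vA \<or> j = vB"
    using j(1) by auto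
  then show ?thesis
    using j(2) by (elim disjE; hypsubst; intro S N M L R A0 Q A B)
qed

end

section \<open>Rich words\<close>

context word_congruence
begin

section \<open>Insertions permitted by the test identities\<close>

lemma dup: "prec x x (p @ x # q) \<Longrightarrow> (p @ x # q, p @ x # x # q) \<in> E"
  by (rule agreeE[OF agree_dup])

text \<open>The middle letters of \<open>ax vQ\<close> are replaced by the factors between the
  insertion point and an \<open>x\<close> on either side.\<close>

lemma insert_between:
  assumes ax: "ax vQ \<in> E" and x: "x \<in> set p" "x \<in> set q"
  shows "(p @ q, p @ x # q) \<in> E"
proof -
  obtain p1 p2 q1 q2 where pq: "p = p1 @ x # p2" "q = q1 @ x # q2"
    using x by (meson split_list)
  let ?f = "\<lambda>i::nat. if i = 0 then [x] else if i = 1 then p2 else q1"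
  have "(p1 @ concat (map ?f [0, 1, 2, 0]) @ q2, p1 @ concat (map ?f [0, 1, 0, 2, 0]) @ q2) \<in> E"
    using ax by (intro cong subst) simp
  then show ?thesis
    by (simp add: pq)
qed

text \<open>A later \<open>y\<close> is doubled, and \<open>ax vL\<close> moves one of the copies to
  the insertion point.\<close>

lemma insert_before:
  assumes ax: "ax vL \<in> E" and y: "y \<in> set q" "prec y y (p @ q)"
  shows "(p @ q, p @ y # q) \<in> E"
proof -
  obtain r q' where q: "q = r @ y # q'"
    using y(1) by (meson split_list)
  let ?f = "\<lambda>i::nat. if i = 0 then r else [y]"
  have "(p @ concat (map ?f [0, 1, 1]) @ q', p @ concat (map ?f [1, 0, 1]) @ q') \<in> E"
    using ax by (intro cong subst) simp
  moreover have "(p @ q, p @ r @ y # y # q') \<in> E"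
    using dup[of y "p @ r" q'] y(2) by (simp add: q)
  ultimately show ?thesis
    using trans[of "p @ q" "p @ r @ y # y # q'" "p @ y # q"] by (simp add: q)
qed

text \<open>A copy of \<open>x\<close> is placed behind the first letter of the run, the induction
  hypothesis carries a copy from there to the end, and the intermediate copy is removed by the same
  step read backwards. The predicate \<open>G\<close> is what the step demands of the remaining
  word: nothing for \<open>ax vA0\<close>, another occurrence of \<open>x\<close> for
  \<open>ax vA\<close>.\<close>

lemma insert_run:
  assumes step: "\<And>p y q. prec x x (p @ x # y # q) \<Longrightarrow> prec y y (p @ x # y # q) \<Longrightarrow> G q \<Longrightarrow>
      (p @ x # y # q, p @ x # y # x # q) \<in> E"
    and G: "\<And>y q. G q \<Longrightarrow> G (y # q)"
  shows "prec x x (p @ x # r @ q) \<Longrightarrow> \<forall>y\<in>set r. prec y y (p @ x # r @ q) \<Longrightarrow> G q \<Longrightarrow>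
    (p @ x # r @ q, p @ x # r @ x # q) \<in> E"
proof (induction r arbitrary: p)
  case Nil
  then show ?case
    using dup by simp
next
  case (Cons y r)
  have Gr: "G (r @ q)" "G (r @ x # q)"
    using Cons.prems(3) G by (induction r) auto
  have "(p @ x # y # r @ q, p @ x # y # x # r @ q) \<in> E"
    using Cons.prems Gr by (intro step) simp_all
  also have "((p @ [x, y]) @ x # r @ q, (p @ [x, y]) @ x # r @ x # q) \<in> E"
    using Cons.prems by (intro Cons.IH) auto
  then have "(p @ x # y # x # r @ q, p @ x # y # x # r @ x # q) \<in> E"
    by simp
  also have "(p @ x # y # x # r @ x # q, p @ x # y # r @ x # q) \<in> E"
    using Cons.prems Gr by (intro sym[OF step]) auto
  finally show ?case
    by simp
qed

text \<open>Nonlinear letters can be doubled freely, so an identity about squares acts on single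
  occurrences.\<close>

lemma insert_step:
  assumes x: "prec x x (p @ x # y # q)" and y: "prec y y (p @ x # y # q)"
    and swap: "(p @ x # x # y # y # q, p @ x # y # y # x # q) \<in> E"
  shows "(p @ x # y # q, p @ x # y # x # q) \<in> E"
proof -
  have y': "prec y y ((p @ [x, x]) @ y # q)" "prec y y ((p @ [x]) @ y # x # q)"
    using y by auto
  have "(p @ x # y # q, p @ x # x # y # q) \<in> E"
    using dup[OF x] .
  also have "(p @ x # x # y # q, p @ x # x # y # y # q) \<in> E"
    using dup[OF y'(1)] by simp
  also note swap
  also have "(p @ x # y # y # x # q, p @ x # y # x # q) \<in> E"
    using sym[OF dup[OF y'(2)]] by simp
  finally show ?thesis .
qed

lemma insert_run_A0:
  assumes ax: "ax vA0 \<in> E"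
    and x: "prec x x (p @ x # r @ q)" and r: "\<forall>y\<in>set r. prec y y (p @ x # r @ q)"
  shows "(p @ x # r @ q, p @ x # r @ x # q) \<in> E"
proof (rule insert_run[where G = "\<lambda>_. True", OF insert_step])
  fix p y q
  let ?f = "\<lambda>i::nat. if i = 0 then [x] else [y]"
  have "(p @ concat (map ?f [0, 0, 1, 1]) @ q, p @ concat (map ?f [0, 1, 1, 0]) @ q) \<in> E"
    using ax by (intro cong subst) simp
  then show "(p @ x # x # y # y # q, p @ x # y # y # x # q) \<in> E"
    by simp
qed (use x r in auto)

lemma insert_run_A:
  assumes ax: "ax vA \<in> E" and r: "\<forall>y\<in>set r. prec y y (p @ x # r @ q)" and x: "x \<in> set q"
  shows "(p @ x # r @ q, p @ x # r @ x # q) \<in> E"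
proof (rule insert_run[where G = "\<lambda>q. x \<in> set q", OF insert_step])
  fix p y q assume "x \<in> set q"
  then obtain q1 q2 where q: "q = q1 @ x # q2"
    by (meson split_list)
  let ?f = "\<lambda>i::nat. if i = 0 then [x] else if i = 1 then [y] else q1"
  have "(p @ concat (map ?f [0, 0, 1, 1, 2, 0]) @ q2, p @ concat (map ?f [0, 1, 1, 0, 2, 0]) @ q2) \<in> E"
    using ax by (intro cong subst) simp
  then show "(p @ x # x # y # y # q, p @ x # y # y # x # q) \<in> E"
    by (simp add: q)
qed (use x r in auto)

text \<open>In a rich word, every insertion of a letter permitted by \<open>E\<close> has already taken place.\<close>

definition rich :: "nat list \<Rightarrow> bool" where
  "rich u \<longleftrightarrow> (\<forall>p q x. u = p @ q \<longrightarrow> (p @ q, p @ x # q) \<in> E \<longrightarrow> (p @ q, p @ x # q) \<in> agree_all)"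

lemma richD: "rich (p @ q) \<Longrightarrow> (p @ q, p @ x # q) \<in> E \<Longrightarrow> (p @ q, p @ x # q) \<in> agree_all"
  by (auto simp: rich_def)

text \<open>Insertion destroys no pair and no triple, and \<open>S\<close> fixes the content, so the
  number of pairs and triples is bounded. An insertion that adds none stays within
  \<open>agree_all\<close>; hence every other insertion raises \<open>m\<close>, and the process
  stops.\<close>

lemma ex_rich:
  assumes S: "\<And>u v. (u, v) \<in> E \<Longrightarrow> set u = set v"
  shows "\<exists>v. (u, v) \<in> E \<and> rich v"
proof -
  define P where "P u = {(x, y). prec x y u}" for u :: "nat list"
  define T where "T u = {(x, y, z). prec3 x y z u}" for u :: "nat list"
  define m where "m u = card (P u) + card (T u)" for u
  define C where "C = set u"
  have PT: "P w \<subseteq> C \<times> C" "T w \<subseteq> C \<times> C \<times> C" if "set w = C" for w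
    using that by (auto simp: P_def T_def dest!: prec3_imp_prec prec_in_set)
  have C: "finite (C \<times> C)" "finite (C \<times> C \<times> C)"
    by (simp_all add: C_def)
  have fin: "finite (P w)" "finite (T w)" if "set w = C" for w
    by (rule finite_subset[OF PT(1)[OF that] C(1)], rule finite_subset[OF PT(2)[OF that] C(2)])
  have le: "m w \<le> card (C \<times> C) + card (C \<times> C \<times> C)" if "set w = C" for w
    unfolding m_def by (rule add_mono[OF card_mono[OF C(1) PT(1)[OF that]] card_mono[OF C(2) PT(2)[OF that]]])
  have "set w = C \<Longrightarrow> \<exists>v. (w, v) \<in> E \<and> rich v" for w
  proof (induction "card (C \<times> C) + card (C \<times> C \<times> C) - m w" arbitrary: w rule: less_induct)
    case less
    show ?case
    proof (cases "rich w")
      case True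
      then show ?thesis using refl by blast
    next
      case False
      then obtain p q x where pq: "w = p @ q" "(w, p @ x # q) \<in> E" "(w, p @ x # q) \<notin> agree_all"
        unfolding rich_def by blast
      let ?w = "p @ x # q"
      have s: "set ?w = C"
        using S[OF pq(2)] less.prems by simp
      have sub: "P w \<subseteq> P ?w" "T w \<subseteq> T ?w"
        by (auto simp: P_def T_def pq(1))
      have "P w \<noteq> P ?w \<or> T w \<noteq> T ?w"
      proof (rule ccontr)
        assume "\<not> ?thesis"
        then have "\<And>x y. prec x y w = prec x y ?w" "\<And>x y z. prec3 x y z w = prec3 x y z ?w"
          unfolding P_def T_def by (auto simp: set_eq_iff)
        then have "(w, ?w) \<in> agree_all"
          using s less.prems by (intro agree_allI) auto
        with pq show False by simp
      qed
      then have "m w < m ?w"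
        unfolding m_def
        using sub card_mono[OF fin(1)[OF s] sub(1)] card_mono[OF fin(2)[OF s] sub(2)]
          psubset_card_mono[OF fin(1)[OF s], of "P w"] psubset_card_mono[OF fin(2)[OF s], of "T w"]
        by fastforce
      then obtain v where "(?w, v) \<in> E" "rich v"
        using less.hyps[of ?w] le[OF s] s by fastforce
      then show ?thesis
        using trans[OF pq(2)] by blast
    qed
  qed
  then show ?thesis
    by (simp add: C_def)
qed

text \<open>\<open>ax vL\<close> permits \<open>y\<close> in front of the whole word, where it
  precedes every letter; richness says that this adds no pair.\<close>

lemma rich_before_linear:
  assumes ax: "ax vL \<in> E" and u: "rich u" and x: "x \<in> set u" and y: "prec y y u"
  shows "prec y x u"
proof -
  have "(u, y # u) \<in> E"
    using insert_before[OF ax, of y u "[]"] y prec_in_set[of y y u] by simp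
  then have "(u, y # u) \<in> agree_all"
    using richD[of "[]" u] u by simp
  then show ?thesis
    using x agree_allD(2)[of u "y # u" y x] by simp
qed

text \<open>If the triple were missing, \<open>x\<close> would occur both before \<open>s\<close>
  and after \<open>t\<close>, and \<open>ax vQ\<close> would permit an \<open>x\<close> right behind
  \<open>s\<close>, which creates the triple.\<close>

lemma rich_between_linear:
  assumes ax: "ax vQ \<in> E" and u: "rich u" and l: "lin s u" "lin t u"
    and p: "prec s x u" "prec x t u" "prec s t u"
  shows "prec3 s x t u"
proof (rule ccontr)
  assume n: "\<not> prec3 s x t u"
  have d: "s \<noteq> x" "x \<noteq> t"
    using l p by (auto simp: lin_def)
  obtain a b where ab: "u = a @ s # b" "t \<in> set b"
    using p(3) prec_split by metis
  have s: "s \<notin> set a" "s \<notin> set b"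
    using l(1) ab by (auto simp: lin_def)
  have "t \<notin> set a"
    using l(2) ab by (auto simp: lin_def)
  have "x \<in> set b" "\<not> prec x t b"
    using p(1) n s d by (auto simp: ab dest: prec_in_set)
  moreover from this have "x \<in> set a"
    using p(2) d \<open>t \<notin> set a\<close> by (auto simp: ab dest: prec_in_set)
  ultimately have "((a @ [s]) @ b, (a @ [s]) @ x # b) \<in> agree_all"
    using u by (intro richD insert_between[OF ax]) (auto simp: ab)
  moreover have "\<not> prec t s u"
    using lin_antisym l p by metis
  ultimately show False
    using agree_allD(3)[of "(a @ [s]) @ b" "(a @ [s]) @ x # b" t s x] l n ab by auto
qed

text \<open>If the pair were missing from \<open>u\<close>, all \<open>y\<close> would precede all
  \<open>x\<close>. By \<open>L\<close> and \<open>R\<close>, a linear letter between the last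
  \<open>y\<close> and the first \<open>x\<close> would lie behind all \<open>y\<close> and before
  all \<open>x\<close> in \<open>v\<close> as well, against \<open>prec x y v\<close>. So that run
  is nonlinear, and a \<open>y\<close> can be carried across it and across \<open>x\<close>.\<close>

lemma rich_prec:
  assumes ax: "ax vA0 \<in> E" and u: "rich u"
    and N: "set u = set v" "\<And>x. prec x x u = prec x x v"
    and L: "\<And>x y. lin x u \<Longrightarrow> prec y x u = prec y x v"
    and R: "\<And>x y. lin x u \<Longrightarrow> prec x y u = prec x y v"
    and v: "prec x y v"
  shows "prec x y u"
proof (rule ccontr)
  assume n: "\<not> prec x y u"
  have x: "x \<in> set u" and y: "y \<in> set u"
    using v N(1) prec_in_set by metis+
  \<comment> \<open>If \<open>x\<close> or \<open>y\<close> were linear, \<open>R\<close> or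
    \<open>L\<close> would transfer the pair from \<open>v\<close>.\<close>
  have nl: "prec x x u" "prec y y u" and d: "x \<noteq> y"
    using n v x y L[of y x] R[of x y] N(2) unfolding lin_def by auto
  obtain a b where ab: "u = a @ x # b" "x \<notin> set a"
    using x by (meson split_list_first)
  have "y \<in> set a"
    using y n d by (auto simp: ab)
  then obtain p r where a: "a = p @ y # r" "y \<notin> set r"
    by (meson split_list_last)
  have u': "u = p @ y # (r @ [x]) @ b"
    by (simp add: ab a)
  have "prec s s u" if "s \<in> set r" for s
  proof (rule ccontr)
    assume s: "\<not> prec s s u"
    then have l: "lin s u"
      using that by (auto simp: lin_def u')
    have "s \<noteq> x" "s \<noteq> y"
      using s nl by auto
    moreover have "\<not> prec s y u" "\<not> prec x s u"
      using s that n ab(2) a calculation by (auto simp: ab dest: prec_in_set)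
    ultimately have "prec3 x y s v" "\<not> prec x s v"
      using prec3_if_prec_left[OF v, of s] L[OF l] R[OF l] N(1) l unfolding lin_def by auto
    then show False
      using prec3_imp_prec by metis
  qed
  then have "(p @ y # (r @ [x]) @ b, p @ y # (r @ [x]) @ y # b) \<in> E"
    using nl by (intro insert_run_A0[OF ax]) (auto simp: u')
  then have "((p @ y # r @ [x]) @ b, (p @ y # r @ [x]) @ y # b) \<in> agree_all"
    using u by (intro richD) (auto simp: u')
  then show False
    using agree_allD(2)[of "(p @ y # r @ [x]) @ b" "(p @ y # r @ [x]) @ y # b" x y] n by (auto simp: u')
qed

text \<open>If the triple were missing from \<open>u\<close>, some \<open>e\<close> would precede
  the first \<open>d\<close>. Take the last such \<open>e\<close>: the letters between it and the
  first \<open>d\<close> turn out to be nonlinear, so \<open>ax vA\<close> carries an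
  \<open>e\<close> across them and across \<open>d\<close>, which creates the triple.\<close>

lemma rich_prec3_left:
  assumes ax: "ax vA \<in> E" and u: "rich u"
    and N: "set u = set v" and P: "\<And>x y. prec x y u = prec x y v"
    and Q: "\<And>s x t. lin s u \<Longrightarrow> lin t u \<Longrightarrow> prec3 s x t u = prec3 s x t v"
    and t: "lin t u" "\<not> prec t d u" and v: "prec3 d e t v"
  shows "prec3 d e t u"
proof (rule ccontr)
  assume n: "\<not> prec3 d e t u"
  have p: "prec d e u" "prec e t u" "prec d t u"
    using v P prec3_imp_prec[of d e t v] by auto
  have dist: "d \<noteq> t" "e \<noteq> t"
    using t p by (auto simp: lin_def)
  \<comment> \<open>For linear \<open>d\<close> the triple is one of those covered by
    \<open>Q\<close>.\<close>
  have nl: "prec d d u"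
    using Q[of d t e] t(1) v n prec_in_set[OF p(1)] unfolding lin_def by blast
  have de: "d \<noteq> e"
    using n prec3_if_prec_left[OF nl, of t] t dist unfolding lin_def by auto
  \<comment> \<open>If no \<open>e\<close> followed the linear \<open>t\<close>, the pair
    \<open>d e\<close> alone would yield the triple.\<close>
  have te: "prec t e u"
    using n prec3_if_prec_left[OF p(1), of t] t dist unfolding lin_def by auto
  obtain a b where ab: "u = a @ d # b" "d \<notin> set a"
    using split_list_first prec_in_set[OF p(1)] by metis
  have tb: "t \<in> set b" "t \<notin> set a"
    using p(3) t dist ab by (auto dest: prec_in_set)
  have "\<not> prec e t b"
    using n by (auto simp: ab)
  then have "e \<in> set a"
    using p(2) de tb by (auto simp: ab dest: prec_in_set)
  then obtain p' r where a: "a = p' @ e # r" "e \<notin> set r"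
    by (meson split_list_last)
  have u': "u = p' @ e # (r @ [d]) @ b"
    by (simp add: ab a)
  have eb: "e \<in> set b"
    using te tb dist by (auto simp: ab dest: prec_in_set)
  have "prec s s u" if "s \<in> set r" for s
  proof (rule ccontr)
    assume s: "\<not> prec s s u"
    then have l: "lin s u"
      using that by (auto simp: lin_def u')
    have sn: "s \<notin> set p'" "s \<noteq> e" "s \<noteq> d" "s \<notin> set b"
      using s that by (auto simp: u')
    have "\<not> prec3 s e t r"
      using a(2) by (auto dest: prec3_imp_prec prec_in_set)
    then have "\<not> prec3 s e t u"
      using \<open>\<not> prec e t b\<close> a(2) sn de
      by (auto simp: u' dest!: prec_in_set dest: prec3_imp_prec)
    moreover have "\<not> prec d s u"
      using ab(2) sn by (auto simp: u' a dest: prec_in_set)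
    \<comment> \<open>In \<open>v\<close>, too, \<open>s\<close> stands before \<open>d\<close>, so
      \<open>s\<close> can replace \<open>d\<close> in the triple of \<open>v\<close>; by
      \<open>Q\<close> the triple \<open>s e t\<close> would then occur in \<open>u\<close>.\<close>
    ultimately show False
      using prec3_replace_first[OF v, of s] Q[OF l t(1)] P l N sn unfolding lin_def by auto
  qed
  then have "(p' @ e # (r @ [d]) @ b, p' @ e # (r @ [d]) @ e # b) \<in> E"
    using nl eb by (intro insert_run_A[OF ax]) (auto simp: u')
  then have "((p' @ e # r @ [d]) @ b, (p' @ e # r @ [d]) @ e # b) \<in> agree_all"
    using u by (intro richD) (auto simp: u')
  then show False
    using agree_allD(3)[of "(p' @ e # r @ [d]) @ b" "(p' @ e # r @ [d]) @ e # b" t d e] n t tb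
    by (auto simp: u')
qed

end

context word_congruence
begin

interpretation rev: word_congruence "{(u, v). (rev u, rev v) \<in> E}"
  by (rule word_congruence_rev)

lemma rev_rich: "rich u \<Longrightarrow> rev.rich (rev u)"
  unfolding rev.rich_def
proof (intro allI impI)
  fix p q x
  assume u: "rich u" "rev u = p @ q" and E: "(p @ q, p @ x # q) \<in> {(u, v). (rev u, rev v) \<in> E}"
  then have "u = rev q @ rev p"
    by (metis rev_append rev_rev_ident)
  then have "(rev q @ rev p, rev q @ x # rev p) \<in> agree_all"
    using u E by (intro richD) auto
  then show "(p @ q, p @ x # q) \<in> agree_all"
    using agree_all_rev[of "p @ q" "p @ x # q"] by simp
qed

lemma rich_after_linear:
  assumes "ax vR \<in> E" "rich u" "x \<in> set u" "prec y y u"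
  shows "prec x y u"
  using rev.rich_before_linear[of "rev u" x y] assms rev_rich by simp

lemma rich_prec3_right:
  assumes "ax vB \<in> E" "rich u"
    and "set u = set v" "\<And>x y. prec x y u = prec x y v"
    and "\<And>s x t. lin s u \<Longrightarrow> lin t u \<Longrightarrow> prec3 s x t u = prec3 s x t v"
    and "lin t u" "\<not> prec d t u" "prec3 t e d v"
  shows "prec3 t e d u"
  using rev.rich_prec3_left[of "rev u" "rev v" t d e] assms rev_rich by simp

end

section \<open>The congruences containing the identities of the top variety\<close>

lemma prec_self_iff_count: "prec x x u \<longleftrightarrow> 2 \<le> count (mset u) x"
  by (induction u) (auto simp: numeral_2_eq_2 Suc_le_eq dest: prec_in_set)

lemma down_trans: "i \<in> down X \<Longrightarrow> down i \<subseteq> down X"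
  by (cases X) auto

lemma ax_feat_eq:
  assumes "i \<in> irreducibles" "j \<in> irreducibles" "j \<notin> down i"
  shows "feat i (fst (ax j)) = feat i (snd (ax j))"
  using assms(2,1,3)
  unfolding down.simps by (elim insertE emptyE; hypsubst) (auto simp: feat_eq lin_def)

lemma ax_feat_neq:
  assumes "j \<in> irreducibles"
  shows "feat j (fst (ax j)) \<noteq> feat j (snd (ax j))"
proof -
  \<comment> \<open>The word \<open>w\<close> belongs to the feature \<open>j\<close> of exactly one
    side of \<open>ax j\<close>.\<close>
  define w :: "nat list" where "w = (case j of vM \<Rightarrow> [0, 1] | vL \<Rightarrow> [1, 0] | vR \<Rightarrow> [0, 1] | vA0 \<Rightarrow> [1, 0]
    | vQ \<Rightarrow> [1, 0, 2] | vA \<Rightarrow> [1, 0, 2] | vB \<Rightarrow> [2, 0, 1] | _ \<Rightarrow> [0])"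
  have "w \<in> feat j (fst (ax j)) \<longleftrightarrow> w \<notin> feat j (snd (ax j))"
    using assms unfolding down.simps
    by (elim insertE emptyE; hypsubst) (simp_all add: w_def feat.simps lin_def)
  then show ?thesis
    by blast
qed

lemma ax_in_agree_down: "j \<in> irreducibles \<Longrightarrow> ax j \<in> agree (down X) \<longleftrightarrow> j \<notin> down X"
proof
  assume j: "j \<in> irreducibles" "j \<notin> down X"
  have "feat i (fst (ax j)) = feat i (snd (ax j))" if "i \<in> down X" for i
  proof (rule ax_feat_eq)
    show "i \<in> irreducibles"
      using that by (cases X) auto
    show "j \<notin> down i"
      using down_trans[OF that] j by blast
  qed (fact j)
  then show "ax j \<in> agree (down X)"
    by (simp add: agree_def case_prod_beta)
qed (use ax_feat_neq in \<open>auto simp: agree_def case_prod_beta simp del: down.simps\<close>)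

text \<open>An ideal is determined by its maximal members and minimal non-members; the thirteen
  cases list the possibilities.\<close>

lemma ex_down_eq:
  assumes "D \<subseteq> irreducibles" and "\<And>j. j \<in> D \<Longrightarrow> down j \<subseteq> D"
  shows "\<exists>X. D = down X"
proof -
  have *: "vN \<in> D \<Longrightarrow> vS \<in> D" "vM \<in> D \<Longrightarrow> vN \<in> D" "vL \<in> D \<Longrightarrow> vM \<in> D" "vR \<in> D \<Longrightarrow> vM \<in> D"
    "vA0 \<in> D \<Longrightarrow> vL \<in> D" "vA0 \<in> D \<Longrightarrow> vR \<in> D" "vQ \<in> D \<Longrightarrow> vL \<in> D" "vQ \<in> D \<Longrightarrow> vR \<in> D"
    "vA \<in> D \<Longrightarrow> vA0 \<in> D" "vA \<in> D \<Longrightarrow> vQ \<in> D" "vB \<in> D \<Longrightarrow> vA0 \<in> D" "vB \<in> D \<Longrightarrow> vQ \<in> D"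
    using assms(2) by force+
  have "D \<subseteq> {vS, vN, vM, vL, vR, vA0, vQ, vA, vB}"
    using assms(1) by simp
  note * = * this
  consider "vS \<notin> D" | "vS \<in> D" "vN \<notin> D" | "vN \<in> D" "vM \<notin> D" | "vM \<in> D" "vL \<notin> D" "vR \<notin> D"
    | "vL \<in> D" "vR \<notin> D" | "vR \<in> D" "vL \<notin> D" | "vL \<in> D" "vR \<in> D" "vA0 \<notin> D" "vQ \<notin> D"
    | "vA0 \<in> D" "vQ \<notin> D" | "vQ \<in> D" "vA0 \<notin> D" | "vA0 \<in> D" "vQ \<in> D" "vA \<notin> D" "vB \<notin> D"
    | "vA \<in> D" "vB \<notin> D" | "vB \<in> D" "vA \<notin> D" | "vA \<in> D" "vB \<in> D"
    by blast
  then show ?thesis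
  proof cases
    case 1
    then have "D = down vT"
      unfolding down.simps using * by blast
    then show ?thesis ..
  next
    case 2
    then have "D = down vS"
      unfolding down.simps using * by blast
    then show ?thesis ..
  next
    case 3
    then have "D = down vN"
      unfolding down.simps using * by blast
    then show ?thesis ..
  next
    case 4
    then have "D = down vM"
      unfolding down.simps using * by blast
    then show ?thesis ..
  next
    case 5
    then have "D = down vL"
      unfolding down.simps using * by blast
    then show ?thesis ..
  next
    case 6
    then have "D = down vR"
      unfolding down.simps using * by blast
    then show ?thesis ..
  next
    case 7
    then have "D = down vB0"
      unfolding down.simps using * by blast
    then show ?thesis ..
  next
    case 8
    then have "D = down vA0"
      unfolding down.simps using * by blast
    then show ?thesis ..
  next
    case 9
    then have "D = down vQ"
      unfolding down.simps using * by blast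
    then show ?thesis ..
  next
    case 10
    then have "D = down vA_meet_B"
      unfolding down.simps using * by blast
    then show ?thesis ..
  next
    case 11
    then have "D = down vA"
      unfolding down.simps using * by blast
    then show ?thesis ..
  next
    case 12
    then have "D = down vB"
      unfolding down.simps using * by blast
    then show ?thesis ..
  next
    case 13
    then have "D = down vA_times_B"
      unfolding down.simps using * by blast
    then show ?thesis ..
  qed
qed

context word_congruence
begin

text \<open>Both words are replaced by rich ones, and the invariants of A^1 x B^1 are recovered
  label by label: from \<open>agree D\<close> if the label is in \<open>D\<close>, from richness
  otherwise. The order is from below, because the richness lemmas for higher labels use the
  invariants of lower ones.\<close>

lemma complete_rich:
  assumes D: "vS \<in> D" "vN \<in> D" "vM \<in> D" and le: "E \<subseteq> agree D"
    and ax: "\<And>j. j \<in> irreducibles \<Longrightarrow> j \<in> D \<or> ax j \<in> E"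
  shows "agree D \<subseteq> E"
proof clarify
  fix u0 v0 :: "nat list"
  assume uv0: "(u0, v0) \<in> agree D"
  have S: "set u = set v" if "(u, v) \<in> E" for u v
    using le D(1) that by (auto simp: agree_def feat_S[symmetric])
  obtain u where u: "(u0, u) \<in> E" "rich u"
    using ex_rich[OF S] by blast
  obtain v where v: "(v0, v) \<in> E" "rich v"
    using ex_rich[OF S] by blast
  have "(u, v) \<in> agree D"
    using le u(1) v(1) uv0 unfolding agree_def by blast
  then have uv: "feat j u = feat j v" if "j \<in> D" for j
    using that by (simp add: agree_def)
  have S: "set u = set v" and N: "prec x x u = prec x x v" for x
    using uv[OF D(1)] uv[OF D(2)] unfolding feat_S feat_N by blast+
  then have l: "lin x u = lin x v" for x
    by (simp add: lin_def)
  have M: "prec x y u = prec x y v" if "lin x u" "lin y u" for x y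
    using uv[OF D(3)] that unfolding feat_M l by blast
  have L: "prec y x u = prec y x v" if x: "lin x u" for x y
  proof (cases "vL \<in> D")
    case True
    then show ?thesis
      using uv[OF True] x unfolding feat_L l by blast
  next
    case False
    then have "ax vL \<in> E"
      using ax[of vL] False by simp
    moreover have "x \<in> set u" "x \<in> set v"
      using x S by (simp_all add: lin_def)
    ultimately have "prec y x u" "prec y x v" if "prec y y u"
      using rich_before_linear u(2) v(2) that N[of y] by blast+
    \<comment> \<open>Here \<open>y\<close> is absent or linear, and \<open>vM\<close> decides the
      order of two linear letters.\<close>
    moreover have "prec y x u = prec y x v" if "\<not> prec y y u"
      using M[OF _ x, of y] that S prec_in_set[of y x u] prec_in_set[of y x v] by (auto simp: lin_def)
    ultimately show ?thesis by blast
  qed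
  have R: "prec x y u = prec x y v" if x: "lin x u" for x y
  proof (cases "vR \<in> D")
    case True
    then show ?thesis
      using uv[OF True] x unfolding feat_R l by blast
  next
    case False
    then have "ax vR \<in> E"
      using ax[of vR] False by simp
    moreover have "x \<in> set u" "x \<in> set v"
      using x S by (simp_all add: lin_def)
    ultimately have "prec x y u" "prec x y v" if "prec y y u"
      using rich_after_linear u(2) v(2) that N[of y] by blast+
    moreover have "prec x y u = prec x y v" if "\<not> prec y y u"
      using M[OF x, of y] that S prec_in_set[of x y u] prec_in_set[of x y v] by (auto simp: lin_def)
    ultimately show ?thesis by blast
  qed
  have Q: "prec3 s x t u = prec3 s x t v" if s: "lin s u" "lin t u" for s x t
  proof (cases "vQ \<in> D")
    case True
    then show ?thesis
      using uv[OF True] s unfolding feat_Q l by blast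
  next
    case False
    then have "ax vQ \<in> E"
      using ax[of vQ] False by simp
    note between = rich_between_linear[OF this u(2) s] rich_between_linear[OF this v(2) s[unfolded l]]
    show ?thesis
      using between prec3_imp_prec[of s x t u] prec3_imp_prec[of s x t v]
        R[OF s(1), of x] R[OF s(1), of t] L[OF s(2), of x] by blast
  qed
  have P: "prec x y u = prec x y v" for x y
  proof (cases "vA0 \<in> D")
    case True
    then show ?thesis
      using uv[OF True] unfolding feat_A0 by blast
  next
    case False
    then have "ax vA0 \<in> E"
      using ax[of vA0] False by simp
    note prec = rich_prec[OF this u(2) S N L R] rich_prec[OF this v(2) S[symmetric] N[symmetric]]
    show ?thesis
      using prec L R unfolding l by blast
  qed
  have "(u, v) \<in> agree_all"
  proof (rule agree_allI)
    show "prec3 d e t u = prec3 d e t v" if t: "lin t u" "\<not> prec t d u" for d e t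
    proof (cases "vA \<in> D")
      case True
      then show ?thesis
        using uv[OF True] t P unfolding feat_A l by blast
    next
      case False
      then have "ax vA \<in> E"
        using ax[of vA] False by simp
      note left = rich_prec3_left[OF this u(2) S P Q t] rich_prec3_left[OF this v(2) S[symmetric] P[symmetric]]
      show ?thesis
        using left Q t unfolding l P by blast
    qed
    show "prec3 t e d u = prec3 t e d v" if t: "lin t u" "\<not> prec d t u" for d e t
    proof (cases "vB \<in> D")
      case True
      then show ?thesis
        using uv[OF True] t P unfolding feat_B l by blast
    next
      case False
      then have "ax vB \<in> E"
        using ax[of vB] False by simp
      note right = rich_prec3_right[OF this u(2) S P Q t] rich_prec3_right[OF this v(2) S[symmetric] P[symmetric]]
      show ?thesis
        using right Q t unfolding l P by blast
    qed
  qed (fact S P)+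
  then have "(u, v) \<in> E"
    by (rule agreeE)
  then show "(u0, v0) \<in> E"
    using trans[OF trans[OF u(1)] sym[OF v(1)]] by blast
qed

section \<open>Commutative congruences and the classification of all congruences\<close>

lemma eq_if_mset_eq:
  assumes ax: "ax vM \<in> E"
  shows "mset u = mset v \<Longrightarrow> (u, v) \<in> E"
proof (induction u arbitrary: v)
  case (Cons x u)
  then have "x \<in> set v"
    by (metis list.set_intros(1) set_mset_mset)
  then obtain p q where v: "v = p @ x # q"
    by (meson split_list)
  then have "(u, p @ q) \<in> E"
    using Cons by simp
  then have "(x # u, x # p @ q) \<in> E"
    by (rule cong_Cons)
  moreover have "([] @ (x # p) @ q, [] @ (p @ [x]) @ q) \<in> E"
    using ax subst[of "[0, 1]" "[1, 0]" "\<lambda>i. if i = 0 then [x] else p"] by (intro cong) simp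
  ultimately show ?case
    using trans[of "x # u" "x # p @ q" "p @ x # q"] by (simp add: v)
qed simp

text \<open>Commutativity gathers three occurrences of a letter, and \<open>dup\<close> removes one
  of them.\<close>

lemma ex_short:
  assumes ax: "ax vM \<in> E"
  shows "\<exists>v. (u, v) \<in> E \<and> (\<forall>x. count (mset v) x \<le> 2)"
proof (induction u rule: length_induct)
  case (1 u)
  show ?case
  proof (cases "\<forall>x. count (mset u) x \<le> 2")
    case True
    then show ?thesis
      using refl by blast
  next
    case False
    then obtain x where "3 \<le> count (mset u) x"
      by (metis not_less_eq_eq numeral_2_eq_2 numeral_3_eq_3)
    then have "replicate_mset 3 x \<subseteq># mset u"
      by (simp add: count_le_replicate_mset_subset_eq)
    then obtain w where w: "mset u = replicate_mset 3 x + mset w"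
      by (metis ex_mset mset_subset_eq_exists_conv)
    then have "(u, x # x # x # w) \<in> E"
      by (intro eq_if_mset_eq[OF ax]) (simp add: numeral_3_eq_3)
    also have "(x # x # x # w, x # x # w) \<in> E"
      using sym[OF dup[of x "[]" "x # w"]] by simp
    finally have "(u, x # x # w) \<in> E" .
    moreover have "length (x # x # w) < length u"
      using arg_cong[OF w, of size] by simp
    ultimately show ?thesis
      using 1 trans by blast
  qed
qed

text \<open>The implications between the test identities make \<open>D\<close> an ideal.
  \<open>complete_rich\<close> covers the ideals containing \<open>vM\<close>. Without
  \<open>vM\<close> the congruence is commutative, and multiplicities cut off at two decide it;
  without \<open>vN\<close> every word equals its square, and squares depend on content alone;
  without \<open>vS\<close> all words are equal.\<close>

lemma eq_agree_down: "\<exists>X. E = agree (down X)"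
proof -
  define D where "D = {j \<in> irreducibles. ax j \<notin> E}"
  have "\<exists>X. D = down X"
  proof (rule ex_down_eq)
    show "down j \<subseteq> D" if "j \<in> D" for j
    proof -
      have *: "ax vA \<notin> E \<Longrightarrow> ax vQ \<notin> E" "ax vA \<notin> E \<Longrightarrow> ax vA0 \<notin> E"
        "ax vB \<notin> E \<Longrightarrow> ax vQ \<notin> E" "ax vB \<notin> E \<Longrightarrow> ax vA0 \<notin> E"
        "ax vQ \<notin> E \<Longrightarrow> ax vL \<notin> E" "ax vQ \<notin> E \<Longrightarrow> ax vR \<notin> E"
        "ax vA0 \<notin> E \<Longrightarrow> ax vL \<notin> E" "ax vA0 \<notin> E \<Longrightarrow> ax vR \<notin> E"
        "ax vL \<notin> E \<Longrightarrow> ax vM \<notin> E" "ax vR \<notin> E \<Longrightarrow> ax vM \<notin> E"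
        "ax vM \<notin> E \<Longrightarrow> ax vN \<notin> E" "ax vN \<notin> E \<Longrightarrow> ax vS \<notin> E"
        using S_imp_N N_imp_M M_imp_L M_imp_R L_imp_A0 R_imp_A0 L_imp_Q R_imp_Q
          A0_imp_A A0_imp_B Q_imp_A Q_imp_B by blast+
      have "j \<in> irreducibles" "ax j \<notin> E"
        using that by (auto simp: D_def)
      then show ?thesis
        unfolding D_def down.simps
        by (elim insertE emptyE; hypsubst) (simp_all add: * del: ax.simps)
    qed
  qed (auto simp: D_def)
  then obtain X where X: "D = down X" by blast
  have le: "E \<subseteq> agree D"
    unfolding agree_def D_def using feat_agree by blast
  have ax: "j \<in> D \<or> ax j \<in> E" if "j \<in> irreducibles" for j
    using that by (auto simp: D_def)
  have "agree D \<subseteq> E"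
  proof (cases "vM \<in> D")
    case True
    then have "vS \<in> D" "vN \<in> D"
      unfolding X by (cases X; simp)+
    then show ?thesis
      using True complete_rich le ax by blast
  next
    case M: False
    show ?thesis
    proof (cases "vN \<in> D")
      case N: True
      then have "D = {vS, vN}" "ax vM \<in> E"
        using M ax[of vM] unfolding X by (cases X; simp)+
      show ?thesis
      proof clarify
        fix u v :: "nat list" assume uv: "(u, v) \<in> agree D"
        obtain u' where u': "(u, u') \<in> E" "\<And>x. count (mset u') x \<le> 2"
          using ex_short[OF \<open>ax vM \<in> E\<close>] by blast
        obtain v' where v': "(v, v') \<in> E" "\<And>x. count (mset v') x \<le> 2"
          using ex_short[OF \<open>ax vM \<in> E\<close>] by blast
        have "(u', v') \<in> agree D"
          using le u'(1) v'(1) uv unfolding agree_def by blast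
        then have *: "set u' = set v'" "\<And>x. prec x x u' = prec x x v'"
          by (simp_all add: agree_def \<open>D = {vS, vN}\<close> feat_eq)
        have "count (mset u') x = count (mset v') x" for x
        proof -
          have "0 < count (mset u') x \<longleftrightarrow> 0 < count (mset v') x"
            using * by simp
          moreover have "2 \<le> count (mset u') x \<longleftrightarrow> 2 \<le> count (mset v') x"
            using *(2) prec_self_iff_count by metis
          ultimately show ?thesis
            using u'(2)[of x] v'(2)[of x] by linarith
        qed
        then have "(u', v') \<in> E"
          by (intro eq_if_mset_eq[OF \<open>ax vM \<in> E\<close>]) (rule multiset_eqI)
        then show "(u, v) \<in> E"
          using trans[OF trans[OF u'(1)] sym[OF v'(1)]] by blast
      qed
    next
      case N: False
      then have axN: "([0], [0, 0]) \<in> E"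
        using ax[of vN] by simp
      show ?thesis
      proof (cases "vS \<in> D")
        case True
        show ?thesis
        proof clarify
          fix u v :: "nat list" assume "(u, v) \<in> agree D"
          then have "set u = set v"
            using True by (auto simp: agree_def feat_S[symmetric])
          then have "(u @ u, v @ v) \<in> E"
            by (intro agreeE agree_all_nonlinI) (auto dest: prec_in_set)
          moreover have sq: "(w, w @ w) \<in> E" for w
            using subst[OF axN, of "\<lambda>_. w"] by simp
          ultimately show "(u, v) \<in> E"
            using trans2 sym[OF sq] by blast
        qed
      next
        case False
        then have "([0], []) \<in> E"
          using ax[of vS] by simp
        then have empty: "(w, []) \<in> E" for w
          using subst[of "[0]" "[]" "\<lambda>_. w"] by simp
        show ?thesis
          using trans[OF empty sym[OF empty]] by auto
      qed
    qed
  qed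
  with le have "E = agree D" by simp
  then show ?thesis
    using X by blast
qed

end

section \<open>Identities and varieties\<close>

primrec weval :: "'a monoid \<Rightarrow> ('x \<Rightarrow> 'a) \<Rightarrow> 'x list \<Rightarrow> 'a" where
  "weval G \<phi> [] = \<one>\<^bsub>G\<^esub>"
| "weval G \<phi> (x # u) = \<phi> x \<otimes>\<^bsub>G\<^esub> weval G \<phi> u"

lemma weval_closed: "monoid G \<Longrightarrow> range \<phi> \<subseteq> carrier G \<Longrightarrow> weval G \<phi> u \<in> carrier G"
  by (induction u) (auto simp: monoid.one_closed monoid.m_closed image_subset_iff)

lemma weval_append:
  "monoid G \<Longrightarrow> range \<phi> \<subseteq> carrier G \<Longrightarrow> weval G \<phi> (u @ v) = weval G \<phi> u \<otimes>\<^bsub>G\<^esub> weval G \<phi> v"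
  by (induction u) (auto simp: monoid.l_one monoid.m_assoc weval_closed image_subset_iff)

lemma weval_concat_map:
  "monoid G \<Longrightarrow> range \<phi> \<subseteq> carrier G \<Longrightarrow>
     weval G \<phi> (concat (map f u)) = weval G (\<lambda>x. weval G \<phi> (f x)) u"
  by (induction u) (simp_all add: weval_append)

lemma weval_map: "weval G \<phi> (map f u) = weval G (\<phi> \<circ> f) u"
  by (induction u) simp_all

lemma weval_hom:
  assumes "monoid G" "h \<in> hom G N" "h \<one>\<^bsub>G\<^esub> = \<one>\<^bsub>N\<^esub>" "range \<phi> \<subseteq> carrier G"
  shows "h (weval G \<phi> u) = weval N (h \<circ> \<phi>) u"
  by (induction u) (use assms weval_closed[OF assms(1,4)] in \<open>auto simp: hom_mult image_subset_iff\<close>)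

definition sat :: "'a monoid \<Rightarrow> 'x list \<Rightarrow> 'x list \<Rightarrow> bool" where
  "sat G u v \<longleftrightarrow> (\<forall>\<phi>. range \<phi> \<subseteq> carrier G \<longrightarrow> weval G \<phi> u = weval G \<phi> v)"

text \<open>An identity involves finitely many letters, so \<open>nat\<close> supplies enough of
  them.\<close>

definition identities :: "'a monoid set \<Rightarrow> (nat list \<times> nat list) set" where
  "identities K = {(u, v). \<forall>G\<in>K. sat G u v}"

definition models :: "(nat list \<times> nat list) set \<Rightarrow> 'a monoid set" where
  "models E = {N. monoid N \<and> (\<forall>(u, v)\<in>E. sat N u v)}"

lemma sat_if_hom_image:
  fixes u v :: "'x list" and N :: "'b monoid"
  assumes G: "monoid G" and h: "h \<in> hom G N" "h \<one>\<^bsub>G\<^esub> = \<one>\<^bsub>N\<^esub>" "h ` carrier G = carrier N"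
    and sat: "sat G u v"
  shows "sat N u v"
  unfolding sat_def
proof (intro allI impI)
  fix \<phi> :: "'x \<Rightarrow> 'b" assume "range \<phi> \<subseteq> carrier N"
  then have "\<forall>x. \<exists>y. y \<in> carrier G \<and> h y = \<phi> x"
    using h(3) by (metis image_iff range_subsetD)
  then obtain \<psi> where \<psi>: "\<And>x. \<psi> x \<in> carrier G" "h \<circ> \<psi> = \<phi>"
    by (auto simp: fun_eq_iff dest!: choice)
  then have "range \<psi> \<subseteq> carrier G"
    by auto
  then show "weval N \<phi> u = weval N \<phi> v"
    using weval_hom[OF G h(1,2), of \<psi>] sat \<psi>(2) unfolding sat_def by metis
qed

text \<open>\<open>iso\<close> speaks only of multiplication; the identity is preserved because its
  image acts as a unit on the range of \<open>h\<close>, which is all of \<open>N\<close>.\<close>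

lemma iso_one:
  assumes "monoid G" "monoid N" "h \<in> iso G N"
  shows "h \<one>\<^bsub>G\<^esub> = \<one>\<^bsub>N\<^esub>"
proof -
  interpret G: monoid G by fact
  interpret N: monoid N by fact
  have h: "h \<in> hom G N" "h ` carrier G = carrier N"
    using assms(3) by (auto simp: iso_def bij_betw_def)
  then obtain x where x: "x \<in> carrier G" "h x = \<one>\<^bsub>N\<^esub>"
    using N.one_closed by (metis imageE)
  have "h \<one>\<^bsub>G\<^esub> = h \<one>\<^bsub>G\<^esub> \<otimes>\<^bsub>N\<^esub> h x"
    using x N.r_one[OF hom_in_carrier[OF h(1) G.one_closed]] by simp
  also have "\<dots> = h (\<one>\<^bsub>G\<^esub> \<otimes>\<^bsub>G\<^esub> x)"
    by (rule hom_mult[OF h(1) G.one_closed x(1), symmetric])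
  finally show ?thesis
    using x by simp
qed

lemma is_iso_sym:
  assumes G: "monoid G" and iso: "G \<cong> N"
  shows "N \<cong> G"
proof -
  obtain h where h: "h \<in> hom G N" "bij_betw h (carrier G) (carrier N)"
    using iso by (auto simp: is_iso_def iso_def)
  let ?k = "inv_into (carrier G) h"
  have k: "bij_betw ?k (carrier N) (carrier G)"
    using h(2) by (rule bij_betw_inv_into)
  have "?k (x \<otimes>\<^bsub>N\<^esub> y) = ?k x \<otimes>\<^bsub>G\<^esub> ?k y" if "x \<in> carrier N" "y \<in> carrier N" for x y
  proof -
    have *: "?k x \<in> carrier G" "?k y \<in> carrier G" "h (?k x) = x" "h (?k y) = y"
      using that k h(2) by (auto simp: bij_betw_def f_inv_into_f inv_into_into)
    then have "x \<otimes>\<^bsub>N\<^esub> y = h (?k x \<otimes>\<^bsub>G\<^esub> ?k y)"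
      using h(1) by (simp add: hom_mult)
    then show ?thesis
      using * monoid.m_closed[OF G] h(2) by (simp add: bij_betw_inv_into_left)
  qed
  then have "?k \<in> iso N G"
    using k by (auto simp: iso_def hom_def bij_betw_def)
  then show ?thesis
    by (rule is_isoI)
qed

lemma sat_iso_imp:
  assumes "monoid G" "monoid N" "G \<cong> N" "sat G u v"
  shows "sat N u v"
proof -
  obtain h where h: "h \<in> iso G N"
    using assms(3) by (auto simp: is_iso_def)
  then show ?thesis
    using assms iso_one[OF assms(1,2) h] by (intro sat_if_hom_image[of G h]) (auto simp: iso_def bij_betw_def)
qed

lemma sat_iso:
  assumes "monoid G" "monoid N" "G \<cong> N"
  shows "sat N u v \<longleftrightarrow> sat G u v"
  using sat_iso_imp[OF assms] sat_iso_imp[OF assms(2,1) is_iso_sym[OF assms(1,3)]] by blast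

lemma sat_submonoid:
  assumes "submonoid P G" "sat G u v"
  shows "sat (G\<lparr>carrier := P\<rparr>) u v"
proof -
  have "weval (G\<lparr>carrier := P\<rparr>) \<phi> w = weval G \<phi> w" for \<phi> :: "'b \<Rightarrow> 'a" and w
    by (induction w) simp_all
  moreover have "range \<phi> \<subseteq> carrier G" if "range \<phi> \<subseteq> P" for \<phi> :: "'b \<Rightarrow> 'a"
    using that submonoid.subset[OF assms(1)] by blast
  ultimately show ?thesis
    using assms(2) by (simp add: sat_def)
qed

section \<open>Birkhoff's theorem within a fixed universe\<close>

lemma monoid_product_group:
  assumes F: "\<And>i. i \<in> I \<Longrightarrow> monoid (F i)"
  shows "monoid (product_group I F)"
proof (rule monoidI; simp)
  show "(\<lambda>i. x i \<otimes>\<^bsub>F i\<^esub> y i) \<in> (\<Pi> i\<in>I. carrier (F i))"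
    if "x \<in> (\<Pi>\<^sub>E i\<in>I. carrier (F i))" "y \<in> (\<Pi>\<^sub>E i\<in>I. carrier (F i))" for x y
    using that by (auto simp: PiE_iff F monoid.m_closed)
  show "(\<lambda>i. \<one>\<^bsub>F i\<^esub>) \<in> (\<Pi> i\<in>I. carrier (F i))"
    by (simp add: F monoid.one_closed)
  show "(\<lambda>i\<in>I. (if i \<in> I then x i \<otimes>\<^bsub>F i\<^esub> y i else undefined) \<otimes>\<^bsub>F i\<^esub> z i) =
        (\<lambda>i\<in>I. x i \<otimes>\<^bsub>F i\<^esub> (if i \<in> I then y i \<otimes>\<^bsub>F i\<^esub> z i else undefined))"
    if "x \<in> (\<Pi>\<^sub>E i\<in>I. carrier (F i))" "y \<in> (\<Pi>\<^sub>E i\<in>I. carrier (F i))" "z \<in> (\<Pi>\<^sub>E i\<in>I. carrier (F i))" for x y z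
    using that by (auto simp: PiE_iff F monoid.m_assoc intro: restrict_ext)
  show "(\<lambda>i\<in>I. (if i \<in> I then \<one>\<^bsub>F i\<^esub> else undefined) \<otimes>\<^bsub>F i\<^esub> x i) = x"
    if "x \<in> (\<Pi>\<^sub>E i\<in>I. carrier (F i))" for x
    using that by (auto simp: PiE_iff F monoid.l_one extensional_def)
  show "(\<lambda>i\<in>I. x i \<otimes>\<^bsub>F i\<^esub> (if i \<in> I then \<one>\<^bsub>F i\<^esub> else undefined)) = x"
    if "x \<in> (\<Pi>\<^sub>E i\<in>I. carrier (F i))" for x
    using that by (auto simp: PiE_iff F monoid.r_one extensional_def)
qed

lemma weval_product_group: "weval (product_group I F) \<phi> u = (\<lambda>i\<in>I. weval (F i) (\<lambda>x. \<phi> x i) u)"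
  by (induction u) (auto simp: fun_eq_iff)

lemma sat_product_group:
  fixes u v :: "'x list" and F :: "'i \<Rightarrow> 'a monoid"
  assumes "\<And>i. i \<in> I \<Longrightarrow> sat (F i) u v"
  shows "sat (product_group I F) u v"
  unfolding sat_def weval_product_group
proof (intro allI impI restrict_ext)
  fix \<phi> :: "'x \<Rightarrow> 'i \<Rightarrow> 'a" and i assume \<phi>: "range \<phi> \<subseteq> carrier (product_group I F)" and i: "i \<in> I"
  have "range (\<lambda>x. \<phi> x i) \<subseteq> carrier (F i)"
    using range_subsetD[OF \<phi>] i by (auto simp: PiE_iff)
  then show "weval (F i) (\<lambda>x. \<phi> x i) u = weval (F i) (\<lambda>x. \<phi> x i) v"
    by (rule assms[OF i, unfolded sat_def, rule_format])
qed

lemma monoid_variety_models: "monoid_variety (models E :: 'u monoid set)"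
  unfolding monoid_variety_def
proof (intro conjI ballI subsetI)
  fix N :: "'u monoid" assume "N \<in> HSP (models E)"
  then obtain I :: "'u set" and F :: "'u \<Rightarrow> 'u monoid" and P h where *: "monoid N" "\<forall>i\<in>I. F i \<in> models E"
    "submonoid P (product_group I F)" "h \<in> hom ((product_group I F)\<lparr>carrier := P\<rparr>) N"
    "h \<one>\<^bsub>product_group I F\<^esub> = \<one>\<^bsub>N\<^esub>" "h ` P = carrier N"
    unfolding HSP_def by blast
  have F: "monoid (F i)" "\<And>u v. (u, v) \<in> E \<Longrightarrow> sat (F i) u v" if "i \<in> I" for i
    using *(2) that by (auto simp: models_def)
  have "sat N u v" if "(u, v) \<in> E" for u v
  proof (rule sat_if_hom_image)
    show "monoid ((product_group I F)\<lparr>carrier := P\<rparr>)"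
      using submonoid.submonoid_is_monoid[OF *(3) monoid_product_group] F(1) .
    show "sat ((product_group I F)\<lparr>carrier := P\<rparr>) u v"
      using sat_submonoid[OF *(3) sat_product_group] F(2)[OF _ that] .
  qed (use * in simp_all)
  then show "N \<in> models E"
    using *(1) by (auto simp: models_def)
qed (simp add: models_def)

lemma ex_inj_list_pairs:
  assumes "infinite (UNIV :: 'u set)"
  shows "\<exists>j :: 'u list \<times> 'u list \<Rightarrow> 'u. inj j"
proof -
  obtain p :: "'u \<times> 'u \<Rightarrow> 'u" where "bij_betw p (UNIV \<times> UNIV) UNIV"
    using card_of_ordIso[THEN iffD2, OF card_of_Times_same_infinite[OF assms]] by blast
  then have "inj p"
    by (simp add: bij_betw_def)
  then have p: "p (a, b) = p (c, d) \<longleftrightarrow> a = c \<and> b = d" for a b c d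
    by (simp add: inj_eq)
  obtain n :: "nat \<Rightarrow> 'u" where n: "inj n"
    using infinite_countable_subset[OF assms] by blast
  \<comment> \<open>This iterated pairing need not separate words of different lengths, so the
    length is recorded next to it.\<close>
  define enc where "enc = rec_list (undefined :: 'u) (\<lambda>x _ e. p (x, e))"
  have enc: "length u = length v \<Longrightarrow> enc u = enc v \<Longrightarrow> u = v" for u v :: "'u list"
    by (induction u v rule: list_induct2) (auto simp: enc_def p)
  show ?thesis
  proof
    show "inj (\<lambda>(u, v). p (p (n (length u), enc u), p (n (length v), enc v)))"
      by (rule injI) (auto simp: p inj_eq[OF n] enc)
  qed
qed

text \<open>\<open>range ev\<close> is a copy of the free monoid of \<open>V\<close> on the letters
  \<open>'u\<close>, inside a product with one factor for each pair of words that \<open>V\<close>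
  separates; the injection \<open>j\<close> provides indices in \<open>'u\<close>. By
  \<open>key\<close>, evaluation in \<open>N\<close> factors through \<open>ev\<close>, so
  \<open>N\<close> is a quotient of this submonoid.\<close>

lemma monoid_variety_eq_models:
  fixes V :: "'u monoid set"
  assumes inf: "infinite (UNIV :: 'u set)" and V: "monoid_variety V"
  shows "V = models (identities V)"
proof
  show "V \<subseteq> models (identities V)"
    using V by (auto simp: models_def identities_def monoid_variety_def)
  show "models (identities V) \<subseteq> V"
  proof
    fix N :: "'u monoid" assume "N \<in> models (identities V)"
    then have N: "monoid N" and sat: "\<And>u v. (u, v) \<in> identities V \<Longrightarrow> sat N u v"
      by (auto simp: models_def)
    obtain j :: "'u list \<times> 'u list \<Rightarrow> 'u" where j: "inj j"
      using ex_inj_list_pairs[OF inf] by blast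
    \<comment> \<open>The elements of \<open>'u\<close> themselves serve as letters; those outside
      the carrier get the value one so that \<open>\<psi>\<close> maps into
      \<open>N\<close>.\<close>
    define \<psi> where "\<psi> x = (if x \<in> carrier N then x else \<one>\<^bsub>N\<^esub>)" for x
    have \<psi>: "range \<psi> \<subseteq> carrier N"
      using monoid.one_closed[OF N] by (auto simp: \<psi>_def)
    define S where "S = {(u, v) | u v. \<exists>M\<in>V. \<exists>\<phi> :: 'u \<Rightarrow> 'u. range \<phi> \<subseteq> carrier M \<and> weval M \<phi> u \<noteq> weval M \<phi> v}"
    have "\<forall>p\<in>S. \<exists>M \<phi>. M \<in> V \<and> range \<phi> \<subseteq> carrier M \<and> weval M \<phi> (fst p) \<noteq> weval M \<phi> (snd p)"
      by (auto simp: S_def)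
    then obtain M \<Phi> where M: "\<And>p. p \<in> S \<Longrightarrow> M p \<in> V \<and> range (\<Phi> p) \<subseteq> carrier (M p)
        \<and> weval (M p) (\<Phi> p) (fst p) \<noteq> weval (M p) (\<Phi> p) (snd p)"
      by metis
    define F where "F i = M (inv_into UNIV j i)" for i
    define ev where "ev w = (\<lambda>i\<in>j ` S. weval (F i) (\<Phi> (inv_into UNIV j i)) w)" for w
    have F: "monoid (F i)" "range (\<Phi> (inv_into UNIV j i)) \<subseteq> carrier (F i)" "F i \<in> V" if "i \<in> j ` S" for i
    proof -
      obtain p where p: "p \<in> S" "i = j p"
        using imageE[OF \<open>i \<in> j ` S\<close>] .
      show "monoid (F i)" "range (\<Phi> (inv_into UNIV j i)) \<subseteq> carrier (F i)" "F i \<in> V"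
        using M[OF p(1)] V j by (simp_all add: p(2) F_def monoid_variety_def)
    qed
    let ?G = "product_group (j ` S) F"
    have ev_one: "\<one>\<^bsub>?G\<^esub> = ev []"
      by (auto simp: ev_def)
    have ev_mult: "ev u \<otimes>\<^bsub>?G\<^esub> ev v = ev (u @ v)" for u v
      using F by (auto simp: ev_def weval_append intro!: restrict_ext)
    have "ev w \<in> carrier ?G" for w
      using F by (auto simp: ev_def weval_closed)
    then have sub: "submonoid (range ev) ?G"
      using ev_one ev_mult by unfold_locales auto
    have key: "weval N \<psi> u = weval N \<psi> v" if eq: "ev u = ev v" for u v
    proof -
      have "(u, v) \<notin> S"
      proof
        assume S: "(u, v) \<in> S"
        then have "ev u (j (u, v)) \<noteq> ev v (j (u, v))"
          using M[OF S] j by (simp add: ev_def F_def)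
        with eq show False by simp
      qed
      then have uv: "weval K \<phi> u = weval K \<phi> v" if "K \<in> V" "range \<phi> \<subseteq> carrier K" for K and \<phi> :: "'u \<Rightarrow> 'u"
        using that by (auto simp: S_def)
      \<comment> \<open>\<open>identities\<close> is stated over \<open>nat\<close>, so the finitely
        many letters of the two words are renamed into \<open>nat\<close> and back.\<close>
      obtain f :: "'u \<Rightarrow> nat" where "inj_on f (set (u @ v))"
        using finite_imp_inj_to_nat_seg[of "set (u @ v)"] by blast
      then have g: "map (inv_into (set (u @ v)) f) (map f u) = u" "map (inv_into (set (u @ v)) f) (map f v) = v"
        by (auto simp: map_idI)
      have "(map f u, map f v) \<in> identities V"
        using uv by (simp add: identities_def sat_def weval_map image_subset_iff)
      then have "weval N (\<psi> \<circ> inv_into (set (u @ v)) f) (map f u) = weval N (\<psi> \<circ> inv_into (set (u @ v)) f) (map f v)"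
        using sat \<psi> unfolding sat_def by (auto simp: image_subset_iff)
      then show ?thesis
        unfolding weval_map[symmetric] g .
    qed
    define h where "h p = weval N \<psi> (SOME w. ev w = p)" for p
    have h: "h (ev w) = weval N \<psi> w" for w
      unfolding h_def by (rule key) (rule someI[of _ w], rule HOL.refl)
    have "h \<in> hom (?G\<lparr>carrier := range ev\<rparr>) N"
      using N \<psi> ev_mult by (auto simp: hom_def h weval_closed weval_append)
    moreover have "h ` range ev = carrier N"
    proof -
      have "x \<in> h ` range ev" if "x \<in> carrier N" for x
      proof -
        have "h (ev [x]) = x"
          using that by (simp add: h \<psi>_def monoid.r_one[OF N])
        then show ?thesis by (metis rangeI image_eqI)
      qed
      then show ?thesis
        using N \<psi> by (auto simp: h weval_closed)
    qed
    moreover have "h \<one>\<^bsub>?G\<^esub> = \<one>\<^bsub>N\<^esub>"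
      unfolding ev_one h by simp
    ultimately have "N \<in> HSP V"
      unfolding HSP_def using N F(3) sub by blast
    then show "N \<in> V"
      using V by (auto simp: monoid_variety_def)
  qed
qed

section \<open>Varieties generated by a finite monoid\<close>

lemma ex_copy:
  assumes inf: "infinite (UNIV :: 'u set)" and G: "monoid G" "finite (carrier G)"
  shows "\<exists>N :: 'u monoid. monoid N \<and> G \<cong> N"
proof -
  obtain A :: "'u set" where A: "finite A" "card A = card (carrier G)"
    using infinite_arbitrarily_large[OF inf] by blast
  then obtain f where f: "bij_betw f (carrier G) A"
    using finite_same_card_bij[OF G(2)] by metis
  let ?g = "inv_into (carrier G) f"
  define N where "N = \<lparr>carrier = A, monoid.mult = \<lambda>x y. f (?g x \<otimes>\<^bsub>G\<^esub> ?g y), one = f \<one>\<^bsub>G\<^esub>\<rparr>"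
  have fg: "\<And>x. x \<in> carrier G \<Longrightarrow> ?g (f x) = x" "\<And>x. x \<in> carrier G \<Longrightarrow> f x \<in> A"
    "\<And>y. y \<in> A \<Longrightarrow> ?g y \<in> carrier G" "\<And>y. y \<in> A \<Longrightarrow> f (?g y) = y"
    using f by (auto simp: bij_betw_def f_inv_into_f inv_into_into)
  interpret G: monoid G by fact
  have "monoid N"
    by (rule monoidI) (auto simp: N_def fg G.m_assoc)
  moreover have "f \<in> iso G N"
    using f by (auto simp: iso_def hom_def N_def fg)
  ultimately show ?thesis
    using is_isoI by blast
qed

text \<open>A variety that contains a copy of \<open>G\<close> satisfies only identities of
  \<open>G\<close>, and it consists of all models of its identities.\<close>

lemma var_generated_eq_models:
  assumes inf: "infinite (UNIV :: 'u set)" and G: "monoid G" "finite (carrier G)"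
  shows "(var_generated {G} :: 'u monoid set) = models (identities {G})"
proof
  have "N \<in> models (identities {G})" if "monoid N" "G \<cong> N" for N :: "'u monoid"
    using that by (simp add: models_def identities_def sat_iso[OF G(1) that])
  then show "(var_generated {G} :: 'u monoid set) \<subseteq> models (identities {G})"
    unfolding var_generated_def using monoid_variety_models[of "identities {G}"]
    by (intro Inter_lower) simp
  obtain N :: "'u monoid" where N: "monoid N" "G \<cong> N"
    using ex_copy[OF inf G] by blast
  show "models (identities {G}) \<subseteq> (var_generated {G} :: 'u monoid set)"
    unfolding var_generated_def
  proof (intro Inter_greatest)
    fix V :: "'u monoid set"
    assume "V \<in> {V. monoid_variety V \<and> (\<forall>G\<in>{G}. \<forall>N. monoid N \<and> G \<cong> N \<longrightarrow> N \<in> V)}"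
    then have V: "monoid_variety V" "N \<in> V"
      using N by auto
    then have "identities V \<subseteq> identities {G}"
      using V(2) by (auto simp: identities_def sat_iso[OF G(1) N, symmetric])
    then have "models (identities {G}) \<subseteq> (models (identities V) :: 'u monoid set)"
      by (auto simp: models_def)
    also have "\<dots> = V"
      using monoid_variety_eq_models[OF inf V(1)] by simp
    finally show "models (identities {G}) \<subseteq> V" .
  qed
qed

text \<open>A copy of \<open>G\<close> over \<open>'u\<close> is among the models of
  \<open>E\<close>.\<close>

lemma identities_models_subset:
  assumes inf: "infinite (UNIV :: 'u set)" and G: "monoid G" "finite (carrier G)" and E: "E \<subseteq> identities {G}"
  shows "identities (models E :: 'u monoid set) \<subseteq> identities {G}"
proof -
  obtain N :: "'u monoid" where N: "monoid N" "G \<cong> N"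
    using ex_copy[OF inf G] by blast
  have "N \<in> models E"
    using N(1) E by (auto simp: models_def identities_def sat_iso[OF G(1) N])
  then show ?thesis
    by (auto simp: identities_def sat_iso[OF G(1) N, symmetric])
qed

section \<open>Multiplication tables of the presented monoids\<close>

lemma carrier_adjoin_one [simp]: "carrier (adjoin_one X f) = insert None (Some ` X)"
  and mult_adjoin_one [simp]: "monoid.mult (adjoin_one X f) = mult_adjoin f"
  and one_adjoin_one [simp]: "one (adjoin_one X f) = None"
  by (simp_all add: adjoin_one_def)

lemma mult_adjoin_None [simp]: "mult_adjoin f x None = x"
  by (cases x) auto

lemma monoid_adjoin_one:
  assumes "\<And>x y. x \<in> X \<Longrightarrow> y \<in> X \<Longrightarrow> f x y \<in> X"
    and "\<And>x y z. x \<in> X \<Longrightarrow> y \<in> X \<Longrightarrow> z \<in> X \<Longrightarrow> f (f x y) z = f x (f y z)"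
  shows "monoid (adjoin_one X f)"
  by (rule monoidI) (use assms in auto)

text \<open>The value at \<open>[]\<close> is a default: the empty word is no element of the free
  semigroup.\<close>

fun sg_eval :: "('a \<Rightarrow> 'a \<Rightarrow> 'a) \<Rightarrow> 'a \<Rightarrow> ('x \<Rightarrow> 'a) \<Rightarrow> 'x list \<Rightarrow> 'a" where
  "sg_eval f z g [] = z"
| "sg_eval f z g [x] = g x"
| "sg_eval f z g (x # y # w) = f (g x) (sg_eval f z g (y # w))"

definition sg0_eval :: "('a \<Rightarrow> 'a \<Rightarrow> 'a) \<Rightarrow> 'a \<Rightarrow> ('x \<Rightarrow> 'a) \<Rightarrow> 'x list option \<Rightarrow> 'a" where
  "sg0_eval f z g u = (case u of None \<Rightarrow> z | Some w \<Rightarrow> sg_eval f z g w)"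

lemma mult0_None [simp]: "mult0 u None = None"
  by (cases u) auto

lemma Some_in_free_sg0 [simp]: "Some w \<in> free_sg0 X \<longleftrightarrow> w \<noteq> [] \<and> set w \<subseteq> X"
  and None_in_free_sg0 [simp]: "None \<in> free_sg0 X"
  by (auto simp: free_sg0_def)

lemma mult0_closed: "u \<in> free_sg0 X \<Longrightarrow> v \<in> free_sg0 X \<Longrightarrow> mult0 u v \<in> free_sg0 X"
  by (cases u; cases v) auto

text \<open>The relators hold in the table, so congruent words have equal values. Conversely,
  \<open>nf_gen\<close> and \<open>nf_step\<close> let a word be evaluated from right to left inside
  the presentation, so it is congruent to the normal form \<open>nf\<close> of its value. Congruence
  classes and table elements thus correspond.\<close>

lemma presented_one_iso:
  fixes C :: "'a set" and f :: "'a \<Rightarrow> 'a \<Rightarrow> 'a"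
  assumes f: "\<And>x y. x \<in> C \<Longrightarrow> y \<in> C \<Longrightarrow> f x y \<in> C"
    and assoc: "\<And>x y w. x \<in> C \<Longrightarrow> y \<in> C \<Longrightarrow> w \<in> C \<Longrightarrow> f (f x y) w = f x (f y w)"
    and z: "z \<in> C" "\<And>c. c \<in> C \<Longrightarrow> f z c = z" "\<And>c. c \<in> C \<Longrightarrow> f c z = z"
    and g: "\<And>x. x \<in> X \<Longrightarrow> g x \<in> C"
    and E: "E \<subseteq> free_sg0 X \<times> free_sg0 X" "\<And>u v. (u, v) \<in> E \<Longrightarrow> sg0_eval f z g u = sg0_eval f z g v"
    and nf: "\<And>c. c \<in> C \<Longrightarrow> nf c \<in> free_sg0 X" "\<And>c. c \<in> C \<Longrightarrow> sg0_eval f z g (nf c) = c" "nf z = None"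
    and nf_gen: "\<And>x. x \<in> X \<Longrightarrow> (Some [x], nf (g x)) \<in> pres_cong X E"
    and nf_step: "\<And>x c. x \<in> X \<Longrightarrow> c \<in> C \<Longrightarrow> (mult0 (Some [x]) (nf c), nf (f (g x) c)) \<in> pres_cong X E"
  shows "adjoin_one C f \<cong> presented_one X E"
proof -
  let ?e = "sg0_eval f z g" and ?R = "pres_cong X E"
  have sg_closed: "sg_eval f z g w \<in> C" if "set w \<subseteq> X" for w
    using that by (induction w rule: induct_list012) (auto simp: z f g)
  have e_closed: "?e u \<in> C" if "u \<in> free_sg0 X" for u
    using that sg_closed by (cases u) (auto simp: sg0_eval_def z)
  have sg_append: "sg_eval f z g (v @ w) = f (sg_eval f z g v) (sg_eval f z g w)"
    if "v \<noteq> []" "w \<noteq> []" "set v \<subseteq> X" "set w \<subseteq> X" for v w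
    using that
  proof (induction v rule: induct_list012)
    case (2 x)
    then show ?case by (cases w) auto
  next
    case (3 x y v)
    then have "sg_eval f z g (y # v) \<in> C" "sg_eval f z g w \<in> C" "g x \<in> C"
      using sg_closed[of "y # v"] sg_closed[of w] g by auto
    with 3 show ?case
      using assoc by simp
  qed simp
  have e_mult: "?e (mult0 u v) = f (?e u) (?e v)" if "u \<in> free_sg0 X" "v \<in> free_sg0 X" for u v
    using that sg_closed sg_append
    by (cases u; cases v) (auto simp: sg0_eval_def z)
  have R: "u \<in> free_sg0 X \<and> v \<in> free_sg0 X \<and> ?e u = ?e v" if "(u, v) \<in> ?R" for u v
    using that
  proof induction
    case (relator u v)
    then show ?case using E by blast
  next
    case (cong u v u' v')
    then show ?case by (simp add: mult0_closed e_mult)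
  qed auto
  have nf_word: "w \<noteq> [] \<Longrightarrow> set w \<subseteq> X \<Longrightarrow> (Some w, nf (sg_eval f z g w)) \<in> ?R" for w
  proof (induction w rule: induct_list012)
    case (2 x)
    then show ?case using nf_gen by simp
  next
    case (3 x y w)
    then have "(mult0 (Some [x]) (Some (y # w)), mult0 (Some [x]) (nf (sg_eval f z g (y # w)))) \<in> ?R"
      by (intro pres_cong.cong pres_cong.refl) auto
    moreover have "(mult0 (Some [x]) (nf (sg_eval f z g (y # w))), nf (f (g x) (sg_eval f z g (y # w)))) \<in> ?R"
      using 3 sg_closed[of "y # w"] by (intro nf_step) auto
    ultimately show ?case
      using pres_cong.trans by fastforce
  qed simp
  have nf_e: "(u, nf (?e u)) \<in> ?R" if "u \<in> free_sg0 X" for u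
    using that nf_word pres_cong.refl[of None X E]
    by (cases u) (auto simp: sg0_eval_def nf(3))
  have cls: "?R `` {u} = ?R `` {v}" if "(u, v) \<in> ?R" for u v
    using that pres_cong.sym pres_cong.trans by blast
  have mult_cls: "pres_mult X E (?R `` {u}) (?R `` {v}) = ?R `` {mult0 u v}"
    if uv: "u \<in> free_sg0 X" "v \<in> free_sg0 X" for u v
  proof -
    have "?R `` {mult0 u v} = ?R `` {mult0 u' v'}" if "u' \<in> ?R `` {u}" "v' \<in> ?R `` {v}" for u' v'
      using that by (intro cls pres_cong.cong) auto
    moreover have "u \<in> ?R `` {u}" "v \<in> ?R `` {v}"
      using uv by (auto intro: pres_cong.refl)
    ultimately show ?thesis
      unfolding pres_mult_def by blast
  qed
  define k where "k = map_option (\<lambda>c. ?R `` {nf c})"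
  have "k \<in> hom (adjoin_one C f) (presented_one X E)"
  proof (rule homI)
    fix x assume "x \<in> carrier (adjoin_one C f)"
    then show "k x \<in> carrier (presented_one X E)"
      using nf(1) by (auto simp: k_def presented_one_def quotient_def)
  next
    fix x y assume xy: "x \<in> carrier (adjoin_one C f)" "y \<in> carrier (adjoin_one C f)"
    have "?R `` {nf (f c d)} = pres_mult X E (?R `` {nf c}) (?R `` {nf d})" if "c \<in> C" "d \<in> C" for c d
    proof -
      have "(mult0 (nf c) (nf d), nf (f c d)) \<in> ?R"
        using nf_e[OF mult0_closed[OF nf(1)[OF that(1)] nf(1)[OF that(2)]]] that
        by (simp add: e_mult nf)
      then show ?thesis
        using that cls by (simp add: mult_cls nf(1))
    qed
    then show "k (x \<otimes>\<^bsub>adjoin_one C f\<^esub> y) = k x \<otimes>\<^bsub>presented_one X E\<^esub> k y"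
      using xy by (auto simp: k_def presented_one_def)
  qed
  moreover have "bij_betw k (carrier (adjoin_one C f)) (carrier (presented_one X E))"
  proof -
    have "c = d" if "c \<in> C" "d \<in> C" "?R `` {nf c} = ?R `` {nf d}" for c d
    proof -
      have "(nf c, nf d) \<in> ?R"
        using that(3) pres_cong.refl[OF nf(1)[OF that(2)], of E] by blast
      then show ?thesis
        using R[of "nf c" "nf d"] nf(2) that by simp
    qed
    then have "inj_on k (carrier (adjoin_one C f))"
      by (auto simp: inj_on_def k_def)
    moreover have "k ` carrier (adjoin_one C f) = carrier (presented_one X E)"
    proof -
      have "?R `` {u} \<in> (\<lambda>c. ?R `` {nf c}) ` C" if "u \<in> free_sg0 X" for u
        using cls[OF nf_e[OF that]] e_closed[OF that] by blast
      then have "free_sg0 X // ?R = (\<lambda>c. ?R `` {nf c}) ` C"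
        using nf(1) by (auto simp: quotient_def)
      then show ?thesis
        by (auto simp: k_def presented_one_def image_image)
    qed
    ultimately show ?thesis
      by (simp add: bij_betw_def)
  qed
  ultimately show ?thesis
    by (intro is_isoI[of k]) (simp add: iso_def)
qed

section \<open>Tables for the individual presentations\<close>

lemma mult_A_assoc: "mult_A (mult_A x y) z = mult_A x (mult_A y z)"
  by (cases x; cases y; cases z) simp_all

lemma mult_A_Z [simp]: "mult_A x Z = Z"
  by (cases x) simp_all

lemma pres_cong_left:
  "(Some u, v) \<in> pres_cong X E \<Longrightarrow> w \<noteq> [] \<Longrightarrow> set w \<subseteq> X \<Longrightarrow>
     (Some (u @ w), mult0 v (Some w)) \<in> pres_cong X E"
  using pres_cong.cong[of "Some u" v X E "Some w" "Some w"] pres_cong.refl[of "Some w" X E]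
  by simp

text \<open>The generators a and b become the idempotents e and d of A; their product ed = c is the
  remaining nonzero element.\<close>

lemma A0_1_iso: "adjoin_one {Z, Ec, Ed, Ee} mult_A \<cong> A0_1"
  unfolding A0_1_def
proof (rule presented_one_iso[where z = Z and g = "case_letter Ee Ed Z"
      and nf = "case_elt None None None (Some [La, Lb]) (Some [Lb]) (Some [La])"], goal_cases)
  case (12 x)
  then show ?case
    by (auto intro!: pres_cong.refl)
next
  case (13 x c)
  let ?E = "{(Some [La, La], Some [La]), (Some [Lb, Lb], Some [Lb]), (Some [Lb, La], None)}"
  \<comment> \<open>A generator times the normal form ab of length two is reduced by a relator
    multiplied by b.\<close>
  have "(Some [La, La, Lb], Some [La, Lb]) \<in> pres_cong {La, Lb} ?E"
    "(Some [Lb, La, Lb], None) \<in> pres_cong {La, Lb} ?E"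
    using pres_cong_left[of "[La, La]" "Some [La]" "{La, Lb}" ?E "[Lb]"]
      pres_cong_left[of "[Lb, La]" "None" "{La, Lb}" ?E "[Lb]"]
    by (auto intro: pres_cong.relator)
  with 13 show ?case
    by (auto intro!: pres_cong.refl intro: pres_cong.relator)
qed (auto simp: mult_A_assoc sg0_eval_def)

lemma L_1_iso: "adjoin_one {Z, Ec, Ed} mult_A \<cong> L_1"
  unfolding L_1_def
  by (rule presented_one_iso[where z = Z and g = "case_letter Ec Ed Z"
      and nf = "case_elt None None None (Some [La]) (Some [Lb]) None"])
    (auto simp: mult_A_assoc sg0_eval_def intro!: pres_cong.refl intro: pres_cong.relator)

lemma R_1_iso: "adjoin_one {Z, Ec, Ee} mult_A \<cong> R_1"
  unfolding R_1_def
  by (rule presented_one_iso[where z = Z and g = "case_letter Ec Ee Z"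
      and nf = "case_elt None None None (Some [La]) None (Some [Lb])"])
    (auto simp: mult_A_assoc sg0_eval_def intro!: pres_cong.refl intro: pres_cong.relator)

lemma N_1_iso: "adjoin_one {Z, Ec} mult_A \<cong> N_1"
  unfolding N_1_def
  by (rule presented_one_iso[where z = Z and g = "case_letter Ec Z Z"
      and nf = "case_elt None None None (Some [La]) None None"])
    (auto simp: mult_A_assoc sg0_eval_def intro!: pres_cong.refl intro: pres_cong.relator)

lemma M_1_iso: "adjoin_one {Z, Ea, Eb, Ec} mult_A \<cong> M_1"
  unfolding M_1_def
proof (rule presented_one_iso[where z = Z and g = "case_letter Ea Eb Ec"
      and nf = "case_elt None (Some [La]) (Some [Lb]) (Some [Lc]) None None"], goal_cases)
  case (8 u v)
  then show ?case
    by (auto simp: sg0_eval_def split: letter.splits)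
next
  case 7
  then show ?case
    by (auto) (metis letter.exhaust)+
qed (auto simp: mult_A_assoc sg0_eval_def intro!: pres_cong.refl intro: pres_cong.relator)

text \<open>\<open>elt\<close> is only a supply of names here: \<open>Ea\<close>, \<open>Eb\<close>
  and \<open>Ec\<close> are the generators of B_0, not the elements of A.\<close>

fun mult_B0 :: "elt \<Rightarrow> elt \<Rightarrow> elt" where
  "mult_B0 Ea Ea = Ea"
| "mult_B0 Eb Eb = Eb"
| "mult_B0 Ea Ec = Ec"
| "mult_B0 Ec Eb = Ec"
| "mult_B0 _ _ = Z"

lemma mult_B0_assoc: "mult_B0 (mult_B0 x y) z = mult_B0 x (mult_B0 y z)"
  by (cases x; cases y; cases z) simp_all

lemma B0_1_iso: "adjoin_one {Z, Ea, Eb, Ec} mult_B0 \<cong> B0_1"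
  unfolding B0_1_def
proof (rule presented_one_iso[where z = Z and g = "case_letter Ea Eb Ec"
      and nf = "case_elt None (Some [La]) (Some [Lb]) (Some [Lc]) None None"], goal_cases)
  case (13 x c)
  let ?R = "pres_cong {La, Lb, Lc} {(Some [La, La], Some [La]), (Some [Lb, Lb], Some [Lb]),
    (Some [La, Lb], None), (Some [Lb, La], None), (Some [La, Lc], Some [Lc]), (Some [Lc, Lb], Some [Lc])}"
  have ba: "(Some [Lb, La], None) \<in> ?R" and ac: "(Some [Lc], Some [La, Lc]) \<in> ?R"
    and cb: "(Some [Lc], Some [Lc, Lb]) \<in> ?R"
    by (simp_all add: pres_cong.relator pres_cong.sym[OF pres_cong.relator])
  have "UNIV = {La, Lb, Lc}"
    using letter.exhaust by auto
  then have refl: "(Some [x], Some [x]) \<in> ?R" for x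
    by (intro pres_cong.refl) auto
  \<comment> \<open>Three vanishing products have to be derived: bc = bac = 0, ca = cba = 0 and cc =
    cac = 0.\<close>
  have "(Some [Lb, Lc], Some [Lb, La, Lc]) \<in> ?R"
    using pres_cong.cong[OF refl[of Lb] ac] by simp
  moreover have "(Some [Lb, La, Lc], None) \<in> ?R"
    using pres_cong.cong[OF ba refl[of Lc]] by simp
  ultimately have bc: "(Some [Lb, Lc], None) \<in> ?R"
    by (rule pres_cong.trans)
  have "(Some [Lc, La], Some [Lc, Lb, La]) \<in> ?R"
    using pres_cong.cong[OF cb refl[of La]] by simp
  moreover have "(Some [Lc, Lb, La], None) \<in> ?R"
    using pres_cong.cong[OF refl[of Lc] ba] by simp
  ultimately have ca: "(Some [Lc, La], None) \<in> ?R"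
    by (rule pres_cong.trans)
  have "(Some [Lc, Lc], Some [Lc, La, Lc]) \<in> ?R"
    using pres_cong.cong[OF refl[of Lc] ac] by simp
  moreover have "(Some [Lc, La, Lc], None) \<in> ?R"
    using pres_cong.cong[OF ca refl[of Lc]] by simp
  ultimately have "(Some [Lc, Lc], None) \<in> ?R"
    by (rule pres_cong.trans)
  with bc ca 13 show ?case
    by (auto intro!: pres_cong.refl intro: pres_cong.relator)
qed (auto simp: mult_B0_assoc sg0_eval_def intro!: pres_cong.refl intro: pres_cong.relator)

section \<open>Evaluation in the multiplication tables\<close>

definition word_val :: "('a \<Rightarrow> 'a \<Rightarrow> 'a) \<Rightarrow> 'a option list \<Rightarrow> 'a option" where
  "word_val f w = foldr (mult_adjoin f) w None"

lemma word_val_simps [simp]: "word_val f [] = None" "word_val f (x # w) = mult_adjoin f x (word_val f w)"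
  by (simp_all add: word_val_def)

lemma weval_adjoin_one: "weval (adjoin_one X f) \<phi> u = word_val f (map \<phi> u)"
  by (induction u) simp_all

lemma Cons_elt_induct [case_names Nil None Z Ea Eb Ec Ed Ee]:
  assumes "P []" "\<And>w. P w \<Longrightarrow> P (None # w)" "\<And>w. P w \<Longrightarrow> P (Some Z # w)"
    "\<And>w. P w \<Longrightarrow> P (Some Ea # w)" "\<And>w. P w \<Longrightarrow> P (Some Eb # w)" "\<And>w. P w \<Longrightarrow> P (Some Ec # w)"
    "\<And>w. P w \<Longrightarrow> P (Some Ed # w)" "\<And>w. P w \<Longrightarrow> P (Some Ee # w)"
  shows "P w"
proof (induction w)
  case (Cons x w)
  show ?case
  proof (cases x)
    case (Some r)
    then show ?thesis
      using assms Cons by (cases r) simp_all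
  qed (use assms Cons in simp)
qed (fact assms)

section \<open>Words with a given nonzero value in A^1\<close>

lemma mult_A_eq_iff:
  "mult_A x y = Ee \<longleftrightarrow> x = Ee \<and> y = Ee"
  "mult_A x y = Ed \<longleftrightarrow> x = Ed \<and> y = Ed"
  "mult_A x y = Ec \<longleftrightarrow> x = Ec \<and> y = Ed \<or> x = Ee \<and> y = Ec \<or> x = Ee \<and> y = Ed"
  "mult_A x y = Eb \<longleftrightarrow> x = Eb \<and> y = Ee \<or> x = Ed \<and> y = Eb"
  "mult_A x y = Ea \<longleftrightarrow> x = Ea \<and> y = Ee \<or> x = Ec \<and> y = Eb \<or> x = Ee \<and> y = Ea \<or> x = Ee \<and> y = Eb"
  by (cases x; cases y; simp)+

lemma mult_adjoin_A_eq_iff: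
  "mult_adjoin f x y = None \<longleftrightarrow> x = None \<and> y = None"
  "mult_adjoin mult_A x y = Some Ee \<longleftrightarrow> x = None \<and> y = Some Ee \<or> x = Some Ee \<and> (y = None \<or> y = Some Ee)"
  "mult_adjoin mult_A x y = Some Ed \<longleftrightarrow> x = None \<and> y = Some Ed \<or> x = Some Ed \<and> (y = None \<or> y = Some Ed)"
  "mult_adjoin mult_A x y = Some Ec \<longleftrightarrow> x = None \<and> y = Some Ec \<or> x = Some Ec \<and> (y = None \<or> y = Some Ed)
    \<or> x = Some Ee \<and> (y = Some Ec \<or> y = Some Ed)"
  "mult_adjoin mult_A x y = Some Eb \<longleftrightarrow> x = None \<and> y = Some Eb \<or> x = Some Eb \<and> (y = None \<or> y = Some Ee)
    \<or> x = Some Ed \<and> y = Some Eb"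
  "mult_adjoin mult_A x y = Some Ea \<longleftrightarrow> x = None \<and> y = Some Ea \<or> x = Some Ea \<and> (y = None \<or> y = Some Ee)
    \<or> x = Some Ec \<and> y = Some Eb \<or> x = Some Ee \<and> (y = Some Ea \<or> y = Some Eb)"
  by (cases x; cases y; auto simp: mult_A_eq_iff)+

lemma word_val_None: "word_val f w = None \<longleftrightarrow> Some Z \<notin> set w \<and> Some Ea \<notin> set w \<and> Some Eb \<notin> set w
    \<and> Some Ec \<notin> set w \<and> Some Ed \<notin> set w \<and> Some Ee \<notin> set w"
  by (induction w rule: Cons_elt_induct) (simp_all add: mult_adjoin_A_eq_iff)

lemma word_val_A_Ee: "word_val mult_A w = Some Ee \<longleftrightarrow> Some Z \<notin> set w \<and> Some Ea \<notin> set w \<and> Some Eb \<notin> set w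
    \<and> Some Ec \<notin> set w \<and> Some Ed \<notin> set w \<and> Some Ee \<in> set w"
  by (induction w rule: Cons_elt_induct) (auto simp: mult_adjoin_A_eq_iff word_val_None)

lemma word_val_A_Ed: "word_val mult_A w = Some Ed \<longleftrightarrow> Some Z \<notin> set w \<and> Some Ea \<notin> set w \<and> Some Eb \<notin> set w
    \<and> Some Ec \<notin> set w \<and> Some Ed \<in> set w \<and> Some Ee \<notin> set w"
  by (induction w rule: Cons_elt_induct) (auto simp: mult_adjoin_A_eq_iff word_val_None)

text \<open>Up to factors \<open>None\<close>, these are the words e^i c d^j, and e^i d^j with
  positive i and j.\<close>

lemma word_val_A_Ec: "word_val mult_A w = Some Ec \<longleftrightarrow> Some Z \<notin> set w \<and> Some Ea \<notin> set w \<and> Some Eb \<notin> set w \<and>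
    (Some Ec \<in> set w \<or> Some Ed \<in> set w \<and> Some Ee \<in> set w) \<and>
    \<not> prec (Some Ec) (Some Ec) w \<and> \<not> prec (Some Ed) (Some Ec) w \<and>
    \<not> prec (Some Ed) (Some Ee) w \<and> \<not> prec (Some Ec) (Some Ee) w"
proof (induction w rule: Cons_elt_induct)
  case (Ec w)
  show ?case
    using prec_in_set[of "Some Ec" "Some Ec" w] prec_in_set[of "Some Ed" "Some Ec" w]
      prec_in_set[of "Some Ed" "Some Ee" w] prec_in_set[of "Some Ec" "Some Ee" w]
    by (simp add: mult_adjoin_A_eq_iff word_val_A_Ed word_val_None; blast)
next
  case (Ed w)
  show ?case
    by (simp add: mult_adjoin_A_eq_iff; blast)
next
  case (Ee w)
  show ?case
    using Ee prec_in_set[of "Some Ec" "Some Ec" w] prec_in_set[of "Some Ed" "Some Ec" w]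
      prec_in_set[of "Some Ed" "Some Ee" w] prec_in_set[of "Some Ec" "Some Ee" w]
    by (simp add: mult_adjoin_A_eq_iff word_val_A_Ed; blast)
qed (simp_all add: mult_adjoin_A_eq_iff)

text \<open>Up to factors \<open>None\<close>, these are the words d^i b e^j.\<close>

lemma word_val_A_Eb: "word_val mult_A w = Some Eb \<longleftrightarrow> Some Z \<notin> set w \<and> Some Ea \<notin> set w \<and> Some Ec \<notin> set w \<and>
    Some Eb \<in> set w \<and>
    \<not> prec (Some Eb) (Some Eb) w \<and> \<not> prec (Some Eb) (Some Ed) w \<and> \<not> prec (Some Ee) (Some Eb) w"
proof (induction w rule: Cons_elt_induct)
  case (Eb w)
  show ?case
    using prec_in_set[of "Some Eb" "Some Eb" w] prec_in_set[of "Some Eb" "Some Ed" w]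
      prec_in_set[of "Some Ee" "Some Eb" w]
    by (simp add: mult_adjoin_A_eq_iff word_val_A_Ee word_val_None; blast)
next
  case (Ee w)
  show ?case
    by (simp add: mult_adjoin_A_eq_iff; blast)
qed (simp_all add: mult_adjoin_A_eq_iff)

text \<open>Up to factors \<open>None\<close>, these are the words e^i a e^j, e^i c d^j b e^k, and
  e^i d^j b e^k with positive i.\<close>

lemma word_val_A_Ea: "word_val mult_A w = Some Ea \<longleftrightarrow> Some Z \<notin> set w \<and>
    (Some Ea \<in> set w \<and> Some Eb \<notin> set w \<and> Some Ec \<notin> set w \<and> Some Ed \<notin> set w \<and> \<not> prec (Some Ea) (Some Ea) w \<or>
     Some Eb \<in> set w \<and> Some Ea \<notin> set w \<and>
     \<not> prec (Some Eb) (Some Eb) w \<and> \<not> prec (Some Eb) (Some Ec) w \<and> \<not> prec (Some Eb) (Some Ed) w \<and>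
     \<not> prec (Some Ec) (Some Ec) w \<and> \<not> prec (Some Ed) (Some Ec) w \<and>
     \<not> prec3 (Some Ed) (Some Ee) (Some Eb) w \<and> \<not> prec3 (Some Ec) (Some Ee) (Some Eb) w \<and>
     (prec (Some Ee) (Some Eb) w \<or> prec (Some Ec) (Some Eb) w))"
proof (induction w rule: Cons_elt_induct)
  case (Ea w)
  show ?case
    using prec_in_set[of "Some Ea" "Some Ea" w]
    by (simp add: mult_adjoin_A_eq_iff word_val_A_Ee word_val_None; blast)
next
  case (Eb w)
  show ?case
    using prec_in_set[of "Some Ee" "Some Eb" w] prec_in_set[of "Some Ec" "Some Eb" w]
    by (simp add: mult_adjoin_A_eq_iff; blast)
next
  case (Ec w)
  show ?case
    using prec_in_set[of "Some Ec" "Some Ec" w] prec_in_set[of "Some Ed" "Some Ec" w]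
      prec_in_set[of "Some Eb" "Some Ec" w] prec3_imp_prec[of "Some Ed" "Some Ee" "Some Eb" w]
      prec3_imp_prec[of "Some Ec" "Some Ee" "Some Eb" w]
    by (simp add: mult_adjoin_A_eq_iff word_val_A_Eb; blast)
next
  case (Ed w)
  show ?case
    using prec_in_set[of "Some Ec" "Some Eb" w]
    by (simp add: mult_adjoin_A_eq_iff; blast)
next
  case (Ee w)
  show ?case
    using Ee prec_total[of "Some Eb" w "Some Ec"] prec_in_set[of "Some Ec" "Some Ec" w]
      prec_in_set[of "Some Ed" "Some Ec" w] prec_in_set[of "Some Eb" "Some Ec" w]
      prec_in_set[of "Some Ec" "Some Eb" w] prec_in_set[of "Some Ee" "Some Eb" w]
      prec3_imp_prec[of "Some Ed" "Some Ee" "Some Eb" w] prec3_imp_prec[of "Some Ec" "Some Ee" "Some Eb" w]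
    by (simp add: mult_adjoin_A_eq_iff word_val_A_Eb; blast)
qed (simp_all add: mult_adjoin_A_eq_iff)

text \<open>Two different letters with value \<open>r\<close> yield the pair \<open>r r\<close> in
  whichever order they occur, so only content and repeated letters matter.\<close>

lemma prec_map_self:
  "prec r r (map \<phi> u) \<longleftrightarrow>
     (\<exists>x. \<phi> x = r \<and> prec x x u) \<or> (\<exists>x y. x \<noteq> y \<and> \<phi> x = r \<and> \<phi> y = r \<and> x \<in> set u \<and> y \<in> set u)"
proof -
  have "prec r r (map \<phi> u)" if "x \<noteq> y" "\<phi> x = r" "\<phi> y = r" "x \<in> set u" "y \<in> set u" for x y
    using that prec_total[of x u y] unfolding prec_map by metis
  then show ?thesis
    unfolding prec_map using prec_in_set by metis
qed

text \<open>These are the nonzero elements of A with square zero; a letter that takes such a value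
  must be linear for the product to be nonzero.\<close>

abbreviation once :: "elt set" where
  "once \<equiv> {Ea, Eb, Ec}"

text \<open>The pairs in \<open>P\<close> and the triples in \<open>T\<close> are those that occur
  in the descriptions of the nonzero values. Since the value of \<open>u\<close> is nonzero, letters
  with values in \<open>once\<close> are linear there, so agreement is demanded only for linear
  letters.\<close>

lemma word_val_A_transfer:
  assumes S: "set u = set v" and N: "\<And>x. prec x x u = prec x x v"
    and P: "\<And>x y r s. \<phi> x = Some r \<Longrightarrow> \<phi> y = Some s \<Longrightarrow>
      (r, s) \<in> {(Eb, Ed), (Ee, Eb), (Ed, Ec), (Ed, Ee), (Ec, Ee), (Eb, Ec), (Ec, Eb)} \<Longrightarrow>
      (r \<in> once \<Longrightarrow> lin x u) \<Longrightarrow> (s \<in> once \<Longrightarrow> lin y u) \<Longrightarrow> prec x y u = prec x y v"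
    and T: "\<And>d e t r. \<phi> d = Some r \<Longrightarrow> r \<in> {Ec, Ed} \<Longrightarrow> \<phi> e = Some Ee \<Longrightarrow> \<phi> t = Some Eb \<Longrightarrow>
      (r = Ec \<Longrightarrow> lin d u) \<Longrightarrow> lin t u \<Longrightarrow> \<not> prec t d u \<Longrightarrow> prec3 d e t u = prec3 d e t v"
    and r: "word_val mult_A (map \<phi> u) \<noteq> Some Z"
  shows "word_val mult_A (map \<phi> v) = word_val mult_A (map \<phi> u)"
proof -
  let ?u = "map \<phi> u" and ?v = "map \<phi> v"
  have S': "set ?u = set ?v"
    using S by simp
  have N': "prec q q ?u = prec q q ?v" for q
    unfolding prec_map_self using S N by simp
  have linI: "lin x u" if "\<phi> x = Some q" "x \<in> set u" "\<not> prec (Some q) (Some q) ?u" for x q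
    using that unfolding lin_def prec_map by blast
  have P': "prec (Some q) (Some s) ?u = prec (Some q) (Some s) ?v"
    if qs: "(q, s) \<in> {(Eb, Ed), (Ee, Eb), (Ed, Ec), (Ed, Ee), (Ec, Ee), (Eb, Ec), (Ec, Eb)}"
      "q \<in> once \<Longrightarrow> \<not> prec (Some q) (Some q) ?u" "s \<in> once \<Longrightarrow> \<not> prec (Some s) (Some s) ?u" for q s
  proof -
    have "prec x y u = prec x y v" if xy: "\<phi> x = Some q" "\<phi> y = Some s" for x y
    proof (cases "x \<in> set u \<and> y \<in> set u")
      case True
      then show ?thesis
        using xy qs by (intro P[of x q y s] linI) auto
    next
      case False
      then show ?thesis
        using S prec_in_set[of x y u] prec_in_set[of x y v] by blast
    qed
    then show ?thesis
      unfolding prec_map by metis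
  qed
  have T': "prec3 (Some q) (Some Ee) (Some Eb) ?u = prec3 (Some q) (Some Ee) (Some Eb) ?v"
    if q: "q \<in> {Ec, Ed}" "\<not> prec (Some Eb) (Some Eb) ?u" "\<not> prec (Some Eb) (Some q) ?u"
      "q = Ec \<Longrightarrow> \<not> prec (Some Ec) (Some Ec) ?u" for q
  proof -
    have "prec3 d e t u = prec3 d e t v" if dt: "\<phi> d = Some q" "\<phi> e = Some Ee" "\<phi> t = Some Eb" for d e t
    proof (cases "d \<in> set u \<and> t \<in> set u")
      case True
      have "\<not> prec t d u"
        using dt q(3) unfolding prec_map by blast
      then show ?thesis
        using dt q True linI[of d q] linI[of t Eb] by (intro T[of d q e t]) auto
    next
      case False
      then show ?thesis
        using S prec3_imp_prec[of d e t] prec_in_set[of d t] by blast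
    qed
    then show ?thesis
      unfolding prec3_map by metis
  qed
  show ?thesis
  proof (cases "word_val mult_A ?u")
    case None
    then have "word_val mult_A ?v = None"
      unfolding word_val_None S' .
    then show ?thesis
      using None by simp
  next
    case (Some q)
    then have "word_val mult_A ?u = Some Ea \<or> word_val mult_A ?u = Some Eb \<or> word_val mult_A ?u = Some Ec
        \<or> word_val mult_A ?u = Some Ed \<or> word_val mult_A ?u = Some Ee"
      using r by (cases q) auto
    moreover have "word_val mult_A ?v = Some Ea" if "word_val mult_A ?u = Some Ea"
      using that P'[of Eb Ec] P'[of Eb Ed] P'[of Ed Ec] P'[of Ee Eb] P'[of Ec Eb] T'[of Ed] T'[of Ec]
      unfolding word_val_A_Ea S' N' by auto
    moreover have "word_val mult_A ?v = Some Eb" if "word_val mult_A ?u = Some Eb"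
      using that P'[of Eb Ed] P'[of Ee Eb] unfolding word_val_A_Eb S' N' by auto
    moreover have "word_val mult_A ?v = Some Ec" if "word_val mult_A ?u = Some Ec"
      using that P'[of Ed Ec] P'[of Ed Ee] P'[of Ec Ee] unfolding word_val_A_Ec S' N' by auto
    moreover have "word_val mult_A ?v = Some Ed" if "word_val mult_A ?u = Some Ed"
      using that unfolding word_val_A_Ed S' .
    moreover have "word_val mult_A ?v = Some Ee" if "word_val mult_A ?u = Some Ee"
      using that unfolding word_val_A_Ee S' .
    ultimately show ?thesis
      by metis
  qed
qed

text \<open>Transfer in both directions leaves only the case in which both values are zero.\<close>

lemma word_val_A_eqI:
  assumes S: "set u = set v" and N: "\<And>x. prec x x u = prec x x v"
    and P: "\<And>x y r s. \<phi> x = Some r \<Longrightarrow> \<phi> y = Some s \<Longrightarrow>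
      (r, s) \<in> {(Eb, Ed), (Ee, Eb), (Ed, Ec), (Ed, Ee), (Ec, Ee), (Eb, Ec), (Ec, Eb)} \<Longrightarrow>
      (r \<in> once \<Longrightarrow> lin x u) \<Longrightarrow> (s \<in> once \<Longrightarrow> lin y u) \<Longrightarrow> prec x y u = prec x y v"
    and T: "\<And>d e t r. \<phi> d = Some r \<Longrightarrow> r \<in> {Ec, Ed} \<Longrightarrow> \<phi> e = Some Ee \<Longrightarrow> \<phi> t = Some Eb \<Longrightarrow>
      (r = Ec \<Longrightarrow> lin d u) \<Longrightarrow> lin t u \<Longrightarrow> \<not> prec t d u \<Longrightarrow> prec3 d e t u = prec3 d e t v"
  shows "word_val mult_A (map \<phi> u) = word_val mult_A (map \<phi> v)"
proof -
  have l: "lin x u = lin x v" for x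
    using S N by (simp add: lin_def)
  have "word_val mult_A (map \<phi> v) = word_val mult_A (map \<phi> u)" if "word_val mult_A (map \<phi> u) \<noteq> Some Z"
    using S N P T that by (rule word_val_A_transfer)
  moreover have "word_val mult_A (map \<phi> u) = word_val mult_A (map \<phi> v)" if "word_val mult_A (map \<phi> v) \<noteq> Some Z"
  proof (rule word_val_A_transfer[OF S[symmetric] N[symmetric] _ _ that])
    fix d e t r
    assume *: "\<phi> d = Some r" "r \<in> {Ec, Ed}" "\<phi> e = Some Ee" "\<phi> t = Some Eb"
      "r = Ec \<Longrightarrow> lin d v" "lin t v" "\<not> prec t d v"
    then have "\<not> prec t d u"
      using P[of t Eb d r] l by auto
    then show "prec3 d e t v = prec3 d e t u"
      using T[of d r e t] * l by auto
  qed (use P l in auto)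
  ultimately show ?thesis
    by metis
qed

lemma satI:
  assumes "\<And>\<phi>. (\<And>x r. \<phi> x = Some r \<Longrightarrow> r \<in> X) \<Longrightarrow> word_val f (map \<phi> u) = word_val f (map \<phi> v)"
  shows "sat (adjoin_one X f) u v"
  unfolding sat_def weval_adjoin_one
proof (intro allI impI assms)
  fix \<phi> :: "'a \<Rightarrow> 'b option" and x r
  assume "range \<phi> \<subseteq> carrier (adjoin_one X f)" "\<phi> x = Some r"
  then show "r \<in> X"
    using range_subsetD[of \<phi> _ x] by auto
qed

lemma satD:
  assumes "sat (adjoin_one X f) u v" and "\<And>x r. \<phi> x = Some r \<Longrightarrow> r \<in> X"
  shows "word_val f (map \<phi> u) = word_val f (map \<phi> v)"
proof -
  have "\<phi> x \<in> insert None (Some ` X)" for x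
    using assms(2)[of x] by (cases "\<phi> x") auto
  then have "range \<phi> \<subseteq> carrier (adjoin_one X f)"
    by auto
  then show ?thesis
    using assms(1) unfolding sat_def weval_adjoin_one by blast
qed

lemma content_if_sat:
  assumes "sat (adjoin_one X f) u v" "Z \<in> X"
  shows "set u = set v"
proof -
  have "x \<in> set u \<longleftrightarrow> x \<in> set v" for x
  proof -
    define \<phi> where "\<phi> z = (if z = x then Some Z else None)" for z
    have "word_val f (map \<phi> w) \<noteq> None \<longleftrightarrow> x \<in> set w" for w
      by (auto simp: word_val_None \<phi>_def split: if_splits)
    moreover have "word_val f (map \<phi> u) = word_val f (map \<phi> v)"
      by (rule satD[OF assms(1)]) (use assms(2) in \<open>auto simp: \<phi>_def split: if_splits\<close>)
    ultimately show ?thesis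
      by metis
  qed
  then show ?thesis by blast
qed

section \<open>Assignments in A^1 that detect the features\<close>

context
  fixes X u v
  assumes sat: "sat (adjoin_one X mult_A) u v"
begin

lemma nonlin_if_sat_A:
  assumes "{Z, Ec} \<subseteq> X"
  shows "prec x x u = prec x x v"
proof -
  define \<phi> where "\<phi> z = (if z = x then Some Ec else None)" for z
  have "word_val mult_A (map \<phi> w) = Some Ec \<longleftrightarrow> x \<in> set w \<and> \<not> prec x x w" for w
    by (auto simp: word_val_A_Ec prec_map \<phi>_def split: if_splits)
  moreover have "word_val mult_A (map \<phi> u) = word_val mult_A (map \<phi> v)"
    by (rule satD[OF sat]) (use assms in \<open>auto simp: \<phi>_def split: if_splits\<close>)
  moreover have "set u = set v"
    using content_if_sat[OF sat] assms by simp
  ultimately show ?thesis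
    using prec_in_set[of x x u] prec_in_set[of x x v] by metis
qed

lemma lin_if_sat_A: "{Z, Ec} \<subseteq> X \<Longrightarrow> lin x u = lin x v"
  using nonlin_if_sat_A content_if_sat[OF sat] by (simp add: lin_def)

lemma linear_order_if_sat_A:
  assumes X: "{Z, Ea, Eb, Ec} \<subseteq> X" and l: "lin x u" "lin y u"
  shows "prec x y u = prec x y v"
proof (cases "x = y")
  case False
  \<comment> \<open>cb = a, whereas bc = 0.\<close>
  define \<phi> where "\<phi> z = (if z = x then Some Ec else if z = y then Some Eb else None)" for z
  have "word_val mult_A (map \<phi> w) = Some Ea \<longleftrightarrow> prec x y w" if "lin x w" "lin y w" for w
    using False that lin_antisym[of x w y] prec_total[of x w y]
    by (auto simp: word_val_A_Ea prec_map prec3_map \<phi>_def lin_def split: if_splits)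
  moreover have "word_val mult_A (map \<phi> u) = word_val mult_A (map \<phi> v)"
    by (rule satD[OF sat]) (use X in \<open>auto simp: \<phi>_def split: if_splits\<close>)
  moreover have "lin x v" "lin y v"
    using l lin_if_sat_A X by auto
  ultimately show ?thesis
    using l by metis
qed (use nonlin_if_sat_A X in auto)

lemma before_linear_if_sat_A_cd:
  assumes X: "{Z, Ec, Ed} \<subseteq> X" and l: "lin x u"
  shows "prec y x u = prec y x v"
proof (cases "x = y")
  case False
  \<comment> \<open>cd = c, whereas dc = 0.\<close>
  define \<phi> where "\<phi> z = (if z = x then Some Ec else if z = y then Some Ed else None)" for z
  have "word_val mult_A (map \<phi> w) = Some Ec \<longleftrightarrow> \<not> prec y x w" if "lin x w" for w
    using False that
    by (auto simp: word_val_A_Ec prec_map \<phi>_def lin_def split: if_splits)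
  moreover have "word_val mult_A (map \<phi> u) = word_val mult_A (map \<phi> v)"
    by (rule satD[OF sat]) (use X in \<open>auto simp: \<phi>_def split: if_splits\<close>)
  moreover have "lin x v"
    using l lin_if_sat_A X by auto
  ultimately show ?thesis
    using l by metis
qed (use nonlin_if_sat_A X in auto)

text \<open>The table for \<open>var_Q\<close> does not contain d, so b and e take over from c and
  d: be = b, whereas eb = a.\<close>

lemma before_linear_if_sat_A_be:
  assumes X: "{Z, Ea, Eb, Ec, Ee} \<subseteq> X" and l: "lin x u"
  shows "prec y x u = prec y x v"
proof (cases "x = y")
  case False
  define \<phi> where "\<phi> z = (if z = x then Some Eb else if z = y then Some Ee else None)" for z
  have "word_val mult_A (map \<phi> w) = Some Eb \<longleftrightarrow> \<not> prec y x w" if "lin x w" for w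
    using False that
    by (auto simp: word_val_A_Eb prec_map \<phi>_def lin_def split: if_splits)
  moreover have "word_val mult_A (map \<phi> u) = word_val mult_A (map \<phi> v)"
    by (rule satD[OF sat]) (use X in \<open>auto simp: \<phi>_def split: if_splits\<close>)
  moreover have "lin x v"
    using l lin_if_sat_A X by auto
  ultimately show ?thesis
    using l by metis
qed (use nonlin_if_sat_A X in auto)

lemma after_linear_if_sat_A:
  assumes X: "{Z, Ec, Ee} \<subseteq> X" and l: "lin x u"
  shows "prec x y u = prec x y v"
proof (cases "x = y")
  case False
  \<comment> \<open>ec = c, whereas ce = 0.\<close>
  define \<phi> where "\<phi> z = (if z = x then Some Ec else if z = y then Some Ee else None)" for z
  have "word_val mult_A (map \<phi> w) = Some Ec \<longleftrightarrow> \<not> prec x y w" if "lin x w" for w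
    using False that
    by (auto simp: word_val_A_Ec prec_map \<phi>_def lin_def split: if_splits)
  moreover have "word_val mult_A (map \<phi> u) = word_val mult_A (map \<phi> v)"
    by (rule satD[OF sat]) (use X in \<open>auto simp: \<phi>_def split: if_splits\<close>)
  moreover have "lin x v"
    using l lin_if_sat_A X by auto
  ultimately show ?thesis
    using l by metis
qed (use nonlin_if_sat_A X in auto)

lemma prec_if_sat_A:
  assumes X: "{Z, Ec, Ed, Ee} \<subseteq> X"
  shows "prec x y u = prec x y v"
proof (cases "x = y")
  case False
  \<comment> \<open>ed = c, whereas de = 0.\<close>
  define \<phi> where "\<phi> z = (if z = x then Some Ed else if z = y then Some Ee else None)" for z
  have "word_val mult_A (map \<phi> w) = Some Ec \<longleftrightarrow> \<not> prec x y w \<and> x \<in> set w \<and> y \<in> set w" for w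
    using False
    by (auto simp: word_val_A_Ec prec_map \<phi>_def split: if_splits)
  moreover have "word_val mult_A (map \<phi> u) = word_val mult_A (map \<phi> v)"
    by (rule satD[OF sat]) (use X in \<open>auto simp: \<phi>_def split: if_splits\<close>)
  moreover have "set u = set v"
    using content_if_sat[OF sat] X by simp
  ultimately show ?thesis
    using prec_in_set[of x y u] prec_in_set[of x y v] by metis
qed (use nonlin_if_sat_A X in auto)

lemma between_linear_if_sat_A:
  assumes X: "{Z, Ea, Eb, Ec, Ee} \<subseteq> X" and l: "lin s u" "lin t u"
  shows "prec3 s x t u = prec3 s x t v"
proof (cases "prec s t u \<and> x \<noteq> s \<and> x \<noteq> t")
  case True
  then have st: "s \<noteq> t"
    using l by (auto simp: lin_def)
  have lv: "lin s v" "lin t v" "prec s t v"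
    using True l lin_if_sat_A linear_order_if_sat_A X by auto
  \<comment> \<open>An e before c or behind b is absorbed, whereas ceb = 0.\<close>
  define \<phi> where "\<phi> z = (if z = s then Some Ec else if z = t then Some Eb else if z = x then Some Ee else None)" for z
  have "word_val mult_A (map \<phi> w) = Some Ea \<longleftrightarrow> \<not> prec3 s x t w" if "lin s w" "lin t w" "prec s t w" for w
    using True st that lin_antisym[of s w t]
    by (auto simp: word_val_A_Ea prec_map prec3_map \<phi>_def lin_def split: if_splits)
  moreover have "word_val mult_A (map \<phi> u) = word_val mult_A (map \<phi> v)"
    by (rule satD[OF sat]) (use X in \<open>auto simp: \<phi>_def split: if_splits\<close>)
  ultimately show ?thesis
    using l lv True by metis
next
  case False
  moreover have "lin s v" "lin t v" "prec s t u = prec s t v"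
    using l lin_if_sat_A linear_order_if_sat_A X by auto
  ultimately show ?thesis
    using l prec3_imp_prec[of s x t u] prec3_imp_prec[of s x t v] unfolding lin_def by auto
qed

lemma prec3_left_if_sat_A:
  assumes X: "X = UNIV" and l: "lin t u" "\<not> prec t d u"
  shows "prec3 d e t u = prec3 d e t v"
proof -
  have P: "prec y z u = prec y z v" for y z
    using prec_if_sat_A X by auto
  have lv: "lin t v" "\<not> prec t d v"
    using l lin_if_sat_A X P by auto
  show ?thesis
  proof (cases "d \<noteq> e \<and> d \<noteq> t \<and> e \<noteq> t \<and> d \<in> set u")
    case True
    \<comment> \<open>An e between d and b gives 0 because de = 0. Otherwise the value is b, or a if
      some e precedes b.\<close>
    define \<phi> where "\<phi> z = (if z = t then Some Eb else if z = d then Some Ed else if z = e then Some Ee else None)" for z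
    have "word_val mult_A (map \<phi> w) = Some Ea \<or> word_val mult_A (map \<phi> w) = Some Eb \<longleftrightarrow> \<not> prec3 d e t w"
      if "lin t w" "\<not> prec t d w" for w
      using True that prec3_imp_prec[of d e t w]
      by (auto simp: word_val_A_Ea word_val_A_Eb prec_map prec3_map \<phi>_def lin_def split: if_splits)
    moreover have "word_val mult_A (map \<phi> u) = word_val mult_A (map \<phi> v)"
      by (rule satD[OF sat]) (use X in \<open>auto simp: \<phi>_def split: if_splits\<close>)
    ultimately show ?thesis
      using l lv by metis
  next
    case False
    have "prec3 d d t w \<longleftrightarrow> prec d d w \<and> d \<noteq> t" if "lin t w" "\<not> prec t d w" for w
      using that prec3_if_prec_left[of d d w t] prec3_imp_prec[of d d t w] unfolding lin_def by auto
    with False show ?thesis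
      using P l lv prec3_imp_prec[of d e t u] prec3_imp_prec[of d e t v] prec_in_set[of d e u]
      unfolding lin_def by metis
  qed
qed

end

section \<open>Identities of the generators\<close>

lemma agreeD:
  assumes uv: "(u, v) \<in> agree D" and D: "vS \<in> D" "vN \<in> D"
  shows "set u = set v" "prec x x u = prec x x v" "lin x u = lin x v"
    "vM \<in> D \<Longrightarrow> lin x u \<Longrightarrow> lin y u \<Longrightarrow> prec x y u = prec x y v"
    "vL \<in> D \<Longrightarrow> lin x u \<Longrightarrow> prec y x u = prec y x v"
    "vR \<in> D \<Longrightarrow> lin x u \<Longrightarrow> prec x y u = prec x y v"
    "vA0 \<in> D \<Longrightarrow> prec x y u = prec x y v"
    "vQ \<in> D \<Longrightarrow> lin s u \<Longrightarrow> lin t u \<Longrightarrow> prec3 s x t u = prec3 s x t v"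
    "vA0 \<in> D \<Longrightarrow> vA \<in> D \<Longrightarrow> lin t u \<Longrightarrow> \<not> prec t d u \<Longrightarrow> prec3 d e t u = prec3 d e t v"
proof -
  have f: "feat j u = feat j v" if "j \<in> D" for j
    using uv that by (simp add: agree_def)
  show S: "set u = set v" and N: "prec x x u = prec x x v" for x
    using f[OF D(1)] f[OF D(2)] unfolding feat_S feat_N by blast+
  then show l: "lin x u = lin x v" for x
    by (simp add: lin_def)
  show "vM \<in> D \<Longrightarrow> lin x u \<Longrightarrow> lin y u \<Longrightarrow> prec x y u = prec x y v"
    using f[of vM] unfolding feat_M l by blast
  show "vL \<in> D \<Longrightarrow> lin x u \<Longrightarrow> prec y x u = prec y x v"
    using f[of vL] unfolding feat_L l by blast
  show "vR \<in> D \<Longrightarrow> lin x u \<Longrightarrow> prec x y u = prec x y v"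
    using f[of vR] unfolding feat_R l by blast
  show P: "vA0 \<in> D \<Longrightarrow> prec x y u = prec x y v" for x y
    using f[of vA0] unfolding feat_A0 by blast
  show "vQ \<in> D \<Longrightarrow> lin s u \<Longrightarrow> lin t u \<Longrightarrow> prec3 s x t u = prec3 s x t v"
    using f[of vQ] unfolding feat_Q l by blast
  show "vA0 \<in> D \<Longrightarrow> vA \<in> D \<Longrightarrow> lin t u \<Longrightarrow> \<not> prec t d u \<Longrightarrow> prec3 d e t u = prec3 d e t v"
    using f[of vA] P unfolding feat_A l by blast
qed

text \<open>
  Except for \<open>B0_1\<close>, the presented monoids are submonoids of \<open>A_1\<close> up to isomorphism, and the
  submonoid of \<open>A_1\<close> without \<open>Ed\<close> generates the variety \<open>var_Q\<close>.
\<close>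

abbreviation table :: "elt set \<Rightarrow> elt option monoid" where
  "table X \<equiv> adjoin_one X mult_A"

text \<open>Each condition on \<open>X\<close> names elements whose relative order affects a value,
  together with the label whose feature controls that order.\<close>

lemma sat_table_if_agree:
  fixes u v :: "'x list"
  assumes uv: "(u, v) \<in> agree D" and D: "vS \<in> D" "vN \<in> D"
    and bc: "Eb \<in> X \<Longrightarrow> Ec \<in> X \<Longrightarrow> vM \<in> D"
    and be: "Eb \<in> X \<Longrightarrow> Ee \<in> X \<Longrightarrow> vL \<in> D" and bd: "Eb \<in> X \<Longrightarrow> Ed \<in> X \<Longrightarrow> vR \<in> D"
    and cd: "Ec \<in> X \<Longrightarrow> Ed \<in> X \<Longrightarrow> vL \<in> D" and ce: "Ec \<in> X \<Longrightarrow> Ee \<in> X \<Longrightarrow> vR \<in> D"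
    and de: "Ed \<in> X \<Longrightarrow> Ee \<in> X \<Longrightarrow> vA0 \<in> D"
    and bce: "Eb \<in> X \<Longrightarrow> Ec \<in> X \<Longrightarrow> Ee \<in> X \<Longrightarrow> vQ \<in> D"
    and bde: "Eb \<in> X \<Longrightarrow> Ed \<in> X \<Longrightarrow> Ee \<in> X \<Longrightarrow> vA \<in> D"
  shows "sat (table X) u v"
proof (rule satI)
  note uv = agreeD[OF uv D]
  fix \<phi> :: "'x \<Rightarrow> elt option" assume X: "\<And>x r. \<phi> x = Some r \<Longrightarrow> r \<in> X"
  show "word_val mult_A (map \<phi> u) = word_val mult_A (map \<phi> v)"
  proof (rule word_val_A_eqI)
    fix x y r s
    assume *: "\<phi> x = Some r" "\<phi> y = Some s" and l: "r \<in> once \<Longrightarrow> lin x u" "s \<in> once \<Longrightarrow> lin y u"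
      and "(r, s) \<in> {(Eb, Ed), (Ee, Eb), (Ed, Ec), (Ed, Ee), (Ec, Ee), (Eb, Ec), (Ec, Eb)}"
    then consider "r = Eb \<and> s = Ed" | "r = Ee \<and> s = Eb" | "r = Ed \<and> s = Ec" | "r = Ed \<and> s = Ee"
      | "r = Ec \<and> s = Ee" | "r = Eb \<and> s = Ec" | "r = Ec \<and> s = Eb"
      by blast
    moreover have "r \<in> X" "s \<in> X"
      using * X by auto
    ultimately show "prec x y u = prec x y v"
      using l bc be bd cd ce de uv(4)[of x y] uv(5)[of y x] uv(6)[of x y] uv(7)[of x y]
      by cases auto
  next
    fix d e t r
    assume *: "\<phi> d = Some r" "r \<in> {Ec, Ed}" "\<phi> e = Some Ee" "\<phi> t = Some Eb"
      "r = Ec \<Longrightarrow> lin d u" "lin t u" "\<not> prec t d u"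
    have "Eb \<in> X" "Ee \<in> X" "r \<in> X"
      using * X by auto
    then show "prec3 d e t u = prec3 d e t v"
      using * bce bde de uv(8)[of d t e] uv(9)[of t d e] by auto
  qed (fact uv)+
qed

text \<open>\<open>vB\<close> is excluded here because it is reached from \<open>vA\<close> by
  reversal in \<open>sat_B\<close>.\<close>

lemma agreeI:
  assumes "set u = set v" "\<And>x. prec x x u = prec x x v" and D: "D \<subseteq> irreducibles - {vB}"
    and "\<And>x y. vM \<in> D \<Longrightarrow> lin x u \<Longrightarrow> lin y u \<Longrightarrow> prec x y u = prec x y v"
    and "\<And>x y. vL \<in> D \<Longrightarrow> lin x u \<Longrightarrow> prec y x u = prec y x v"
    and "\<And>x y. vR \<in> D \<Longrightarrow> lin x u \<Longrightarrow> prec x y u = prec x y v"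
    and "\<And>x y. vA0 \<in> D \<or> vA \<in> D \<Longrightarrow> prec x y u = prec x y v"
    and "\<And>s t x. vQ \<in> D \<Longrightarrow> lin s u \<Longrightarrow> lin t u \<Longrightarrow> prec3 s x t u = prec3 s x t v"
    and "\<And>d e t. vA \<in> D \<Longrightarrow> lin t u \<Longrightarrow> \<not> prec t d u \<Longrightarrow> prec3 d e t u = prec3 d e t v"
  shows "(u, v) \<in> agree D"
proof -
  have l: "lin x u = lin x v" for x
    using assms(1,2) by (simp add: lin_def)
  have "feat j u = feat j v" if "j \<in> D" for j
  proof -
    have "j = vS \<or> j = vN \<or> j = vM \<or> j = vL \<or> j = vR \<or> j = vA0 \<or> j = vQ \<or> j = vA"
      using that D by auto
    then show ?thesis
    proof (elim disjE)
      assume "j = vS"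
      then show "feat j u = feat j v"
        using assms(1) by (simp add: feat_S)
    next
      assume "j = vN"
      then show "feat j u = feat j v"
        using assms(2) by (simp add: feat_N)
    next
      assume "j = vM"
      then show "feat j u = feat j v"
        using that assms(4) by (auto simp: feat_M l cong: conj_cong)
    next
      assume "j = vL"
      then show "feat j u = feat j v"
        using that assms(5) by (auto simp: feat_L l cong: conj_cong)
    next
      assume "j = vR"
      then show "feat j u = feat j v"
        using that assms(6) by (auto simp: feat_R l cong: conj_cong)
    next
      assume "j = vA0"
      then show "feat j u = feat j v"
        using that assms(7) by (auto simp: feat_A0 l cong: conj_cong)
    next
      assume "j = vQ"
      then show "feat j u = feat j v"
        using that assms(8) by (auto simp: feat_Q l cong: conj_cong)
    next
      assume "j = vA"
      then show "feat j u = feat j v"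
        using that assms(7,9) by (auto simp: feat_A l cong: conj_cong)
    qed
  qed
  then show ?thesis
    by (simp add: agree_def)
qed

lemma sat_table_N: "sat (table {Z, Ec}) u v \<longleftrightarrow> (u, v) \<in> agree (down vN)"
proof
  assume s: "sat (table {Z, Ec}) u v"
  show "(u, v) \<in> agree (down vN)"
    by (rule agreeI) (use content_if_sat[OF s] nonlin_if_sat_A[OF s] in auto)
next
  assume "(u, v) \<in> agree (down vN)"
  then show "sat (table {Z, Ec}) u v"
    by (rule sat_table_if_agree) auto
qed

lemma sat_table_M: "sat (table {Z, Ea, Eb, Ec}) u v \<longleftrightarrow> (u, v) \<in> agree (down vM)"
proof
  assume s: "sat (table {Z, Ea, Eb, Ec}) u v"
  show "(u, v) \<in> agree (down vM)"
    by (rule agreeI) (use content_if_sat[OF s] nonlin_if_sat_A[OF s] linear_order_if_sat_A[OF s] in auto)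
next
  assume "(u, v) \<in> agree (down vM)"
  then show "sat (table {Z, Ea, Eb, Ec}) u v"
    by (rule sat_table_if_agree) auto
qed

lemma sat_table_L: "sat (table {Z, Ec, Ed}) u v \<longleftrightarrow> (u, v) \<in> agree (down vL)"
proof
  assume s: "sat (table {Z, Ec, Ed}) u v"
  show "(u, v) \<in> agree (down vL)"
    by (rule agreeI) (use content_if_sat[OF s] nonlin_if_sat_A[OF s] before_linear_if_sat_A_cd[OF s] in auto)
next
  assume "(u, v) \<in> agree (down vL)"
  then show "sat (table {Z, Ec, Ed}) u v"
    by (rule sat_table_if_agree) auto
qed

lemma sat_table_R: "sat (table {Z, Ec, Ee}) u v \<longleftrightarrow> (u, v) \<in> agree (down vR)"
proof
  assume s: "sat (table {Z, Ec, Ee}) u v"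
  show "(u, v) \<in> agree (down vR)"
    by (rule agreeI) (use content_if_sat[OF s] nonlin_if_sat_A[OF s] after_linear_if_sat_A[OF s] in auto)
next
  assume "(u, v) \<in> agree (down vR)"
  then show "sat (table {Z, Ec, Ee}) u v"
    by (rule sat_table_if_agree) auto
qed

lemma sat_table_A0: "sat (table {Z, Ec, Ed, Ee}) u v \<longleftrightarrow> (u, v) \<in> agree (down vA0)"
proof
  assume s: "sat (table {Z, Ec, Ed, Ee}) u v"
  show "(u, v) \<in> agree (down vA0)"
    by (rule agreeI) (use content_if_sat[OF s] prec_if_sat_A[OF s] in auto)
next
  assume "(u, v) \<in> agree (down vA0)"
  then show "sat (table {Z, Ec, Ed, Ee}) u v"
    by (rule sat_table_if_agree) auto
qed

lemma sat_table_Q: "sat (table {Z, Ea, Eb, Ec, Ee}) u v \<longleftrightarrow> (u, v) \<in> agree (down vQ)"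
proof
  assume s: "sat (table {Z, Ea, Eb, Ec, Ee}) u v"
  show "(u, v) \<in> agree (down vQ)"
    by (rule agreeI)
      (use content_if_sat[OF s] nonlin_if_sat_A[OF s] before_linear_if_sat_A_be[OF s]
        after_linear_if_sat_A[OF s] between_linear_if_sat_A[OF s] in auto)
next
  assume "(u, v) \<in> agree (down vQ)"
  then show "sat (table {Z, Ea, Eb, Ec, Ee}) u v"
    by (rule sat_table_if_agree) auto
qed

lemma sat_table_A: "sat (table UNIV) u v \<longleftrightarrow> (u, v) \<in> agree (down vA)"
proof
  assume s: "sat (table UNIV) u v"
  show "(u, v) \<in> agree (down vA)"
    by (rule agreeI)
      (use content_if_sat[OF s] prec_if_sat_A[OF s] between_linear_if_sat_A[OF s] prec3_left_if_sat_A[OF s] in auto)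
next
  assume "(u, v) \<in> agree (down vA)"
  then show "sat (table UNIV) u v"
    by (rule sat_table_if_agree) auto
qed

section \<open>The identities of B_0^1\<close>

lemma mult_B0_eq_iff:
  "mult_B0 x y = Ea \<longleftrightarrow> x = Ea \<and> y = Ea"
  "mult_B0 x y = Eb \<longleftrightarrow> x = Eb \<and> y = Eb"
  "mult_B0 x y = Ec \<longleftrightarrow> x = Ec \<and> y = Eb \<or> x = Ea \<and> y = Ec"
  by (cases x; cases y; simp)+

lemma mult_adjoin_B0_eq_iff:
  "mult_adjoin mult_B0 x y = Some Ea \<longleftrightarrow> x = None \<and> y = Some Ea \<or> x = Some Ea \<and> (y = None \<or> y = Some Ea)"
  "mult_adjoin mult_B0 x y = Some Eb \<longleftrightarrow> x = None \<and> y = Some Eb \<or> x = Some Eb \<and> (y = None \<or> y = Some Eb)"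
  "mult_adjoin mult_B0 x y = Some Ec \<longleftrightarrow> x = None \<and> y = Some Ec \<or> x = Some Ec \<and> (y = None \<or> y = Some Eb)
    \<or> x = Some Ea \<and> y = Some Ec"
  by (cases x; cases y; auto simp: mult_B0_eq_iff)+

lemma word_val_B0_Ea: "set w \<subseteq> {None, Some Z, Some Ea, Some Eb, Some Ec} \<Longrightarrow>
    word_val mult_B0 w = Some Ea \<longleftrightarrow> Some Z \<notin> set w \<and> Some Ea \<in> set w \<and> Some Eb \<notin> set w \<and> Some Ec \<notin> set w"
  by (induction w rule: Cons_elt_induct) (auto simp: mult_adjoin_B0_eq_iff word_val_None)

lemma word_val_B0_Eb: "set w \<subseteq> {None, Some Z, Some Ea, Some Eb, Some Ec} \<Longrightarrow>
    word_val mult_B0 w = Some Eb \<longleftrightarrow> Some Z \<notin> set w \<and> Some Ea \<notin> set w \<and> Some Eb \<in> set w \<and> Some Ec \<notin> set w"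
  by (induction w rule: Cons_elt_induct) (auto simp: mult_adjoin_B0_eq_iff word_val_None)

text \<open>Up to factors \<open>None\<close>, these are the words a^i c b^j.\<close>

lemma word_val_B0_Ec: "set w \<subseteq> {None, Some Z, Some Ea, Some Eb, Some Ec} \<Longrightarrow>
    word_val mult_B0 w = Some Ec \<longleftrightarrow> Some Z \<notin> set w \<and> Some Ec \<in> set w \<and>
      \<not> prec (Some Ec) (Some Ec) w \<and> \<not> prec (Some Ec) (Some Ea) w \<and> \<not> prec (Some Eb) (Some Ec) w"
proof (induction w rule: Cons_elt_induct)
  case (Ec w)
  then show ?case
    using prec_in_set[of "Some Ec" "Some Ec" w] prec_in_set[of "Some Ec" "Some Ea" w]
      prec_in_set[of "Some Eb" "Some Ec" w]
    by (auto simp: mult_adjoin_B0_eq_iff word_val_B0_Eb word_val_None)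
qed (auto simp: mult_adjoin_B0_eq_iff)

lemma word_val_B0_range: "set w \<subseteq> {None, Some Z, Some Ea, Some Eb, Some Ec} \<Longrightarrow>
    word_val mult_B0 w \<in> {None, Some Z, Some Ea, Some Eb, Some Ec}"
proof (induction w)
  case (Cons x w)
  then show ?case
    by auto
qed simp

lemma sat_B0: "sat (adjoin_one {Z, Ea, Eb, Ec} mult_B0) u v \<longleftrightarrow> (u, v) \<in> agree (down vB0)"
proof
  assume uv: "(u, v) \<in> agree (down vB0)"
  note uv = agreeD[OF uv, simplified]
  show "sat (adjoin_one {Z, Ea, Eb, Ec} mult_B0) u v"
  proof (rule satI)
    fix \<phi> :: "'a \<Rightarrow> elt option" assume X: "\<And>x r. \<phi> x = Some r \<Longrightarrow> r \<in> {Z, Ea, Eb, Ec}"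
    let ?X = "{None, Some Z, Some Ea, Some Eb, Some Ec}" and ?u = "map \<phi> u" and ?v = "map \<phi> v"
    have "\<phi> x \<in> ?X" for x
      using X[of x] by (cases "\<phi> x") auto
    then have "\<phi> ` A \<subseteq> ?X" for A
      by (rule image_subsetI)
    then have u: "set ?u \<subseteq> ?X" and v: "set ?v \<subseteq> ?X"
      unfolding set_map by this+
    have S: "set ?u = set ?v"
      using uv(1) by simp
    have cc: "prec (Some Ec) (Some Ec) ?u = prec (Some Ec) (Some Ec) ?v"
      unfolding prec_map_self uv(1,2) ..
    have "lin x u" if "\<phi> x = Some Ec" "x \<in> set u" "\<not> prec (Some Ec) (Some Ec) ?u" for x
      using that unfolding lin_def prec_map by blast
    moreover have "x \<in> set u \<and> y \<in> set u" if "prec x y u \<or> prec x y v" for x y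
      using that prec_in_set[of x y] uv(1) by blast
    ultimately have "prec x y u = prec x y v" if "\<phi> x = Some Ec \<or> \<phi> y = Some Ec" "\<not> prec (Some Ec) (Some Ec) ?u" for x y
      using that uv(5)[of y x] uv(6)[of x y] by blast
    then have "prec (Some Ec) (Some Ea) ?u = prec (Some Ec) (Some Ea) ?v"
      "prec (Some Eb) (Some Ec) ?u = prec (Some Eb) (Some Ec) ?v" if "\<not> prec (Some Ec) (Some Ec) ?u"
      using that unfolding prec_map[of _ _ \<phi> u] prec_map[of _ _ \<phi> v] by metis+
    then have "word_val mult_B0 ?u = Some Ec \<longleftrightarrow> word_val mult_B0 ?v = Some Ec"
      unfolding word_val_B0_Ec[OF u] word_val_B0_Ec[OF v] S cc by blast
    moreover have "word_val mult_B0 ?u = Some Ea \<longleftrightarrow> word_val mult_B0 ?v = Some Ea"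
      "word_val mult_B0 ?u = Some Eb \<longleftrightarrow> word_val mult_B0 ?v = Some Eb" "word_val mult_B0 ?u = None \<longleftrightarrow> word_val mult_B0 ?v = None"
      unfolding word_val_B0_Ea[OF u] word_val_B0_Ea[OF v] word_val_B0_Eb[OF u] word_val_B0_Eb[OF v] word_val_None S by blast+
    ultimately show "word_val mult_B0 ?u = word_val mult_B0 ?v"
      using word_val_B0_range[OF u] word_val_B0_range[OF v] by auto
  qed
next
  assume sat: "sat (adjoin_one {Z, Ea, Eb, Ec} mult_B0) u v"
  have S: "set u = set v"
    using content_if_sat[OF sat] by simp
  have nl: "prec x x u = prec x x v" for x
  proof -
    define \<phi> where "\<phi> z = (if z = x then Some Ec else None)" for z
    have "word_val mult_B0 (map \<phi> w) = Some Ec \<longleftrightarrow> x \<in> set w \<and> \<not> prec x x w" for w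
      by (subst word_val_B0_Ec) (auto simp: prec_map \<phi>_def split: if_splits)
    moreover have "word_val mult_B0 (map \<phi> u) = word_val mult_B0 (map \<phi> v)"
      by (rule satD[OF sat]) (auto simp: \<phi>_def split: if_splits)
    ultimately show ?thesis
      using S prec_in_set[of x x u] prec_in_set[of x x v] by metis
  qed
  have xy: "prec y x u = prec y x v \<and> prec x y u = prec x y v" if x: "lin x u" and "x \<noteq> y" for x y
  proof -
    have x': "lin x v"
      using x S nl by (simp add: lin_def)
    \<comment> \<open>With a for \<open>y\<close>: ac = c and ca = 0. With b for \<open>y\<close>:
      cb = c and bc = 0. The two choices detect the two orders.\<close>
    define \<phi> where "\<phi> q z = (if z = x then Some Ec else if z = y then Some q else None)" for q z
    have "word_val mult_B0 (map (\<phi> Ea) w) = Some Ec \<longleftrightarrow> \<not> prec x y w"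
      "word_val mult_B0 (map (\<phi> Eb) w) = Some Ec \<longleftrightarrow> \<not> prec y x w" if "lin x w" for w
      using that \<open>x \<noteq> y\<close> by (subst word_val_B0_Ec; auto simp: prec_map \<phi>_def lin_def split: if_splits)+
    moreover have "word_val mult_B0 (map (\<phi> q) u) = word_val mult_B0 (map (\<phi> q) v)" if "q \<in> {Ea, Eb}" for q
      using that by (intro satD[OF sat]) (auto simp: \<phi>_def split: if_splits)
    ultimately show ?thesis
      using x x' by (metis insertCI)
  qed
  show "(u, v) \<in> agree (down vB0)"
  proof (rule agreeI)
    have *: "prec y x u = prec y x v" "prec x y u = prec x y v" if "lin x u" for x y
      using xy[OF that, of y] nl by (cases "x = y"; auto)+
    show "prec x y u = prec x y v" if "lin x u" "lin y u" for x y
      using *(2) that by blast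
    show "prec y x u = prec y x v" if "lin x u" for x y
      using *(1) that by blast
    show "prec x y u = prec x y v" if "lin x u" for x y
      using *(2) that by blast
  qed (use S nl in auto)
qed

section \<open>The trivial monoid, the semilattice, duality and direct products\<close>

lemma down_le: "down X \<subseteq> irreducibles"
  by (cases X) auto

lemma monoid_table: "(\<And>x y. x \<in> X \<Longrightarrow> y \<in> X \<Longrightarrow> mult_A x y \<in> X) \<Longrightarrow> monoid (table X)"
  by (rule monoid_adjoin_one) (simp_all add: mult_A_assoc)

lemma monoid_T: "monoid T_mon"
  by (rule monoidI) (auto simp: T_mon_def)

lemma sat_T: "sat T_mon u v"
proof -
  have "weval T_mon \<phi> w = 1" if "range \<phi> \<subseteq> {1}" for \<phi> and w :: "'a list"
    using that by (induction w) (auto simp: T_mon_def)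
  then show ?thesis
    by (simp add: sat_def T_mon_def)
qed

lemma monoid_S: "monoid S_mon"
  by (rule monoidI) (auto simp: S_mon_def)

lemma sat_S: "sat S_mon u v \<longleftrightarrow> (u, v) \<in> agree (down vS)"
proof -
  have weval: "weval S_mon \<phi> w = (if 0 \<in> \<phi> ` set w then 0 else 1)" if "range \<phi> \<subseteq> {0, 1}" for \<phi> and w :: "'a list"
  proof (induction w)
    case (Cons x w)
    have "\<phi> x = 0 \<or> \<phi> x = 1"
      using that by blast
    then show ?case
      using Cons by (auto simp: S_mon_def)
  qed (simp add: S_mon_def)
  have "set u = set v" if s: "sat S_mon u v"
  proof -
    have "x \<in> set u \<longleftrightarrow> x \<in> set v" for x
    proof -
      define \<phi> :: "'a \<Rightarrow> nat" where "\<phi> z = (if z = x then 0 else 1)" for z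
      have "range \<phi> \<subseteq> {0, 1}"
        by (auto simp: \<phi>_def)
      then have "weval S_mon \<phi> u = weval S_mon \<phi> v"
        using s by (simp add: sat_def S_mon_def)
      moreover have "0 \<in> \<phi> ` set w \<longleftrightarrow> x \<in> set w" for w
        by (auto simp: \<phi>_def)
      ultimately show ?thesis
        using weval[OF \<open>range \<phi> \<subseteq> {0, 1}\<close>] by (metis zero_neq_one)
    qed
    then show ?thesis by blast
  qed
  moreover have "sat S_mon u v" if "set u = set v"
  proof -
    have "carrier S_mon = {0, 1}"
      by (simp add: S_mon_def)
    then show ?thesis
      using that by (simp add: sat_def weval)
  qed
  ultimately show ?thesis
    by (auto simp: agree_def feat_S)
qed

lemma feat_rev:
  "feat vS (rev u) = feat vS (rev v) \<longleftrightarrow> feat vS u = feat vS v"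
  "feat vN (rev u) = feat vN (rev v) \<longleftrightarrow> feat vN u = feat vN v"
  "feat vM (rev u) = feat vM (rev v) \<longleftrightarrow> feat vM u = feat vM v"
  "feat vL (rev u) = feat vL (rev v) \<longleftrightarrow> feat vR u = feat vR v"
  "feat vR (rev u) = feat vR (rev v) \<longleftrightarrow> feat vL u = feat vL v"
  "feat vA0 (rev u) = feat vA0 (rev v) \<longleftrightarrow> feat vA0 u = feat vA0 v"
  "feat vQ (rev u) = feat vQ (rev v) \<longleftrightarrow> feat vQ u = feat vQ v"
  "feat vA (rev u) = feat vA (rev v) \<longleftrightarrow> feat vB u = feat vB v"
  unfolding feat_eq lin_rev prec_rev prec3_rev set_rev by blast+

lemma monoid_A: "monoid A_1"
  unfolding A_1_def by (rule monoid_table) simp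

lemma finite_elt: "finite (UNIV :: elt set)"
proof (rule finite_subset)
  show "UNIV \<subseteq> {Z, Ea, Eb, Ec, Ed, Ee}"
    using elt.exhaust by blast
qed simp

lemma finite_A: "finite (carrier A_1)" and finite_B: "finite (carrier B_1)"
  by (simp_all add: A_1_def B_1_def finite_elt)

lemma sat_A: "sat A_1 u v \<longleftrightarrow> (u, v) \<in> agree (down vA)"
  unfolding A_1_def by (rule sat_table_A)

lemma monoid_B: "monoid B_1"
  unfolding B_1_def by (rule monoid_adjoin_one) (simp_all add: mult_A_assoc)

text \<open>\<open>B_1\<close> evaluates a word as \<open>A_1\<close> evaluates its reversal, and
  reversal exchanges \<open>vL\<close> with \<open>vR\<close> and \<open>vA\<close> with
  \<open>vB\<close>.\<close>

lemma sat_B: "sat B_1 u v \<longleftrightarrow> (u, v) \<in> agree (down vB)"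
proof -
  have c: "carrier B_1 = carrier A_1"
    by (simp add: A_1_def B_1_def)
  have m: "x \<otimes>\<^bsub>B_1\<^esub> y = y \<otimes>\<^bsub>A_1\<^esub> x" for x y
    by (cases x; cases y) (simp_all add: A_1_def B_1_def)
  have o: "\<one>\<^bsub>B_1\<^esub> = \<one>\<^bsub>A_1\<^esub>"
    by (simp add: A_1_def B_1_def)
  have "weval B_1 \<phi> w = weval A_1 \<phi> (rev w)" if \<phi>: "range \<phi> \<subseteq> carrier A_1" for \<phi> and w :: "'a list"
  proof (induction w)
    case (Cons x w)
    have "\<phi> x \<in> carrier A_1"
      using \<phi> by blast
    then show ?case
      by (simp add: Cons m weval_append[OF monoid_A \<phi>] monoid.r_one[OF monoid_A])
  qed (simp add: o)
  then have "sat B_1 u v \<longleftrightarrow> sat A_1 (rev u) (rev v)"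
    unfolding sat_def c by auto
  then show ?thesis
    unfolding sat_A by (auto simp: agree_def feat_rev)
qed

lemma sat_DirProd:
  assumes "monoid G" "monoid H"
  shows "sat (G \<times>\<times> H) u v \<longleftrightarrow> sat G u v \<and> sat H u v"
proof -
  have weval: "weval (G \<times>\<times> H) \<phi> w = (weval G (fst \<circ> \<phi>) w, weval H (snd \<circ> \<phi>) w)" for \<phi> and w :: "'c list"
    by (induction w) (simp_all add: mult_DirProd')
  show ?thesis
  proof (intro iffI conjI)
    assume s: "sat (G \<times>\<times> H) u v"
    show "sat G u v"
      unfolding sat_def
    proof (intro allI impI)
      fix \<phi> :: "'c \<Rightarrow> 'a" assume "range \<phi> \<subseteq> carrier G"
      then have "range (\<lambda>x. (\<phi> x, \<one>\<^bsub>H\<^esub>)) \<subseteq> carrier (G \<times>\<times> H)"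
        using monoid.one_closed[OF assms(2)] by auto
      then have "weval (G \<times>\<times> H) (\<lambda>x. (\<phi> x, \<one>\<^bsub>H\<^esub>)) u = weval (G \<times>\<times> H) (\<lambda>x. (\<phi> x, \<one>\<^bsub>H\<^esub>)) v"
        using s unfolding sat_def by blast
      then show "weval G \<phi> u = weval G \<phi> v"
        by (simp add: weval comp_def)
    qed
    show "sat H u v"
      unfolding sat_def
    proof (intro allI impI)
      fix \<phi> :: "'c \<Rightarrow> 'b" assume "range \<phi> \<subseteq> carrier H"
      then have "range (\<lambda>x. (\<one>\<^bsub>G\<^esub>, \<phi> x)) \<subseteq> carrier (G \<times>\<times> H)"
        using monoid.one_closed[OF assms(1)] by auto
      then have "weval (G \<times>\<times> H) (\<lambda>x. (\<one>\<^bsub>G\<^esub>, \<phi> x)) u = weval (G \<times>\<times> H) (\<lambda>x. (\<one>\<^bsub>G\<^esub>, \<phi> x)) v"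
        using s unfolding sat_def by blast
      then show "weval H \<phi> u = weval H \<phi> v"
        by (simp add: weval comp_def)
    qed
  next
    assume s: "sat G u v \<and> sat H u v"
    show "sat (G \<times>\<times> H) u v"
      unfolding sat_def weval
    proof (intro allI impI)
      fix \<phi> :: "'c \<Rightarrow> 'a \<times> 'b" assume "range \<phi> \<subseteq> carrier (G \<times>\<times> H)"
      then have "\<phi> x \<in> carrier G \<times> carrier H" for x
        by auto
      then have "range (fst \<circ> \<phi>) \<subseteq> carrier G" "range (snd \<circ> \<phi>) \<subseteq> carrier H"
        by (auto simp: mem_Times_iff)
      then show "(weval G (fst \<circ> \<phi>) u, weval H (snd \<circ> \<phi>) u) = (weval G (fst \<circ> \<phi>) v, weval H (snd \<circ> \<phi>) v)"
        using s unfolding sat_def by blast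
    qed
  qed
qed

lemma var_generated_iso:
  assumes "monoid G" "G \<cong> H"
  shows "var_generated {H} = var_generated {G}"
proof -
  have "H \<cong> N \<longleftrightarrow> G \<cong> N" for N :: "'c monoid"
    using iso_trans[OF assms(2)] iso_trans[OF is_iso_sym[OF assms]] by blast
  then show ?thesis
    by (simp add: var_generated_def)
qed

lemma word_congruence_identities:
  assumes V: "\<And>N. N \<in> V \<Longrightarrow> monoid N" and le: "agree_all \<subseteq> identities V"
  shows "word_congruence (identities V)"
proof
  fix u v assume uv: "(u, v) \<in> identities V"
  show "(v, u) \<in> identities V"
    using uv by (auto simp: identities_def sat_def)
  show "(u, w) \<in> identities V" if "(v, w) \<in> identities V" for w
    using uv that by (auto simp: identities_def sat_def)
  show "(p @ u @ q, p @ v @ q) \<in> identities V" for p q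
    using uv by (auto simp: identities_def sat_def weval_append V)
  show "(concat (map f u), concat (map f v)) \<in> identities V" for f
    using uv by (auto simp: identities_def sat_def weval_concat_map V weval_closed image_subset_iff)
qed (fact le)

lemma monoid_in_models: "N \<in> models E \<Longrightarrow> monoid N"
  by (simp add: models_def)

lemma subset_identities_iff:
  "(\<And>N. N \<in> V \<Longrightarrow> monoid N) \<Longrightarrow> E \<subseteq> identities V \<longleftrightarrow> V \<subseteq> models E"
  by (auto simp: models_def identities_def)

lemma agree_mono: "D \<subseteq> D' \<Longrightarrow> agree D' \<subseteq> agree D"
  by (auto simp: agree_def)

lemma identities_eq_agree_down:
  assumes V: "\<And>N. N \<in> V \<Longrightarrow> monoid N" and le: "V \<subseteq> models agree_all"
  shows "\<exists>X. identities V = agree (down X)"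
  using word_congruence.eq_agree_down[OF word_congruence_identities[OF V]] subset_identities_iff[OF V] le
  by blast

lemma agree_down_subset_iff: "agree (down Y) \<subseteq> (agree (down X) :: (nat list \<times> nat list) set) \<longleftrightarrow> down X \<subseteq> down Y"
proof
  assume le: "agree (down Y) \<subseteq> (agree (down X) :: (nat list \<times> nat list) set)"
  show "down X \<subseteq> down Y"
  proof
    fix j assume j: "j \<in> down X"
    then have "j \<in> irreducibles"
      using down_le by blast
    then show "j \<in> down Y"
      using ax_in_agree_down[of j X] ax_in_agree_down[of j Y] le j by blast
  qed
qed (rule agree_mono)

lemma identities_singleton: "(\<And>u v. sat G u v \<longleftrightarrow> (u, v) \<in> E) \<Longrightarrow> identities {G} = E"
  by (auto simp: identities_def)

section \<open>The top variety, the variety of Q^1 and the meet\<close>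

context
  assumes inf: "infinite (UNIV :: 'u set)"
begin

lemma var_generated_eq_models_agree:
  assumes "monoid G" "finite (carrier G)"
    "\<And>u v :: nat list. sat G u v \<longleftrightarrow> (u, v) \<in> agree (down X)"
  shows "(var_generated {G} :: 'u monoid set) = models (agree (down X))"
  using var_generated_eq_models[OF inf assms(1,2)] identities_singleton[OF assms(3)] by simp

lemma var_generated_iso_eq_models_agree:
  assumes "monoid G" "finite (carrier G)"
    "\<And>u v :: nat list. sat G u v \<longleftrightarrow> (u, v) \<in> agree (down X)" "G \<cong> H"
  shows "(var_generated {H} :: 'u monoid set) = models (agree (down X))"
  unfolding var_generated_iso[OF assms(1,4)] by (rule var_generated_eq_models_agree[OF assms(1-3)])

lemma var_generated_AB: "(var_generated {A_1 \<times>\<times> B_1} :: 'u monoid set) = models agree_all"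
proof (rule var_generated_eq_models_agree)
  show "monoid (A_1 \<times>\<times> B_1)"
    using DirProd_monoid monoid_A monoid_B .
  show "finite (carrier (A_1 \<times>\<times> B_1))"
    by (simp add: finite_A finite_B)
  show "sat (A_1 \<times>\<times> B_1) u v \<longleftrightarrow> (u, v) \<in> agree_all" for u v :: "nat list"
    unfolding sat_DirProd[OF monoid_A monoid_B] sat_A sat_B by (auto simp: agree_def)
qed

lemma model_identities_agree:
  fixes N :: "'u monoid"
  assumes "N \<in> models agree_all"
  obtains X where "identities {N} = agree (down X)"
  using identities_eq_agree_down[of "{N}"] assms monoid_in_models by blast

text \<open>By the classification, the identities of a member \<open>N\<close> form
  \<open>agree (down X)\<close> for some \<open>X\<close>. The defining identity is
  \<open>ax vA0\<close>, so \<open>vA0\<close> is not in \<open>down X\<close>, and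
  \<open>down vQ\<close> is the largest ideal without \<open>vA0\<close>.\<close>

lemma var_Q_eq_models: "(var_Q :: 'u monoid set) = models (agree (down vQ))"
proof
  show "(var_Q :: 'u monoid set) \<subseteq> models (agree (down vQ))"
  proof
    fix N :: "'u monoid" assume "N \<in> var_Q"
    then have N: "N \<in> models agree_all" and
      eq: "\<forall>x\<in>carrier N. \<forall>y\<in>carrier N. x [^]\<^bsub>N\<^esub> (2::nat) \<otimes>\<^bsub>N\<^esub> y [^]\<^bsub>N\<^esub> (2::nat) =
        x \<otimes>\<^bsub>N\<^esub> y [^]\<^bsub>N\<^esub> (2::nat) \<otimes>\<^bsub>N\<^esub> x"
      unfolding var_Q_def var_generated_AB by auto
    interpret monoid N
      using N by (rule monoid_in_models)
    obtain X where X: "identities {N} = agree (down X)"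
      using N by (rule model_identities_agree)
    have "sat N [0::nat, 0, 1, 1] [0, 1, 1, 0]"
      unfolding sat_def
    proof (intro allI impI)
      fix \<phi> :: "nat \<Rightarrow> 'u" assume "range \<phi> \<subseteq> carrier N"
      then have "\<phi> 0 \<in> carrier N" "\<phi> 1 \<in> carrier N"
        by blast+
      then show "weval N \<phi> [0, 0, 1, 1] = weval N \<phi> [0, 1, 1, 0]"
        using eq[rule_format, of "\<phi> 0" "\<phi> 1"] by (simp add: numeral_2_eq_2 m_assoc)
    qed
    then have "ax vA0 \<in> agree (down X)"
      unfolding X[symmetric] by (simp add: identities_def)
    then have "vA0 \<notin> down X"
      by (simp add: ax_in_agree_down del: ax.simps)
    then have "agree (down vQ) \<subseteq> identities {N}"
      unfolding X by (intro agree_mono) (cases X; simp)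
    then show "N \<in> models (agree (down vQ))"
      using subset_identities_iff[of "{N}"] monoid_axioms by blast
  qed
  show "models (agree (down vQ)) \<subseteq> (var_Q :: 'u monoid set)"
  proof
    fix N :: "'u monoid" assume N: "N \<in> models (agree (down vQ))"
    interpret monoid N
      using N by (rule monoid_in_models)
    have "agree_all \<subseteq> agree (down vQ)"
      by (rule agree_mono) auto
    then have 1: "N \<in> var_generated {A_1 \<times>\<times> B_1}"
      unfolding var_generated_AB using N by (auto simp: models_def)
    have "ax vA0 \<in> agree (down vQ)"
      by (subst ax_in_agree_down) auto
    then have sat: "sat N [0::nat, 0, 1, 1] [0, 1, 1, 0]"
      using N by (auto simp: models_def)
    have "x [^]\<^bsub>N\<^esub> (2::nat) \<otimes>\<^bsub>N\<^esub> y [^]\<^bsub>N\<^esub> (2::nat) = x \<otimes>\<^bsub>N\<^esub> y [^]\<^bsub>N\<^esub> (2::nat) \<otimes>\<^bsub>N\<^esub> x"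
      if "x \<in> carrier N" "y \<in> carrier N" for x y
    proof -
      have "range (\<lambda>i::nat. if i = 0 then x else y) \<subseteq> carrier N"
        using that by auto
      from sat[unfolded sat_def, rule_format, OF this] show ?thesis
        using that by (simp add: numeral_2_eq_2 m_assoc)
    qed
    then show "N \<in> var_Q"
      unfolding var_Q_def using 1 by simp
  qed
qed

text \<open>The theory of the meet is the join of two congruences. Instead of computing it, the
  classification is applied to one monoid \<open>N\<close> in both classes: its ideal contains
  neither \<open>vA\<close> nor \<open>vB\<close>, and \<open>down vA_meet_B\<close> is the largest
  such ideal.\<close>

lemma models_agree_meet:
  "(models (agree (down vA)) \<inter> models (agree (down vB)) :: 'u monoid set) = models (agree (down vA_meet_B))"
proof
  show "(models (agree (down vA)) \<inter> models (agree (down vB)) :: 'u monoid set) \<subseteq> models (agree (down vA_meet_B))"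
  proof
    fix N :: "'u monoid" assume N: "N \<in> models (agree (down vA)) \<inter> models (agree (down vB))"
    then have m: "monoid N"
      using monoid_in_models by blast
    have A: "agree (down vA) \<subseteq> identities {N}" and B: "agree (down vB) \<subseteq> identities {N}"
      using N m subset_identities_iff[of "{N}"] by auto
    moreover have "agree_all \<subseteq> agree (down vA)"
      by (rule agree_mono) auto
    ultimately have "N \<in> models agree_all"
      using m subset_identities_iff[of "{N}" agree_all] by auto
    then obtain X where X: "identities {N} = agree (down X)"
      by (rule model_identities_agree)
    have "vA \<notin> down X" "vB \<notin> down X"
      using A B unfolding X agree_down_subset_iff by (cases X; simp)+
    then have "agree (down vA_meet_B) \<subseteq> identities {N}"
      unfolding X by (intro agree_mono) (cases X; simp)
    then show "N \<in> models (agree (down vA_meet_B))"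
      using subset_identities_iff[of "{N}"] m by blast
  qed
  have "agree (down vA) \<subseteq> agree (down vA_meet_B)" "agree (down vB) \<subseteq> agree (down vA_meet_B)"
    by (rule agree_mono; auto)+
  then show "models (agree (down vA_meet_B)) \<subseteq> (models (agree (down vA)) \<inter> models (agree (down vB)) :: 'u monoid set)"
    by (auto simp: models_def)
qed

end

section \<open>The lattice of subvarieties\<close>

definition covers :: "(label \<times> label) set" where
  "covers = {(vT, vS), (vS, vN), (vN, vM),
          (vM, vL), (vM, vR), (vL, vB0), (vR, vB0),
          (vB0, vA0), (vB0, vQ), (vA0, vA_meet_B), (vQ, vA_meet_B),
          (vA_meet_B, vA), (vA_meet_B, vB), (vA, vA_times_B), (vB, vA_times_B)}"

lemma down_inj: "down X = down Y \<Longrightarrow> X = Y"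
proof -
  assume "down X = down Y"
  then have "j \<in> down X \<longleftrightarrow> j \<in> down Y" for j
    by simp
  from this[of vS] this[of vN] this[of vM] this[of vL] this[of vR] this[of vA0] this[of vQ] this[of vA] this[of vB]
  show ?thesis
    by (cases X; cases Y; simp)
qed

lemma covers_insert:
  assumes "(X, Y) \<in> covers"
  shows "\<exists>j. j \<notin> down X \<and> down Y = insert j (down X)"
proof -
  \<comment> \<open>If \<open>Y\<close> is join irreducible, the new element is \<open>Y\<close>
    itself; otherwise it is the irreducible below \<open>Y\<close> that \<open>X\<close>
    lacks.\<close>
  define j where "j = (case Y of vB0 \<Rightarrow> if X = vL then vR else vL | vA_meet_B \<Rightarrow> if X = vA0 then vQ else vA0
    | vA_times_B \<Rightarrow> if X = vA then vB else vA | _ \<Rightarrow> Y)"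
  have "j \<notin> down X \<and> down Y = insert j (down X)"
    using assms unfolding covers_def
    by (elim insertE emptyE; clarsimp simp: j_def) (simp_all add: insert_commute)
  then show ?thesis ..
qed

text \<open>Every strict inclusion of ideals starts with a listed pair; this shows that the list
  misses no covering.\<close>

lemma ex_covers: "down X \<subset> down Y \<Longrightarrow> \<exists>W. (X, W) \<in> covers \<and> down W \<subseteq> down Y"
proof -
  assume "down X \<subset> down Y"
  then have "j \<in> down X \<longrightarrow> j \<in> down Y" for j
    by blast
  note this[of vS] this[of vN] this[of vM] this[of vL] this[of vR] this[of vA0] this[of vQ] this[of vA] this[of vB]
  moreover have "X \<noteq> Y"
    using \<open>down X \<subset> down Y\<close> by auto
  ultimately show ?thesis
    unfolding covers_def by (cases X; cases Y; simp) (simp_all add: conj_disj_distribR ex_disj_distrib)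
qed

lemma down_cover_iff:
  "down X \<subset> down Y \<and> \<not> (\<exists>W. down X \<subset> down W \<and> down W \<subset> down Y) \<longleftrightarrow> (X, Y) \<in> covers"
proof
  assume *: "down X \<subset> down Y \<and> \<not> (\<exists>W. down X \<subset> down W \<and> down W \<subset> down Y)"
  then obtain W where W: "(X, W) \<in> covers" "down W \<subseteq> down Y"
    using ex_covers[of X Y] by auto
  obtain j where "j \<notin> down X" "down W = insert j (down X)"
    using covers_insert[OF W(1)] by (elim exE conjE)
  then have "down X \<subset> down W"
    by auto
  then have "down W = down Y"
    using * W(2) by auto
  then show "(X, Y) \<in> covers"
    using down_inj[of W Y] W(1) by simp
next
  assume "(X, Y) \<in> covers"
  then obtain j where j: "j \<notin> down X" "down Y = insert j (down X)"
    by (elim covers_insert[THEN exE] conjE)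
  have False if "down X \<subset> down W" "down W \<subset> insert j (down X)" for W
    using that by auto
  then show "down X \<subset> down Y \<and> \<not> (\<exists>W. down X \<subset> down W \<and> down W \<subset> down Y)"
    using j by auto
qed

section \<open>The thirteen varieties as model classes, their order and coverings\<close>

context
  assumes inf: "infinite (UNIV :: 'u set)"
begin

lemma variety_of_eq_models: "(variety_of X :: 'u monoid set) = models (agree (down X))"
proof (cases X)
  case vT
  have "(var_generated {T_mon} :: 'u monoid set) = models (agree (down vT))"
    by (rule var_generated_eq_models_agree[OF inf monoid_T])
      (simp add: T_mon_def, simp add: sat_T agree_def)
  with vT show ?thesis by simp
next
  case vS
  have "(var_generated {S_mon} :: 'u monoid set) = models (agree (down vS))"
    by (rule var_generated_eq_models_agree[OF inf monoid_S _ sat_S]) (simp add: S_mon_def)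
  with vS show ?thesis by simp
next
  case vN
  have "(var_generated {N_1} :: 'u monoid set) = models (agree (down vN))"
    by (rule var_generated_iso_eq_models_agree[OF inf monoid_table _ sat_table_N N_1_iso]) auto
  with vN show ?thesis by simp
next
  case vM
  have "(var_generated {M_1} :: 'u monoid set) = models (agree (down vM))"
    by (rule var_generated_iso_eq_models_agree[OF inf monoid_table _ sat_table_M M_1_iso]) auto
  with vM show ?thesis by simp
next
  case vL
  have "(var_generated {L_1} :: 'u monoid set) = models (agree (down vL))"
    by (rule var_generated_iso_eq_models_agree[OF inf monoid_table _ sat_table_L L_1_iso]) auto
  with vL show ?thesis by simp
next
  case vR
  have "(var_generated {R_1} :: 'u monoid set) = models (agree (down vR))"
    by (rule var_generated_iso_eq_models_agree[OF inf monoid_table _ sat_table_R R_1_iso]) auto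
  with vR show ?thesis by simp
next
  case vB0
  have "monoid (adjoin_one {Z, Ea, Eb, Ec} mult_B0)"
    by (rule monoid_adjoin_one) (auto simp: mult_B0_assoc)
  then have "(var_generated {B0_1} :: 'u monoid set) = models (agree (down vB0))"
    by (rule var_generated_iso_eq_models_agree[OF inf _ _ sat_B0 B0_1_iso]) auto
  with vB0 show ?thesis by simp
next
  case vA0
  have "(var_generated {A0_1} :: 'u monoid set) = models (agree (down vA0))"
    by (rule var_generated_iso_eq_models_agree[OF inf monoid_table _ sat_table_A0 A0_1_iso]) auto
  with vA0 show ?thesis by simp
next
  case vQ
  then show ?thesis
    by (simp only: variety_of.simps var_Q_eq_models[OF inf])
next
  case vA_meet_B
  then show ?thesis
    by (simp only: variety_of.simps models_agree_meet[OF inf]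
        var_generated_eq_models_agree[OF inf monoid_A finite_A sat_A]
        var_generated_eq_models_agree[OF inf monoid_B finite_B sat_B])
next
  case vA
  then show ?thesis
    by (simp only: variety_of.simps var_generated_eq_models_agree[OF inf monoid_A finite_A sat_A])
next
  case vB
  then show ?thesis
    by (simp only: variety_of.simps var_generated_eq_models_agree[OF inf monoid_B finite_B sat_B])
next
  case vA_times_B
  then show ?thesis
    by (simp only: variety_of.simps var_generated_AB[OF inf])
qed

lemma identities_models_subset_agree:
  assumes "monoid G" "finite (carrier G)" "\<And>u v :: nat list. sat G u v \<longleftrightarrow> (u, v) \<in> agree (down j)"
    and "j \<in> down X"
  shows "identities (models (agree (down X)) :: 'u monoid set) \<subseteq> agree (down j)"
proof -
  have "agree (down X) \<subseteq> identities {G}"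
    unfolding identities_singleton[OF assms(3)] by (rule agree_mono[OF down_trans[OF assms(4)]])
  then show ?thesis
    using identities_models_subset[OF inf assms(1,2)] unfolding identities_singleton[OF assms(3)] by blast
qed

text \<open>\<open>agree (down X)\<close> is the intersection of the \<open>agree (down j)\<close>
  for \<open>j\<close> in \<open>down X\<close>. For each such \<open>j\<close> the class contains a
  copy of a finite monoid whose identities are exactly \<open>agree (down j)\<close>, so no further
  identity holds in it.\<close>

lemma identities_models_agree: "identities (models (agree (down X)) :: 'u monoid set) = agree (down X)"
proof
  have "identities (models (agree (down X)) :: 'u monoid set) \<subseteq> agree (down j)" if j: "j \<in> down X" for j
  proof -
    note * = identities_models_subset_agree[OF _ _ _ j]
    have "j = vS \<or> j = vN \<or> j = vM \<or> j = vL \<or> j = vR \<or> j = vA0 \<or> j = vQ \<or> j = vA \<or> j = vB"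
      using j down_le[of X] by auto
    then show ?thesis
    proof (elim disjE)
      assume j: "j = vS"
      show ?thesis
        by (rule *[OF monoid_S]) (simp_all only: j sat_S, simp add: S_mon_def)
    next
      assume j: "j = vN"
      show ?thesis
        by (rule *[of "table {Z, Ec}"]) (simp_all only: j sat_table_N, auto intro!: monoid_table)
    next
      assume j: "j = vM"
      show ?thesis
        by (rule *[of "table {Z, Ea, Eb, Ec}"]) (simp_all only: j sat_table_M, auto intro!: monoid_table)
    next
      assume j: "j = vL"
      show ?thesis
        by (rule *[of "table {Z, Ec, Ed}"]) (simp_all only: j sat_table_L, auto intro!: monoid_table)
    next
      assume j: "j = vR"
      show ?thesis
        by (rule *[of "table {Z, Ec, Ee}"]) (simp_all only: j sat_table_R, auto intro!: monoid_table)
    next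
      assume j: "j = vA0"
      show ?thesis
        by (rule *[of "table {Z, Ec, Ed, Ee}"]) (simp_all only: j sat_table_A0, auto intro!: monoid_table)
    next
      assume j: "j = vQ"
      show ?thesis
        by (rule *[of "table {Z, Ea, Eb, Ec, Ee}"]) (simp_all only: j sat_table_Q, auto intro!: monoid_table)
    next
      assume j: "j = vA"
      show ?thesis
        by (rule *[OF monoid_A finite_A]) (simp only: j sat_A)
    next
      assume j: "j = vB"
      show ?thesis
        by (rule *[OF monoid_B finite_B]) (simp only: j sat_B)
    qed
  qed
  moreover have "j \<in> down j" if "j \<in> down X" for j
    using that down_le[of X] by auto
  ultimately show "identities (models (agree (down X)) :: 'u monoid set) \<subseteq> agree (down X)"
    unfolding agree_def by blast
next
  show "agree (down X) \<subseteq> identities (models (agree (down X)) :: 'u monoid set)"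
    by (auto simp: models_def identities_def)
qed

lemma variety_of_subset_iff:
  "(variety_of X :: 'u monoid set) \<subseteq> variety_of Y \<longleftrightarrow> down X \<subseteq> down Y"
proof
  assume "(variety_of X :: 'u monoid set) \<subseteq> variety_of Y"
  then have "identities (variety_of Y :: 'u monoid set) \<subseteq> identities (variety_of X :: 'u monoid set)"
    by (auto simp: identities_def)
  then show "down X \<subseteq> down Y"
    unfolding variety_of_eq_models identities_models_agree agree_down_subset_iff .
next
  assume "down X \<subseteq> down Y"
  then have "agree (down Y) \<subseteq> (agree (down X) :: (nat list \<times> nat list) set)"
    by (rule agree_mono)
  then show "(variety_of X :: 'u monoid set) \<subseteq> variety_of Y"
    unfolding variety_of_eq_models by (auto simp: models_def)
qed

lemma subvarieties_eq_range:
  "subvarieties (variety_of vA_times_B :: 'u monoid set) = range variety_of"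
proof
  show "subvarieties (variety_of vA_times_B :: 'u monoid set) \<subseteq> range variety_of"
  proof
    fix V :: "'u monoid set" assume "V \<in> subvarieties (variety_of vA_times_B)"
    then have V: "monoid_variety V" "V \<subseteq> models agree_all"
      unfolding subvarieties_def variety_of_eq_models by auto
    then obtain X where "identities V = agree (down X)"
      using identities_eq_agree_down[of V] unfolding monoid_variety_def by blast
    then have "V = variety_of X"
      unfolding variety_of_eq_models using monoid_variety_eq_models[OF inf V(1)] by simp
    then show "V \<in> range variety_of"
      by simp
  qed
  have "(variety_of X :: 'u monoid set) \<subseteq> variety_of vA_times_B" for X
    unfolding variety_of_subset_iff by (rule down_le)
  moreover have "monoid_variety (variety_of X :: 'u monoid set)" for X
    unfolding variety_of_eq_models by (rule monoid_variety_models)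
  ultimately show "range variety_of \<subseteq> subvarieties (variety_of vA_times_B :: 'u monoid set)"
    unfolding subvarieties_def by blast
qed

text \<open>\<open>covered_by\<close> quantifies over all varieties, but one below
  \<open>variety_of Y\<close> is a subvariety of the top and hence again a
  \<open>variety_of W\<close>.\<close>

lemma covered_by_iff:
  "covered_by (variety_of X :: 'u monoid set) (variety_of Y) \<longleftrightarrow>
     down X \<subset> down Y \<and> \<not> (\<exists>W. down X \<subset> down W \<and> down W \<subset> down Y)"
proof -
  have psub: "(variety_of X :: 'u monoid set) \<subset> variety_of Y \<longleftrightarrow> down X \<subset> down Y" for X Y
    unfolding less_le_not_le variety_of_subset_iff ..
  have "(\<exists>V. monoid_variety V \<and> variety_of X \<subset> V \<and> V \<subset> (variety_of Y :: 'u monoid set)) \<longleftrightarrow>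
      (\<exists>W. (variety_of X :: 'u monoid set) \<subset> variety_of W \<and> (variety_of W :: 'u monoid set) \<subset> variety_of Y)"
    (is "?V \<longleftrightarrow> ?W")
  proof
    assume ?V
    then obtain V :: "'u monoid set" where V: "monoid_variety V" "variety_of X \<subset> V" "V \<subset> variety_of Y"
      by blast
    moreover have "(variety_of Y :: 'u monoid set) \<subseteq> variety_of vA_times_B"
      unfolding variety_of_subset_iff by (rule down_le)
    ultimately have "V \<in> subvarieties (variety_of vA_times_B)"
      unfolding subvarieties_def by blast
    then show ?W
      using V unfolding subvarieties_eq_range by blast
  next
    assume ?W
    then show ?V
      using monoid_variety_models unfolding variety_of_eq_models by blast
  qed
  then show ?thesis
    unfolding covered_by_def psub by simp
qed

end

theorem theorem4p5:
  assumes "infinite (UNIV :: 'u set)"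
  shows "subvarieties (var_generated {A_1 \<times>\<times> B_1} :: 'u monoid set) = range variety_of
    \<and> inj (variety_of :: label \<Rightarrow> 'u monoid set)
    \<and> (\<forall>X Y. covered_by (variety_of X :: 'u monoid set) (variety_of Y) \<longleftrightarrow>
        (X, Y) \<in> {(vT, vS), (vS, vN), (vN, vM),
          (vM, vL), (vM, vR), (vL, vB0), (vR, vB0),
          (vB0, vA0), (vB0, vQ), (vA0, vA_meet_B), (vQ, vA_meet_B),
          (vA_meet_B, vA), (vA_meet_B, vB), (vA, vA_times_B), (vB, vA_times_B)})"
proof (intro conjI allI)
  show "subvarieties (var_generated {A_1 \<times>\<times> B_1} :: 'u monoid set) = range variety_of"
    using subvarieties_eq_range[OF assms] by simp
  show "inj (variety_of :: label \<Rightarrow> 'u monoid set)"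
    by (rule injI, rule down_inj) (simp add: set_eq_subset variety_of_subset_iff[OF assms])
  show "covered_by (variety_of X :: 'u monoid set) (variety_of Y) \<longleftrightarrow>
        (X, Y) \<in> {(vT, vS), (vS, vN), (vN, vM),
          (vM, vL), (vM, vR), (vL, vB0), (vR, vB0),
          (vB0, vA0), (vB0, vQ), (vA0, vA_meet_B), (vQ, vA_meet_B),
          (vA_meet_B, vA), (vA_meet_B, vB), (vA, vA_times_B), (vB, vA_times_B)}" for X Y
    unfolding covered_by_iff[OF assms] by (rule down_cover_iff[unfolded covers_def])
qed

end
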